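(* Let $\mathbf{a}\in\mathfrak{A}_3$ with $a_{(12)}\neq a_{(13)}=a_{(23)}$. There are exactly $3$ simple $\mathcal{A}_{[\mathbf{a}]}$-modules up to isomorphism, namely $\Bbbk_e$, $\Bbbk_{(12)}$ and $L$. Moreover, $M_e$ is the projective cover, and the injective hull, of $\Bbbk_e$; $M_{(12)}$ is the projective cover, and the injective hull, of $\Bbbk_{(12)}$; and $M_{(13)(23)}$ is the projective cover, and the injective hull, of $L$.
   Context: $\Bbbk$ is an algebraically closed field of characteristic $0$. $\mathcal{O}_2^3=\{(12),(13),(23)\}\subset\mathbb{S}_3$; $\Bbbk^{\mathbb{S}_3}$ is the algebra of functions on $\mathbb{S}_3$ with basis the characteristic functions $\delta_g$ of $\{g\}$, $g\in\mathbb{S}_3$. $\mathfrak{A}_3=\{\mathbf{a}=(a_{(12)},a_{(13)},a_{(23)})\in\Bbbk^3: a_{(12)}+a_{(13)}+a_{(23)}=0\}$. For $\mathbf{a}\in\mathfrak{A}_3$ and $(ij)\in\mathcal{O}_2^3$ put $f_{ij}=\sum_{g\in\mathbb{S}_3}(a_{(ij)}-a_{g^{-1}(ij)g})\delta_g\in\Bbbk^{\mathbb{S}_3}$. $\mathcal{A}_{[\mathbf{a}]}$ is the algebra generated by $\Bbbk^{\mathbb{S}_3}$ and $x_{(12)},x_{(13)},x_{(23)}$ with relations $\delta_h x_{(ij)}=x_{(ij)}\delta_{(ij)h}$ ($h\in\mathbb{S}_3$), $x_{(ij)}^2=f_{ij}$, $x_{(13)}x_{(23)}+x_{(23)}x_{(12)}+x_{(12)}x_{(13)}=0$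 and $x_{(23)}x_{(13)}+x_{(13)}x_{(12)}+x_{(12)}x_{(23)}=0$. (It is known to have dimension $72$ and to contain $\Bbbk^{\mathbb{S}_3}$ as a subalgebra; it is a Hopf algebra with $\Delta(x_{(ij)})=x_{(ij)}\otimes1+\sum_{h\in\mathbb{S}_3}\operatorname{sgn}(h)\delta_h\otimes x_{h^{-1}(ij)h}$ and $\Bbbk^{\mathbb{S}_3}$ as Hopf subalgebra.) Modules are left modules. For an $\mathcal{A}_{[\mathbf{a}]}$-module $M$ and $g\in\mathbb{S}_3$, $M[g]=\delta_g\cdot M$. The Verma module is $M_g=\mathcal{A}_{[\mathbf{a}]}\otimes_{\Bbbk^{\mathbb{S}_3}}\Bbbk_g$, where $\Bbbk_g$ is the one-dimensional $\Bbbk^{\mathbb{S}_3}$-module with $f\cdot 1=f(g)1$. Assume $a_{(12)}\neq a_{(13)}=a_{(23)}$. For $h\in\{e,(12)\}$, $\Bbbk_h$ also denotes the one-dimensional $\mathcal{A}_{[\mathbf{a}]}$-module on which every $x_{(ij)}$ acts by $0$ and $f\in\Bbbk^{\mathbb{S}_3}$ acts by $f(h)$. $L$ is the $\mathcal{A}_{[\mathbf{a}]}$-module with basis $\{v_{(13)},v_{(23)},v_{(13)(23)},v_{(23)(13)}\}$, $v_g\in L[g]$, and $x_{(ij)}\cdot v_g=0$ if $g=(ij)$; $x_{(ij)}\cdot v_g=v_{(ij)g}$ if $g\neq(ij)$ and $\operatorname{sgn} g=-1$; $x_{(ij)}\cdot v_g=f_{ij}(g)v_{(ij)g}$ if $\operatorname{sgn}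 g=1$ (read as $0$ when $(ij)g=(12)$, since then $f_{ij}(g)=0$). *)

theory Defs
  imports "HOL-Computational_Algebra.Polynomial" "HOL-Algebra.Algebra"
begin

section \<open>Left modules over a not necessarily commutative ring\<close>

text \<open>The locale \<^locale>\<open>module\<close> of HOL-Algebra requires a commutative ring of scalars;
  apart from that the axioms below are the same. The records \<^typ>\<open>('a, 'b) module\<close> and the locale
  \<^locale>\<open>submodule\<close> make no commutativity assumption and are used as they are.\<close>

locale left_module = R?: ring R + M?: abelian_group M
  for R :: "('a, 'c) ring_scheme" (structure) and M :: "('a, 'b, 'd) module_scheme" (structure) +
  assumes smult_closed [simp, intro]:
      "\<lbrakk>r \<in> carrier R; x \<in> carrier M\<rbrakk> \<Longrightarrow> r \<odot>\<^bsub>M\<^esub> x \<in> carrier M"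
    and smult_l_distr:
      "\<lbrakk>r \<in> carrier R; s \<in> carrier R; x \<in> carrier M\<rbrakk> \<Longrightarrow>
        (r \<oplus>\<^bsub>R\<^esub> s) \<odot>\<^bsub>M\<^esub> x = r \<odot>\<^bsub>M\<^esub> x \<oplus>\<^bsub>M\<^esub> s \<odot>\<^bsub>M\<^esub> x"
    and smult_r_distr:
      "\<lbrakk>r \<in> carrier R; x \<in> carrier M; y \<in> carrier M\<rbrakk> \<Longrightarrow>
        r \<odot>\<^bsub>M\<^esub> (x \<oplus>\<^bsub>M\<^esub> y) = r \<odot>\<^bsub>M\<^esub> x \<oplus>\<^bsub>M\<^esub> r \<odot>\<^bsub>M\<^esub> y"
    and smult_assoc1:
      "\<lbrakk>r \<in> carrier R; s \<in> carrier R; x \<in> carrier M\<rbrakk> \<Longrightarrow>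
        (r \<otimes>\<^bsub>R\<^esub> s) \<odot>\<^bsub>M\<^esub> x = r \<odot>\<^bsub>M\<^esub> (s \<odot>\<^bsub>M\<^esub> x)"
    and smult_one [simp]: "x \<in> carrier M \<Longrightarrow> \<one>\<^bsub>R\<^esub> \<odot>\<^bsub>M\<^esub> x = x"

definition lmod_hom ::
  "('a, 'c) ring_scheme \<Rightarrow> ('a, 'm, 'd) module_scheme \<Rightarrow> ('a, 'n, 'e) module_scheme \<Rightarrow> ('m \<Rightarrow> 'n) set"
  where "lmod_hom R M N = {h \<in> carrier M \<rightarrow> carrier N.
    (\<forall>x\<in>carrier M. \<forall>y\<in>carrier M. h (x \<oplus>\<^bsub>M\<^esub> y) = h x \<oplus>\<^bsub>N\<^esub> h y) \<and>
    (\<forall>r\<in>carrier R. \<forall>x\<in>carrier M. h (r \<odot>\<^bsub>M\<^esub> x) = r \<odot>\<^bsub>N\<^esub> h x)}"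

definition lmod_iso ::
  "('a, 'c) ring_scheme \<Rightarrow> ('a, 'm, 'd) module_scheme \<Rightarrow> ('a, 'n, 'e) module_scheme \<Rightarrow> bool"
  where "lmod_iso R M N \<longleftrightarrow> (\<exists>h\<in>lmod_hom R M N. bij_betw h (carrier M) (carrier N))"

definition simple_module :: "('a, 'c) ring_scheme \<Rightarrow> ('a, 'm, 'd) module_scheme \<Rightarrow> bool"
  where "simple_module R M \<longleftrightarrow> left_module R M \<and> carrier M \<noteq> {\<zero>\<^bsub>M\<^esub>} \<and>
    (\<forall>U. submodule U R M \<longrightarrow> U = {\<zero>\<^bsub>M\<^esub>} \<or> U = carrier M)"

definition superfluous_submodule :: "'m set \<Rightarrow> ('a, 'c) ring_scheme \<Rightarrow> ('a, 'm, 'd) module_scheme \<Rightarrow> bool"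
  where "superfluous_submodule K R M \<longleftrightarrow> submodule K R M \<and>
    (\<forall>U. submodule U R M \<and> U <+>\<^bsub>M\<^esub> K = carrier M \<longrightarrow> U = carrier M)"

definition essential_submodule :: "'m set \<Rightarrow> ('a, 'c) ring_scheme \<Rightarrow> ('a, 'm, 'd) module_scheme \<Rightarrow> bool"
  where "essential_submodule K R M \<longleftrightarrow> submodule K R M \<and>
    (\<forall>U. submodule U R M \<and> U \<inter> K = {\<zero>\<^bsub>M\<^esub>} \<longrightarrow> U = {\<zero>\<^bsub>M\<^esub>})"

text \<open>A formula of HOL cannot quantify over all modules, only over those whose elements come from
  a given type. The element types of the test modules in the lifting and extension properties are
  therefore parameters; a theorem that leaves them as type variables covers all modules.\<close>

definition projective_module ::
  "'n itself \<Rightarrow> 'p itself \<Rightarrow> ('a, 'c) ring_scheme \<Rightarrow> ('a, 'm, 'd) module_scheme \<Rightarrow> bool"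
  where "projective_module TN TP R P \<longleftrightarrow> left_module R P \<and>
    (\<forall>(N :: ('a, 'n) module) (Q :: ('a, 'p) module). left_module R N \<longrightarrow> left_module R Q \<longrightarrow>
      (\<forall>g\<in>lmod_hom R N Q. \<forall>f\<in>lmod_hom R P Q. g ` carrier N = carrier Q \<longrightarrow>
        (\<exists>h\<in>lmod_hom R P N. \<forall>x\<in>carrier P. g (h x) = f x)))"

definition injective_module ::
  "'n itself \<Rightarrow> 'p itself \<Rightarrow> ('a, 'c) ring_scheme \<Rightarrow> ('a, 'm, 'd) module_scheme \<Rightarrow> bool"
  where "injective_module TN TP R E \<longleftrightarrow> left_module R E \<and>
    (\<forall>(N :: ('a, 'n) module) (Q :: ('a, 'p) module). left_module R N \<longrightarrow> left_module R Q \<longrightarrow>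
      (\<forall>g\<in>lmod_hom R N Q. \<forall>f\<in>lmod_hom R N E. inj_on g (carrier N) \<longrightarrow>
        (\<exists>h\<in>lmod_hom R Q E. \<forall>x\<in>carrier N. h (g x) = f x)))"

definition projective_cover ::
  "'n itself \<Rightarrow> 'p itself \<Rightarrow> ('a, 'c) ring_scheme \<Rightarrow> ('a, 'm, 'd) module_scheme \<Rightarrow>
    ('a, 's, 'e) module_scheme \<Rightarrow> bool"
  where "projective_cover TN TP R P S \<longleftrightarrow> projective_module TN TP R P \<and> left_module R S \<and>
    (\<exists>h\<in>lmod_hom R P S. h ` carrier P = carrier S \<and> superfluous_submodule (a_kernel P S h) R P)"

definition injective_hull ::
  "'n itself \<Rightarrow> 'p itself \<Rightarrow> ('a, 'c) ring_scheme \<Rightarrow> ('a, 'm, 'd) module_scheme \<Rightarrow>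
    ('a, 's, 'e) module_scheme \<Rightarrow> bool"
  where "injective_hull TN TP R E S \<longleftrightarrow> injective_module TN TP R E \<and> left_module R S \<and>
    (\<exists>h\<in>lmod_hom R S E. inj_on h (carrier S) \<and> essential_submodule (h ` carrier S) R E)"

section \<open>Induced modules\<close>

text \<open>The module \<open>A \<otimes>\<^sub>B N\<close> along \<open>\<iota> : B \<rightarrow> A\<close>: the free abelian group on pairs modulo the biadditive
  and \<open>B\<close>-balanced relations, with \<open>A\<close> acting on the left factor.\<close>

definition tensor_relators ::
  "('a, 'c) ring_scheme \<Rightarrow> ('b, 'd) ring_scheme \<Rightarrow> ('b \<Rightarrow> 'a) \<Rightarrow> ('b, 'n, 'e) module_scheme \<Rightarrow>
    ('a \<times> 'n \<Rightarrow>\<^sub>0 int) set"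
  where "tensor_relators A B \<iota> N =
    {frag_of (x \<oplus>\<^bsub>A\<^esub> y, n) - frag_of (x, n) - frag_of (y, n) | x y n.
      x \<in> carrier A \<and> y \<in> carrier A \<and> n \<in> carrier N} \<union>
    {frag_of (x, m \<oplus>\<^bsub>N\<^esub> n) - frag_of (x, m) - frag_of (x, n) | x m n.
      x \<in> carrier A \<and> m \<in> carrier N \<and> n \<in> carrier N} \<union>
    {frag_of (x \<otimes>\<^bsub>A\<^esub> \<iota> b, n) - frag_of (x, b \<odot>\<^bsub>N\<^esub> n) | x b n.
      x \<in> carrier A \<and> b \<in> carrier B \<and> n \<in> carrier N}"

definition induced_module ::
  "('a, 'c) ring_scheme \<Rightarrow> ('b, 'd) ring_scheme \<Rightarrow> ('b \<Rightarrow> 'a) \<Rightarrow> ('b, 'n, 'e) module_scheme \<Rightarrow>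
    ('a, ('a \<times> 'n \<Rightarrow>\<^sub>0 int) set) module"
  where "induced_module A B \<iota> N =
    (let F = free_Abelian_group (carrier A \<times> carrier N);
         K = generate F (tensor_relators A B \<iota> N)
     in \<lparr>carrier = rcosets\<^bsub>F\<^esub> K, monoid.mult = undefined, monoid.one = undefined,
         ring.zero = K, ring.add = (\<lambda>U V. U <#>\<^bsub>F\<^esub> V),
         module.smult = (\<lambda>x U. the_elem
           ((\<lambda>c. K #>\<^bsub>F\<^esub> frag_extend (\<lambda>(y, n). frag_of (x \<otimes>\<^bsub>A\<^esub> y, n)) c) ` U))\<rparr>)"

section \<open>Free algebras\<close>

text \<open>The free algebra is the monoid algebra of the free monoid. Multiplication on
  \<^typ>\<open>'b \<Rightarrow>\<^sub>0 'c\<close> is convolution with respect to the additive operation of the index type,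
  so the free monoid is written additively.\<close>

datatype 'g word = Word (letters: "'g list")

instantiation word :: (type) monoid_add
begin
definition zero_word_def: "0 = Word []"
definition plus_word_def: "u + v = Word (letters u @ letters v)"
instance by standard (auto simp: zero_word_def plus_word_def)
end

definition free_algebra :: "'g set \<Rightarrow> ('g word \<Rightarrow>\<^sub>0 'k::comm_ring_1) ring"
  where "free_algebra G =
    \<lparr>carrier = {p. \<forall>w\<in>Poly_Mapping.keys p. set (letters w) \<subseteq> G},
     monoid.mult = (*), monoid.one = 1, ring.zero = 0, ring.add = (+)\<rparr>"

definition gen :: "'g \<Rightarrow> ('g word \<Rightarrow>\<^sub>0 'k::comm_ring_1)"
  where "gen g = Poly_Mapping.single (Word [g]) 1"

definition const :: "'k \<Rightarrow> ('g word \<Rightarrow>\<^sub>0 'k::comm_ring_1)"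
  where "const c = Poly_Mapping.single 0 c"

lemma ring_free_algebra: "ring (free_algebra G :: ('g word \<Rightarrow>\<^sub>0 'k::comm_ring_1) ring)"
  (is "ring ?R")
proof -
  have mult: "set (letters w) \<subseteq> G"
    if p: "\<forall>w\<in>Poly_Mapping.keys p. set (letters w) \<subseteq> G"
      and q: "\<forall>w\<in>Poly_Mapping.keys q. set (letters w) \<subseteq> G"
      and w: "w \<in> Poly_Mapping.keys (p * q)" for p q :: "'g word \<Rightarrow>\<^sub>0 'k" and w
  proof -
    obtain u v where "w = u + v" "u \<in> Poly_Mapping.keys p" "v \<in> Poly_Mapping.keys q"
      using w keys_mult[of p q] by blast
    then show ?thesis
      using p q by (simp add: plus_word_def)
  qed
  show ?thesis
  proof (rule ringI)
    show "abelian_group ?R"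
    proof (rule abelian_groupI)
      fix p assume "p \<in> carrier ?R"
      then show "\<exists>q\<in>carrier ?R. q \<oplus>\<^bsub>?R\<^esub> p = \<zero>\<^bsub>?R\<^esub>"
        by (intro bexI[of _ "- p"]) (simp_all add: free_algebra_def)
    next
      fix p q assume "p \<in> carrier ?R" "q \<in> carrier ?R"
      then show "p \<oplus>\<^bsub>?R\<^esub> q \<in> carrier ?R"
        using Poly_Mapping.keys_add[of p q] by (auto simp: free_algebra_def)
    qed (simp_all add: free_algebra_def ac_simps)
    show "Group.monoid ?R"
    proof (rule monoidI)
      fix p q assume "p \<in> carrier ?R" "q \<in> carrier ?R"
      then show "p \<otimes>\<^bsub>?R\<^esub> q \<in> carrier ?R"
        using mult[of p q] by (simp add: free_algebra_def)
    qed (simp_all add: free_algebra_def zero_word_def mult.assoc)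
  qed (simp_all add: free_algebra_def distrib_left distrib_right)
qed

section \<open>The algebra\<close>

abbreviation S3 :: "(nat \<Rightarrow> nat) set"
  where "S3 \<equiv> carrier (sym_group 3)"

abbreviation t12 :: "nat \<Rightarrow> nat" where "t12 \<equiv> transpose 1 2"
abbreviation t13 :: "nat \<Rightarrow> nat" where "t13 \<equiv> transpose 1 3"
abbreviation t23 :: "nat \<Rightarrow> nat" where "t23 \<equiv> transpose 2 3"

definition transpositions3 :: "(nat \<Rightarrow> nat) set"
  where "transpositions3 = {t12, t13, t23}"

text \<open>Functions on \<open>S3\<close> are represented by functions that vanish outside \<open>S3\<close>.\<close>

definition fun_S3 :: "((nat \<Rightarrow> nat) \<Rightarrow> 'k::field) ring"
  where "fun_S3 = \<lparr>carrier = {f. \<forall>g. g \<notin> S3 \<longrightarrow> f g = 0},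
    monoid.mult = (\<lambda>f f' g. f g * f' g), monoid.one = (\<lambda>g. if g \<in> S3 then 1 else 0),
    ring.zero = (\<lambda>_. 0), ring.add = (\<lambda>f f' g. f g + f' g)\<rparr>"

definition delta :: "(nat \<Rightarrow> nat) \<Rightarrow> (nat \<Rightarrow> nat) \<Rightarrow> 'k::field"
  where "delta g = (\<lambda>h. if h = g then 1 else 0)"

text \<open>Only the values of a parameter \<open>a\<close> on the three transpositions are ever used.\<close>

definition params3 :: "((nat \<Rightarrow> nat) \<Rightarrow> 'k::field) set"
  where "params3 = {a. a t12 + a t13 + a t23 = 0}"

definition f_elt :: "((nat \<Rightarrow> nat) \<Rightarrow> 'k::field) \<Rightarrow> (nat \<Rightarrow> nat) \<Rightarrow> (nat \<Rightarrow> nat) \<Rightarrow> 'k"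
  where "f_elt a t = (\<lambda>h. \<Sum>g\<in>S3. (a t - a (inv' g \<circ> t \<circ> g)) * delta g h)"

datatype 'k alg_gen = Fn "(nat \<Rightarrow> nat) \<Rightarrow> 'k" | Tr "nat \<Rightarrow> nat"

definition alg_gens :: "'k::field alg_gen set"
  where "alg_gens = Fn ` carrier fun_S3 \<union> Tr ` transpositions3"

abbreviation fn :: "((nat \<Rightarrow> nat) \<Rightarrow> 'k::field) \<Rightarrow> 'k alg_gen word \<Rightarrow>\<^sub>0 'k"
  where "fn f \<equiv> gen (Fn f)"

abbreviation xt :: "(nat \<Rightarrow> nat) \<Rightarrow> 'k::field alg_gen word \<Rightarrow>\<^sub>0 'k"
  where "xt t \<equiv> gen (Tr t)"

text \<open>The first four sets say that \<open>f \<mapsto> fn f\<close> is a unital algebra map on the functions on \<open>S3\<close>.\<close>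

definition relators :: "((nat \<Rightarrow> nat) \<Rightarrow> 'k::field) \<Rightarrow> ('k alg_gen word \<Rightarrow>\<^sub>0 'k) set"
  where "relators a =
    {fn (f \<oplus>\<^bsub>fun_S3\<^esub> f') - (fn f + fn f') | f f'. f \<in> carrier fun_S3 \<and> f' \<in> carrier fun_S3} \<union>
    {fn (\<lambda>g. c * f g) - const c * fn f | c f. f \<in> carrier fun_S3} \<union>
    {fn (f \<otimes>\<^bsub>fun_S3\<^esub> f') - fn f * fn f' | f f'. f \<in> carrier fun_S3 \<and> f' \<in> carrier fun_S3} \<union>
    {fn \<one>\<^bsub>fun_S3\<^esub> - 1} \<union>
    {fn (delta h) * xt t - xt t * fn (delta (t \<circ> h)) | h t. h \<in> S3 \<and> t \<in> transpositions3} \<union>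
    {xt t * xt t - fn (f_elt a t) | t. t \<in> transpositions3} \<union>
    {xt t13 * xt t23 + xt t23 * xt t12 + xt t12 * xt t13,
     xt t23 * xt t13 + xt t13 * xt t12 + xt t12 * xt t23}"

lemma relators_closed: "relators a \<subseteq> carrier (free_algebra alg_gens)"
proof -
  interpret R: ring "free_algebra alg_gens :: ('a alg_gen word \<Rightarrow>\<^sub>0 'a) ring"
    by (rule ring_free_algebra)
  let ?C = "carrier (free_algebra alg_gens) :: ('a alg_gen word \<Rightarrow>\<^sub>0 'a) set"
  have gen: "gen g \<in> ?C" if "g \<in> alg_gens" for g
    using that by (simp add: free_algebra_def gen_def)
  have const: "const c \<in> ?C" for c
    by (simp add: free_algebra_def const_def zero_word_def)
  have add: "p + q \<in> ?C" and mult: "p * q \<in> ?C" and diff: "p - q \<in> ?C" and one: "1 \<in> ?C"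
    if "p \<in> ?C" "q \<in> ?C" for p q
  proof -
    show "p + q \<in> ?C" "p * q \<in> ?C" "1 \<in> ?C"
      using R.add.m_closed[OF that] R.m_closed[OF that] R.one_closed by (simp_all add: free_algebra_def)
    have "- q \<in> ?C"
      using that by (simp add: free_algebra_def)
    then show "p - q \<in> ?C"
      using R.add.m_closed[OF that(1), of "- q"] by (simp add: free_algebra_def)
  qed
  have fn: "fn f \<in> ?C" if "f \<in> carrier fun_S3" for f
    using that by (intro gen) (simp add: alg_gens_def)
  have xt: "xt t \<in> ?C" if "t \<in> transpositions3" for t
    using that by (intro gen) (simp add: alg_gens_def)
  have S3: "t \<circ> h \<in> S3" if "t \<in> transpositions3" "h \<in> S3" for t h
    using that by (auto simp: transpositions3_def sym_group_carrier intro!: permutes_compose permutes_swap_id)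
  have delta: "delta h \<in> carrier fun_S3" if "h \<in> S3" for h
    using that by (auto simp: fun_S3_def delta_def)
  have f_elt: "f_elt a t \<in> carrier fun_S3" for t
    by (auto simp: fun_S3_def f_elt_def delta_def intro!: sum.neutral)
  have "t12 \<in> transpositions3" "t13 \<in> transpositions3" "t23 \<in> transpositions3"
    by (simp_all add: transpositions3_def)
  moreover have "f \<oplus>\<^bsub>fun_S3\<^esub> f' \<in> carrier fun_S3" "f \<otimes>\<^bsub>fun_S3\<^esub> f' \<in> carrier fun_S3"
    "(\<lambda>g. c * f g) \<in> carrier fun_S3" if "f \<in> carrier fun_S3" "f' \<in> carrier fun_S3" for f f' :: "(nat \<Rightarrow> nat) \<Rightarrow> 'a" and c
    using that by (simp_all add: fun_S3_def)
  moreover have "\<one>\<^bsub>fun_S3\<^esub> \<in> carrier (fun_S3 :: ((nat \<Rightarrow> nat) \<Rightarrow> 'a) ring)"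
    by (simp add: fun_S3_def)
  moreover have "1 \<in> ?C"
    by (rule one[OF const const])
  ultimately show ?thesis
    unfolding relators_def using delta delta[OF S3] f_elt
    by (auto intro!: add mult diff fn xt const)
qed

definition rel_ideal :: "((nat \<Rightarrow> nat) \<Rightarrow> 'k::field) \<Rightarrow> ('k alg_gen word \<Rightarrow>\<^sub>0 'k) set"
  where "rel_ideal a = Idl\<^bsub>free_algebra alg_gens\<^esub> (relators a)"

text \<open>Scalars act on an \<open>alg_A a\<close>-module through the classes of \<open>const c\<close>, so modules over the ring
  \<open>alg_A a\<close> are the same as modules over the algebra, and likewise for their homomorphisms.\<close>

definition alg_A :: "((nat \<Rightarrow> nat) \<Rightarrow> 'k::field) \<Rightarrow> ('k alg_gen word \<Rightarrow>\<^sub>0 'k) set ring"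
  where "alg_A a = free_algebra alg_gens Quot rel_ideal a"

lemma ring_alg_A: "ring (alg_A a)"
  unfolding alg_A_def rel_ideal_def
  by (intro ideal.quotient_is_ring ring.genideal_ideal ring_free_algebra relators_closed)

definition fun_S3_map ::
  "((nat \<Rightarrow> nat) \<Rightarrow> 'k::field) \<Rightarrow> ((nat \<Rightarrow> nat) \<Rightarrow> 'k) \<Rightarrow> ('k alg_gen word \<Rightarrow>\<^sub>0 'k) set"
  where "fun_S3_map a f = rel_ideal a +>\<^bsub>free_algebra alg_gens\<^esub> fn f"

section \<open>The modules\<close>

definition point_module :: "(nat \<Rightarrow> nat) \<Rightarrow> ((nat \<Rightarrow> nat) \<Rightarrow> 'k::field, 'k) module"
  where "point_module g = \<lparr>carrier = UNIV, monoid.mult = undefined, monoid.one = undefined,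
    ring.zero = 0, ring.add = (+), module.smult = (\<lambda>f c. f g * c)\<rparr>"

definition verma ::
  "((nat \<Rightarrow> nat) \<Rightarrow> 'k::field) \<Rightarrow> (nat \<Rightarrow> nat) \<Rightarrow>
    (('k alg_gen word \<Rightarrow>\<^sub>0 'k) set, (('k alg_gen word \<Rightarrow>\<^sub>0 'k) set \<times> 'k \<Rightarrow>\<^sub>0 int) set) module"
  where "verma a g = induced_module (alg_A a) fun_S3 (fun_S3_map a) (point_module g)"

text \<open>\<open>graded_module a B \<xi>\<close> is the vector space with a basis \<open>v\<^sub>g\<close> for \<open>g \<in> B\<close>, realized as
  \<open>delta g\<close>, where \<open>f\<close> acts on \<open>v\<^sub>g\<close> by \<open>f g\<close> and \<open>xt t\<close> sends \<open>v\<^sub>g\<close> to \<open>\<xi> t g\<close>. The action of the free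
  algebra descends to \<^term>\<open>alg_A a\<close> provided that it kills the relators; \<^const>\<open>the_elem\<close> picks
  the common value of the action of all representatives.\<close>

fun gen_act ::
  "(nat \<Rightarrow> nat) set \<Rightarrow> ((nat \<Rightarrow> nat) \<Rightarrow> (nat \<Rightarrow> nat) \<Rightarrow> (nat \<Rightarrow> nat) \<Rightarrow> 'k::field) \<Rightarrow>
    'k alg_gen \<Rightarrow> ((nat \<Rightarrow> nat) \<Rightarrow> 'k) \<Rightarrow> ((nat \<Rightarrow> nat) \<Rightarrow> 'k)"
  where
    "gen_act B \<xi> (Fn f) v = (\<lambda>g. f g * v g)"
  | "gen_act B \<xi> (Tr t) v = (\<lambda>h. \<Sum>g\<in>B. v g * \<xi> t g h)"

definition free_act ::
  "(nat \<Rightarrow> nat) set \<Rightarrow> ((nat \<Rightarrow> nat) \<Rightarrow> (nat \<Rightarrow> nat) \<Rightarrow> (nat \<Rightarrow> nat) \<Rightarrow> 'k::field) \<Rightarrow>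
    ('k alg_gen word \<Rightarrow>\<^sub>0 'k) \<Rightarrow> ((nat \<Rightarrow> nat) \<Rightarrow> 'k) \<Rightarrow> ((nat \<Rightarrow> nat) \<Rightarrow> 'k)"
  where "free_act B \<xi> p v =
    (\<lambda>h. \<Sum>w\<in>Poly_Mapping.keys p. Poly_Mapping.lookup p w * foldr (gen_act B \<xi>) (letters w) v h)"

definition graded_module ::
  "(nat \<Rightarrow> nat) set \<Rightarrow> ((nat \<Rightarrow> nat) \<Rightarrow> (nat \<Rightarrow> nat) \<Rightarrow> (nat \<Rightarrow> nat) \<Rightarrow> 'k::field) \<Rightarrow>
    (('k alg_gen word \<Rightarrow>\<^sub>0 'k) set, (nat \<Rightarrow> nat) \<Rightarrow> 'k) module"
  where "graded_module B \<xi> = \<lparr>carrier = {v. \<forall>g. g \<notin> B \<longrightarrow> v g = 0},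
    monoid.mult = undefined, monoid.one = undefined, ring.zero = (\<lambda>_. 0), ring.add = (\<lambda>u v g. u g + v g),
    module.smult = (\<lambda>r v. the_elem ((\<lambda>p. free_act B \<xi> p v) ` r))\<rparr>"

definition k_module :: "(nat \<Rightarrow> nat) \<Rightarrow> (('k::field alg_gen word \<Rightarrow>\<^sub>0 'k) set, (nat \<Rightarrow> nat) \<Rightarrow> 'k) module"
  where "k_module h = graded_module {h} (\<lambda>t g. (\<lambda>_. 0))"

definition L_basis :: "(nat \<Rightarrow> nat) set"
  where "L_basis = {t13, t23, t13 \<circ> t23, t23 \<circ> t13}"

definition L_x ::
  "((nat \<Rightarrow> nat) \<Rightarrow> 'k::field) \<Rightarrow> (nat \<Rightarrow> nat) \<Rightarrow> (nat \<Rightarrow> nat) \<Rightarrow> (nat \<Rightarrow> nat) \<Rightarrow> 'k"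
  where "L_x a t g =
    (if g = t then (\<lambda>_. 0)
     else if sign g = -1 then delta (t \<circ> g)
     else if t \<circ> g = t12 then (\<lambda>_. 0)
     else (\<lambda>h. f_elt a t g * delta (t \<circ> g) h))"

definition L_module ::
  "((nat \<Rightarrow> nat) \<Rightarrow> 'k::field) \<Rightarrow> (('k alg_gen word \<Rightarrow>\<^sub>0 'k) set, (nat \<Rightarrow> nat) \<Rightarrow> 'k) module"
  where "L_module a = graded_module L_basis (L_x a)"

end

theory Submission
  imports Defs
begin

text \<open>Verma modules are the projective modules \<open>A \<delta>\<^sub>g\<close>. Rewriting by the relations shows that \<open>M\<^sub>g\<close> has a
  spanning set of twelve words, and an explicit representation on the free vector space over these
  words shows that they form a basis. The coefficient of the longest word \<open>z\<close> is a functional whose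
  Gram matrix with respect to the basis (reversing words on one side) is a signed permutation matrix.
  Hence \<open>M\<^sub>g\<close> is isomorphic to a dual space of a projective right module and is injective.
  For the parameters considered here and \<open>g\<close> one of \<open>e\<close>, \<open>(12)\<close>, \<open>(13)(23)\<close> the weight space \<open>M\<^sub>g[g]\<close> is
  spanned by the generator and its image under \<open>z\<close>, and \<open>z\<close> squares to zero. So \<open>M\<^sub>g\<close> is local, and its
  socle is generated by the image of \<open>z\<close>; this gives the projective covers and the injective hulls.
  In a simple module some weight space for \<open>e\<close>, \<open>(12)\<close> or \<open>(13)(23)\<close> is nonzero, because some generator
  acts injectively on each of the others; so it is a quotient of one of the three local modules.\<close>

text \<open>Verma modules are given as quotients of free abelian groups over a quotient of a free
  algebra, a form unfit for computation. All computation takes place in \<open>nf_module\<close> on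
  twelve coordinates; the two agree because homomorphisms out of either are the same as vectors of
  weight \<open>g\<close> in the target. With a, b, c for \<open>x12\<close>, \<open>x13\<close>,
  \<open>x23\<close>, the twelve words are 1, a, b, ab, ba, aba, each with or without a final c.
  Their independence needs no confluence argument: it suffices that the tables produced by rewriting
  satisfy the relations of the algebra.

  Right modules never occur. The relations are stable under reversing words, so the dual of a left
  module is again a left module, and a homomorphism into the model is determined by a single linear
  functional. The test modules for injectivity have arbitrary dimension, which is why functionals
  are extended by Zorn's lemma.\<close>

type_synonym perm = "nat \<Rightarrow> nat"

section \<open>Left modules\<close>

lemma (in abelian_group) eq_iff_minus_zero:
  assumes "x \<in> carrier G" "y \<in> carrier G"
  shows "x = y \<longleftrightarrow> x \<oplus> \<ominus> y = \<zero>"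
proof
  assume "x \<oplus> \<ominus> y = \<zero>"
  then have "\<ominus> (\<ominus> y) = x"
    using assms by (intro minus_equality) auto
  then show "x = y"
    using assms by simp
qed (use assms in \<open>simp add: r_neg\<close>)

context left_module
begin

lemma smult_l_null [simp]:
  assumes x: "x \<in> carrier M"
  shows "\<zero> \<odot>\<^bsub>M\<^esub> x = \<zero>\<^bsub>M\<^esub>"
proof -
  have "\<zero> \<odot>\<^bsub>M\<^esub> x = \<zero> \<odot>\<^bsub>M\<^esub> x \<oplus>\<^bsub>M\<^esub> \<zero> \<odot>\<^bsub>M\<^esub> x"
    using smult_l_distr[OF R.zero_closed R.zero_closed x] by simp
  then show ?thesis
    using M.add.r_cancel_one' x by (metis R.zero_closed smult_closed)
qed

lemma smult_r_null [simp]: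
  assumes r: "r \<in> carrier R"
  shows "r \<odot>\<^bsub>M\<^esub> \<zero>\<^bsub>M\<^esub> = \<zero>\<^bsub>M\<^esub>"
proof -
  have "r \<odot>\<^bsub>M\<^esub> \<zero>\<^bsub>M\<^esub> = r \<odot>\<^bsub>M\<^esub> \<zero>\<^bsub>M\<^esub> \<oplus>\<^bsub>M\<^esub> r \<odot>\<^bsub>M\<^esub> \<zero>\<^bsub>M\<^esub>"
    using smult_r_distr[OF r M.zero_closed M.zero_closed] by simp
  then show ?thesis
    using M.add.r_cancel_one' r by (metis M.zero_closed smult_closed)
qed

lemma smult_l_minus:
  assumes "r \<in> carrier R" "x \<in> carrier M"
  shows "(\<ominus> r) \<odot>\<^bsub>M\<^esub> x = \<ominus>\<^bsub>M\<^esub> (r \<odot>\<^bsub>M\<^esub> x)"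
proof -
  have "(\<ominus> r) \<odot>\<^bsub>M\<^esub> x \<oplus>\<^bsub>M\<^esub> r \<odot>\<^bsub>M\<^esub> x = \<zero>\<^bsub>M\<^esub>"
    using smult_l_distr[of "\<ominus> r" r x] assms by (simp add: R.l_neg)
  then show ?thesis
    using assms by (simp add: M.minus_equality)
qed

text \<open>Closure under negation is not asked for: the negative of a vector is its product with
  the scalar \<open>\<ominus> \<one>\<close>.\<close>

lemma submoduleI:
  assumes sub: "U \<subseteq> carrier M" and zero: "\<zero>\<^bsub>M\<^esub> \<in> U"
    and add: "\<And>x y. x \<in> U \<Longrightarrow> y \<in> U \<Longrightarrow> x \<oplus>\<^bsub>M\<^esub> y \<in> U"
    and smult: "\<And>r x. r \<in> carrier R \<Longrightarrow> x \<in> U \<Longrightarrow> r \<odot>\<^bsub>M\<^esub> x \<in> U"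
  shows "submodule U R M"
proof (intro submodule.intro submodule_axioms.intro)
  have "\<ominus>\<^bsub>M\<^esub> x \<in> U" if "x \<in> U" for x
    using smult[of "\<ominus> \<one>" x] that sub smult_l_minus[of \<one> x] by auto
  then show "subgroup U (add_monoid M)"
    using sub zero add by (intro M.add.subgroupI) (auto simp: a_inv_def)
qed (use smult in auto)

lemma submoduleD:
  assumes "submodule U R M"
  shows "U \<subseteq> carrier M" and "\<zero>\<^bsub>M\<^esub> \<in> U"
    and "\<And>x y. x \<in> U \<Longrightarrow> y \<in> U \<Longrightarrow> x \<oplus>\<^bsub>M\<^esub> y \<in> U"
    and "\<And>r x. r \<in> carrier R \<Longrightarrow> x \<in> U \<Longrightarrow> r \<odot>\<^bsub>M\<^esub> x \<in> U"
    and "\<And>x. x \<in> U \<Longrightarrow> \<ominus>\<^bsub>M\<^esub> x \<in> U"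
proof -
  interpret U: submodule U R M by (rule assms)
  show "U \<subseteq> carrier M" "\<zero>\<^bsub>M\<^esub> \<in> U"
    using U.subset U.one_closed by simp_all
  show "\<And>x y. x \<in> U \<Longrightarrow> y \<in> U \<Longrightarrow> x \<oplus>\<^bsub>M\<^esub> y \<in> U"
    using U.m_closed by simp
  show "\<And>r x. r \<in> carrier R \<Longrightarrow> x \<in> U \<Longrightarrow> r \<odot>\<^bsub>M\<^esub> x \<in> U"
    by (rule U.smult_closed)
  show "\<And>x. x \<in> U \<Longrightarrow> \<ominus>\<^bsub>M\<^esub> x \<in> U"
    using U.m_inv_closed by (simp add: a_inv_def)
qed

lemma submodule_carrier: "submodule (carrier M) R M"
  by (rule submoduleI) auto

lemma submodule_zero: "submodule {\<zero>\<^bsub>M\<^esub>} R M"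
  by (rule submoduleI) auto

end

section \<open>Homomorphisms, kernels and images of submodules\<close>

lemma lmod_homI:
  assumes "\<And>x. x \<in> carrier M \<Longrightarrow> h x \<in> carrier N"
    and "\<And>x y. x \<in> carrier M \<Longrightarrow> y \<in> carrier M \<Longrightarrow> h (x \<oplus>\<^bsub>M\<^esub> y) = h x \<oplus>\<^bsub>N\<^esub> h y"
    and "\<And>r x. r \<in> carrier R \<Longrightarrow> x \<in> carrier M \<Longrightarrow> h (r \<odot>\<^bsub>M\<^esub> x) = r \<odot>\<^bsub>N\<^esub> h x"
  shows "h \<in> lmod_hom R M N"
  using assms by (auto simp: lmod_hom_def)

lemma lmod_homD:
  assumes "h \<in> lmod_hom R M N"
  shows "\<And>x. x \<in> carrier M \<Longrightarrow> h x \<in> carrier N"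
    and "\<And>x y. x \<in> carrier M \<Longrightarrow> y \<in> carrier M \<Longrightarrow> h (x \<oplus>\<^bsub>M\<^esub> y) = h x \<oplus>\<^bsub>N\<^esub> h y"
    and "\<And>r x. r \<in> carrier R \<Longrightarrow> x \<in> carrier M \<Longrightarrow> h (r \<odot>\<^bsub>M\<^esub> x) = r \<odot>\<^bsub>N\<^esub> h x"
  using assms by (auto simp: lmod_hom_def)

lemma lmod_hom_compose:
  assumes "g \<in> lmod_hom R M N" "h \<in> lmod_hom R N L"
  shows "h \<circ> g \<in> lmod_hom R M L"
  using assms by (intro lmod_homI) (simp_all add: lmod_homD)

locale left_module_hom = M: left_module R M + N: left_module R N
  for R :: "('a, 'c) ring_scheme" (structure) and M :: "('a, 'm, 'd) module_scheme"
    and N :: "('a, 'n, 'e) module_scheme" and h +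
  assumes hom: "h \<in> lmod_hom R M N"
begin

lemmas closed = lmod_homD(1)[OF hom]
  and add = lmod_homD(2)[OF hom]
  and smult = lmod_homD(3)[OF hom]

lemma zero: "h \<zero>\<^bsub>M\<^esub> = \<zero>\<^bsub>N\<^esub>"
  using smult[of \<zero> "\<zero>\<^bsub>M\<^esub>"] closed by simp

lemma minus: "x \<in> carrier M \<Longrightarrow> h (\<ominus>\<^bsub>M\<^esub> x) = \<ominus>\<^bsub>N\<^esub> h x"
  using smult[of "\<ominus> \<one>" x] closed by (simp add: M.smult_l_minus N.smult_l_minus)

lemma kernel_iff: "x \<in> a_kernel M N h \<longleftrightarrow> x \<in> carrier M \<and> h x = \<zero>\<^bsub>N\<^esub>"
  by (simp add: a_kernel_def')

lemma submodule_vimage: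
  assumes U: "submodule U R N"
  shows "submodule {x \<in> carrier M. h x \<in> U} R M"
  using N.submoduleD[OF U] by (intro M.submoduleI) (auto simp: closed add smult zero)

lemma submodule_image:
  assumes U: "submodule U R M"
  shows "submodule (h ` U) R N"
proof -
  note D = M.submoduleD[OF U]
  show ?thesis
  proof (rule N.submoduleI)
    fix x y assume "x \<in> h ` U" "y \<in> h ` U"
    then obtain x' y' where "x = h x'" "y = h y'" "x' \<in> U" "y' \<in> U" by blast
    then show "x \<oplus>\<^bsub>N\<^esub> y \<in> h ` U"
      using D by (intro image_eqI[of _ _ "x' \<oplus>\<^bsub>M\<^esub> y'"]) (auto simp: add subset_iff)
  next
    fix r x assume "r \<in> carrier R" "x \<in> h ` U"
    then obtain x' where "x = h x'" "x' \<in> U" by blast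
    then show "r \<odot>\<^bsub>N\<^esub> x \<in> h ` U"
      using D \<open>r \<in> carrier R\<close> by (intro image_eqI[of _ _ "r \<odot>\<^bsub>M\<^esub> x'"]) (auto simp: smult subset_iff)
  qed (use D in \<open>auto simp: closed subset_iff zero[symmetric]\<close>)
qed

lemma submodule_kernel: "submodule (a_kernel M N h) R M"
  using submodule_vimage[OF N.submodule_zero] by (simp add: a_kernel_def')

lemma eq_iff_diff_in_kernel:
  assumes "x \<in> carrier M" "y \<in> carrier M"
  shows "h x = h y \<longleftrightarrow> x \<oplus>\<^bsub>M\<^esub> \<ominus>\<^bsub>M\<^esub> y \<in> a_kernel M N h"
proof -
  have "h (x \<oplus>\<^bsub>M\<^esub> \<ominus>\<^bsub>M\<^esub> y) = h x \<oplus>\<^bsub>N\<^esub> \<ominus>\<^bsub>N\<^esub> h y"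
    using assms by (simp add: add minus)
  then show ?thesis
    using assms closed N.eq_iff_minus_zero[of "h x" "h y"] by (simp add: kernel_iff)
qed

lemma inj_on_if_kernel_trivial:
  assumes "\<And>x. x \<in> carrier M \<Longrightarrow> h x = \<zero>\<^bsub>N\<^esub> \<Longrightarrow> x = \<zero>\<^bsub>M\<^esub>"
  shows "inj_on h (carrier M)"
proof (rule Fun.inj_onI)
  fix x y assume *: "x \<in> carrier M" "y \<in> carrier M" "h x = h y"
  then show "x = y"
    using assms eq_iff_diff_in_kernel[of x y] M.M.eq_iff_minus_zero[of x y]
    by (simp add: kernel_iff)
qed

lemma sum_kernel_eq:
  assumes surj: "h ` carrier M = carrier N" and U: "submodule U R M" and hU: "h ` U = carrier N"
  shows "U <+>\<^bsub>M\<^esub> a_kernel M N h = carrier M"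
proof
  note D = M.submoduleD[OF U]
  show "U <+>\<^bsub>M\<^esub> a_kernel M N h \<subseteq> carrier M"
    using D(1) by (auto simp: set_add_def' kernel_iff)
  show "carrier M \<subseteq> U <+>\<^bsub>M\<^esub> a_kernel M N h"
  proof
    fix x assume x: "x \<in> carrier M"
    then obtain u where u: "u \<in> U" "h x = h u" using hU closed by blast
    then have "x \<oplus>\<^bsub>M\<^esub> \<ominus>\<^bsub>M\<^esub> u \<in> a_kernel M N h"
      using x D(1) eq_iff_diff_in_kernel by blast
    moreover have "x = u \<oplus>\<^bsub>M\<^esub> (x \<oplus>\<^bsub>M\<^esub> \<ominus>\<^bsub>M\<^esub> u)"
      using x u D(1) M.M.a_lcomm[of u x "\<ominus>\<^bsub>M\<^esub> u"] M.M.r_neg[of u] by (auto simp: subset_iff)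
    ultimately show "x \<in> U <+>\<^bsub>M\<^esub> a_kernel M N h"
      using u by (auto simp: set_add_def')
  qed
qed

lemma superfluous_kernel_iff:
  assumes surj: "h ` carrier M = carrier N"
  shows "superfluous_submodule (a_kernel M N h) R M \<longleftrightarrow>
    (\<forall>U. submodule U R M \<longrightarrow> h ` U = carrier N \<longrightarrow> U = carrier M)"
proof -
  have "h ` U = carrier N" if U: "submodule U R M" and UK: "U <+>\<^bsub>M\<^esub> a_kernel M N h = carrier M" for U
  proof
    note sub = M.submoduleD(1)[OF U]
    show "h ` U \<subseteq> carrier N" using sub closed by auto
    show "carrier N \<subseteq> h ` U"
    proof
      fix y assume "y \<in> carrier N"
      then obtain x where "x \<in> U <+>\<^bsub>M\<^esub> a_kernel M N h" "y = h x"
        using surj UK by auto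
      then obtain u k where "u \<in> U" "k \<in> a_kernel M N h" "y = h (u \<oplus>\<^bsub>M\<^esub> k)"
        by (auto simp: set_add_def')
      then show "y \<in> h ` U" using sub closed by (auto simp: add kernel_iff)
    qed
  qed
  then show ?thesis
    using sum_kernel_eq[OF surj] submodule_kernel unfolding superfluous_submodule_def by blast
qed

end

lemma left_module_homI:
  "left_module R M \<Longrightarrow> left_module R N \<Longrightarrow> h \<in> lmod_hom R M N \<Longrightarrow> left_module_hom R M N h"
  by (simp add: left_module_hom_def left_module_hom_axioms_def)

lemma lmod_hom_inv_into:
  assumes "left_module R M" "left_module R N" and f: "f \<in> lmod_hom R M N"
    and bij: "bij_betw f (carrier M) (carrier N)"
  shows "inv_into (carrier M) f \<in> lmod_hom R N M"
proof -
  interpret left_module_hom R M N f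
    by (intro left_module_homI assms)
  let ?g = "inv_into (carrier M) f"
  have g: "?g y \<in> carrier M" "f (?g y) = y" if "y \<in> carrier N" for y
    using that bij by (auto simp: bij_betw_def inv_into_into f_inv_into_f)
  have gf: "?g (f x) = x" if "x \<in> carrier M" for x
    using that bij by (auto simp: bij_betw_def)
  show ?thesis
  proof (rule lmod_homI)
    fix x y assume "x \<in> carrier N" "y \<in> carrier N"
    then show "?g (x \<oplus>\<^bsub>N\<^esub> y) = ?g x \<oplus>\<^bsub>M\<^esub> ?g y"
      using gf[of "?g x \<oplus>\<^bsub>M\<^esub> ?g y"] g by (simp add: add)
  next
    fix r x assume "r \<in> carrier R" "x \<in> carrier N"
    then show "?g (r \<odot>\<^bsub>N\<^esub> x) = r \<odot>\<^bsub>M\<^esub> ?g x"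
      using gf[of "r \<odot>\<^bsub>M\<^esub> ?g x"] g by (simp add: smult)
  qed (use g in auto)
qed

section \<open>Simple modules and uniqueness of simple quotients\<close>

lemma simple_moduleD: "simple_module R S \<Longrightarrow> submodule U R S \<Longrightarrow> U = {\<zero>\<^bsub>S\<^esub>} \<or> U = carrier S"
  by (simp add: simple_module_def)

lemma hom_onto_simple:
  assumes P: "left_module R P" and S: "simple_module R S" and h: "h \<in> lmod_hom R P S"
    and x: "x \<in> carrier P" "h x \<noteq> \<zero>\<^bsub>S\<^esub>"
  shows "h ` carrier P = carrier S"
proof -
  interpret left_module_hom R P S h
    using P S h by (simp add: left_module_homI simple_module_def)
  show ?thesis
    using simple_moduleD[OF S submodule_image[OF M.submodule_carrier]] x by auto
qed

lemma hom_from_simple_inj: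
  assumes P: "left_module R P" and S: "simple_module R S" and h: "h \<in> lmod_hom R S P"
    and x: "x \<in> carrier S" "h x \<noteq> \<zero>\<^bsub>P\<^esub>"
  shows "inj_on h (carrier S)"
proof -
  interpret left_module_hom R S P h
    using P S h by (simp add: left_module_homI simple_module_def)
  have "a_kernel S P h = {\<zero>\<^bsub>S\<^esub>}"
    using simple_moduleD[OF S submodule_kernel] x by (auto simp: a_kernel_def')
  then show ?thesis
    by (intro inj_on_if_kernel_trivial) (auto simp: a_kernel_def')
qed

text \<open>A module with a superfluous maximal submodule is local: that submodule contains every proper
  one, so all simple quotients agree.\<close>

lemma simple_quotient_unique:
  assumes P: "left_module R P" and S: "simple_module R S" and M: "simple_module R M"
    and h: "h \<in> lmod_hom R P S" "h ` carrier P = carrier S"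
    and K: "superfluous_submodule (a_kernel P S h) R P"
    and p: "p \<in> lmod_hom R P M" "p ` carrier P = carrier M"
  shows "lmod_iso R M S"
proof -
  interpret h: left_module_hom R P S h
    using P S h by (simp add: left_module_homI simple_module_def)
  interpret p: left_module_hom R P M p
    using P M p by (simp add: left_module_homI simple_module_def)
  have proper: "a_kernel P M p \<noteq> carrier P"
  proof
    assume "a_kernel P M p = carrier P"
    then have "p ` carrier P = {\<zero>\<^bsub>M\<^esub>}"
      using p.zero h.M.M.zero_closed by (force simp: a_kernel_def')
    then show False
      using M p(2) by (simp add: simple_module_def)
  qed
  \<comment> \<open>Otherwise \<open>h\<close> maps the kernel of \<open>p\<close> onto the simple
    module \<open>S\<close>, and superfluity makes that kernel all of \<open>P\<close>.\<close>
  have "a_kernel P M p \<subseteq> a_kernel P S h"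
  proof (rule ccontr)
    assume "\<not> ?thesis"
    then have "h ` a_kernel P M p = carrier S"
      using simple_moduleD[OF S h.submodule_image[OF p.submodule_kernel]] by (auto simp: a_kernel_def')
    then show False
      using K[unfolded h.superfluous_kernel_iff[OF h(2)]] p.submodule_kernel proper by blast
  qed
  then have eq: "h x = h y" if "x \<in> carrier P" "y \<in> carrier P" "p x = p y" for x y
    using that by (auto simp: p.eq_iff_diff_in_kernel h.eq_iff_diff_in_kernel)
  \<comment> \<open>\<open>s\<close> is only a set-theoretic section of \<open>p\<close>. Still
    \<open>h \<circ> s\<close> is a homomorphism, because \<open>h\<close> is constant on the fibres
    of \<open>p\<close>.\<close>
  define s where "s = inv_into (carrier P) p"
  have s: "s m \<in> carrier P" "p (s m) = m" if "m \<in> carrier M" for m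
    using that p(2) by (auto simp: s_def inv_into_into f_inv_into_f)
  have hs: "h (s (p x)) = h x" if "x \<in> carrier P" for x
    using eq[of "s (p x)" x] s[of "p x"] that p.closed by simp
  have hom: "(\<lambda>m. h (s m)) \<in> lmod_hom R M S"
  proof (rule lmod_homI)
    fix x y assume "x \<in> carrier M" "y \<in> carrier M"
    then show "h (s (x \<oplus>\<^bsub>M\<^esub> y)) = h (s x) \<oplus>\<^bsub>S\<^esub> h (s y)"
      using hs[of "s x \<oplus>\<^bsub>P\<^esub> s y"] s by (simp add: h.add p.add)
  next
    fix r x assume "r \<in> carrier R" "x \<in> carrier M"
    then show "h (s (r \<odot>\<^bsub>M\<^esub> x)) = r \<odot>\<^bsub>S\<^esub> h (s x)"
      using hs[of "r \<odot>\<^bsub>P\<^esub> s x"] s by (simp add: h.smult p.smult)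
  qed (use s h.closed in auto)
  have surj: "(\<lambda>m. h (s m)) ` carrier M = carrier S"
  proof
    show "(\<lambda>m. h (s m)) ` carrier M \<subseteq> carrier S"
      using s h.closed by auto
    show "carrier S \<subseteq> (\<lambda>m. h (s m)) ` carrier M"
    proof
      fix y assume "y \<in> carrier S"
      then obtain x where x: "x \<in> carrier P" "y = h x" using h(2) by auto
      then show "y \<in> (\<lambda>m. h (s m)) ` carrier M"
        using hs[of x] p.closed by (intro image_eqI[of _ _ "p x"]) auto
    qed
  qed
  obtain y where y: "y \<in> carrier S" "y \<noteq> \<zero>\<^bsub>S\<^esub>"
    using S h.N.M.zero_closed unfolding simple_module_def by blast
  obtain m where m: "m \<in> carrier M" "y = h (s m)"
    using surj y(1) by blast
  have "inj_on (\<lambda>m. h (s m)) (carrier M)"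
    by (rule hom_from_simple_inj[OF h.N.left_module_axioms M hom m(1)]) (use y(2) m(2) in blast)
  then show ?thesis
    using hom surj unfolding lmod_iso_def bij_betw_def by blast
qed

text \<open>Allows covers to be established for the coordinate model and then carried over to the
  tensor product. Lifting problems are composed with the isomorphism and its inverse, and
  superfluity is transported through images of submodules.\<close>

lemma projective_cover_cong:
  fixes TN :: "'n itself" and TP :: "'p itself"
  assumes P': "left_module (R :: ('a, 'c) ring_scheme) P'" and iso: "lmod_iso R P' P"
    and cover: "projective_cover TN TP R P S"
  shows "projective_cover TN TP R P' S"
proof -
  obtain f where f: "f \<in> lmod_hom R P' P" and bij: "bij_betw f (carrier P') (carrier P)"
    using iso by (auto simp: lmod_iso_def)
  have P: "left_module R P" and S: "left_module R S" and proj: "projective_module TN TP R P"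
    using cover by (auto simp: projective_cover_def projective_module_def)
  obtain h where h: "h \<in> lmod_hom R P S" "h ` carrier P = carrier S"
    and K: "superfluous_submodule (a_kernel P S h) R P"
    using cover by (auto simp: projective_cover_def)
  define i where "i = inv_into (carrier P') f"
  have i: "i \<in> lmod_hom R P P'"
    unfolding i_def by (rule lmod_hom_inv_into[OF P' P f bij])
  have fi: "f (i x) = x" if "x \<in> carrier P" for x
    using that bij by (auto simp: i_def bij_betw_def f_inv_into_f)
  have i_f: "i (f x) = x" if "x \<in> carrier P'" for x
    using that bij by (auto simp: i_def bij_betw_def)
  interpret f: left_module_hom R P' P f
    using P P' f by (simp add: left_module_homI)
  interpret h: left_module_hom R P S h
    using P S h(1) by (rule left_module_homI)
  interpret hf: left_module_hom R P' S "h \<circ> f"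
    using S P' lmod_hom_compose[OF f h(1)] by (simp add: left_module_homI)
  have "projective_module TN TP R P'"
    unfolding projective_module_def
  proof (intro conjI allI impI ballI)
    fix N :: "('a, 'n) module" and Q :: "('a, 'p) module" and g k
    assume "left_module R N" "left_module R Q" "g \<in> lmod_hom R N Q" "k \<in> lmod_hom R P' Q"
      "g ` carrier N = carrier Q"
    then obtain l where l: "l \<in> lmod_hom R P N" "\<forall>x\<in>carrier P. g (l x) = (k \<circ> i) x"
      using proj lmod_hom_compose[OF i, of k Q] unfolding projective_module_def by blast
    show "\<exists>l\<in>lmod_hom R P' N. \<forall>x\<in>carrier P'. g (l x) = k x"
      using lmod_hom_compose[OF f l(1)] l(2) i_f f.closed by (intro bexI[of _ "l \<circ> f"]) auto
  qed (rule P')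
  moreover have surj: "(h \<circ> f) ` carrier P' = carrier S"
    using bij h(2) by (metis bij_betw_def image_comp)
  moreover have "superfluous_submodule (a_kernel P' S (h \<circ> f)) R P'"
    unfolding hf.superfluous_kernel_iff[OF surj]
  proof (intro allI impI)
    fix U assume U: "submodule U R P'" and hU: "(h \<circ> f) ` U = carrier S"
    have "h ` (f ` U) = carrier S" using hU by (simp add: image_comp)
    then have "f ` U = carrier P"
      using K[unfolded h.superfluous_kernel_iff[OF h(2)]] f.submodule_image[OF U] by blast
    then show "U = carrier P'"
      using f.M.submoduleD(1)[OF U] bij by (metis bij_betw_def inj_on_image_eq_iff order_refl)
  qed
  ultimately show ?thesis
    unfolding projective_cover_def by (intro conjI S bexI[OF _ hf.hom])
qed

lemma injective_hull_cong:
  fixes TN :: "'n itself" and TP :: "'p itself"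
  assumes E': "left_module (R :: ('a, 'c) ring_scheme) E'" and iso: "lmod_iso R E' E"
    and hull: "injective_hull TN TP R E S"
  shows "injective_hull TN TP R E' S"
proof -
  obtain f where f: "f \<in> lmod_hom R E' E" and bij: "bij_betw f (carrier E') (carrier E)"
    using iso by (auto simp: lmod_iso_def)
  have E: "left_module R E" and S: "left_module R S" and inj: "injective_module TN TP R E"
    using hull by (auto simp: injective_hull_def injective_module_def)
  obtain h where h: "h \<in> lmod_hom R S E" "inj_on h (carrier S)"
    and ess: "essential_submodule (h ` carrier S) R E"
    using hull by (auto simp: injective_hull_def)
  define i where "i = inv_into (carrier E') f"
  have i: "i \<in> lmod_hom R E E'"
    unfolding i_def by (rule lmod_hom_inv_into[OF E' E f bij])
  have fi: "f (i x) = x" if "x \<in> carrier E" for x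
    using that bij by (auto simp: i_def bij_betw_def f_inv_into_f)
  have i_f: "i (f x) = x" if "x \<in> carrier E'" for x
    using that bij by (auto simp: i_def bij_betw_def)
  interpret f: left_module_hom R E' E f
    using E E' f by (simp add: left_module_homI)
  interpret ih: left_module_hom R S E' "i \<circ> h"
    using S E' lmod_hom_compose[OF h(1) i] by (simp add: left_module_homI)
  have fih: "f ((i \<circ> h) x) = h x" if "x \<in> carrier S" for x
    using that fi lmod_homD(1)[OF h(1)] by simp
  have "injective_module TN TP R E'"
    unfolding injective_module_def
  proof (intro conjI allI impI ballI)
    fix N :: "('a, 'n) module" and Q :: "('a, 'p) module" and g k
    assume *: "left_module R N" "left_module R Q" "g \<in> lmod_hom R N Q" "k \<in> lmod_hom R N E'"
      "inj_on g (carrier N)"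
    then obtain l where l: "l \<in> lmod_hom R Q E" "\<forall>x\<in>carrier N. l (g x) = (f \<circ> k) x"
      using inj lmod_hom_compose[OF _ f, of k N] unfolding injective_module_def by blast
    show "\<exists>l\<in>lmod_hom R Q E'. \<forall>x\<in>carrier N. l (g x) = k x"
      using lmod_hom_compose[OF l(1) i] l(2) i_f lmod_homD(1)[OF *(4)] by (intro bexI[of _ "i \<circ> l"]) auto
  qed (rule E')
  moreover have "inj_on (i \<circ> h) (carrier S)"
    using h(2) fih by (metis inj_on_def)
  moreover have "essential_submodule ((i \<circ> h) ` carrier S) R E'"
    unfolding essential_submodule_def
  proof (intro conjI allI impI)
    show "submodule ((i \<circ> h) ` carrier S) R E'"
      by (rule ih.submodule_image[OF ih.M.submodule_carrier])
    fix U assume "submodule U R E' \<and> U \<inter> (i \<circ> h) ` carrier S = {\<zero>\<^bsub>E'\<^esub>}"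
    then have U: "submodule U R E'" and US: "U \<inter> (i \<circ> h) ` carrier S = {\<zero>\<^bsub>E'\<^esub>}" by auto
    have UE: "U \<subseteq> carrier E'" by (rule f.M.submoduleD(1)[OF U])
    have h0: "h \<zero>\<^bsub>S\<^esub> = \<zero>\<^bsub>E\<^esub>"
      using fih[OF ih.M.M.zero_closed] by (simp only: ih.zero f.zero)
    have "f ` U \<inter> h ` carrier S = {\<zero>\<^bsub>E\<^esub>}"
    proof -
      have "f u = \<zero>\<^bsub>E\<^esub>" if "u \<in> U" "s \<in> carrier S" "f u = h s" for u s
      proof -
        have "u = (i \<circ> h) s" using that i_f[of u] UE by auto
        then have "u \<in> U \<inter> (i \<circ> h) ` carrier S" using that by blast
        then show ?thesis using f.zero unfolding US by simp
      qed
      moreover have "\<zero>\<^bsub>E\<^esub> \<in> f ` U" "\<zero>\<^bsub>E\<^esub> \<in> h ` carrier S"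
        using imageI[OF f.M.submoduleD(2)[OF U], of f] imageI[OF ih.M.M.zero_closed, of h]
        unfolding f.zero h0 .
      ultimately show ?thesis by blast
    qed
    then have "f ` U = {\<zero>\<^bsub>E\<^esub>}"
      using ess f.submodule_image[OF U] by (simp add: essential_submodule_def)
    then have "f u = f \<zero>\<^bsub>E'\<^esub>" if "u \<in> U" for u
      using that unfolding f.zero by blast
    then have "u = \<zero>\<^bsub>E'\<^esub>" if "u \<in> U" for u
      using that UE bij f.M.M.zero_closed unfolding bij_betw_def by (meson inj_onD subsetD)
    then show "U = {\<zero>\<^bsub>E'\<^esub>}"
      using f.M.submoduleD(2)[OF U] by blast
  qed
  ultimately show ?thesis
    unfolding injective_hull_def by (intro conjI S bexI[OF _ ih.hom])
qed

section \<open>Modules over the algebra in terms of generators\<close>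

lemma free_algebra_simps:
  "p \<in> carrier (free_algebra G) \<longleftrightarrow> (\<forall>w\<in>Poly_Mapping.keys p. set (letters w) \<subseteq> G)"
  "p \<otimes>\<^bsub>free_algebra G\<^esub> q = p * q" "p \<oplus>\<^bsub>free_algebra G\<^esub> q = p + q"
  "\<one>\<^bsub>free_algebra G\<^esub> = 1" "\<zero>\<^bsub>free_algebra G\<^esub> = 0"
  by (simp_all add: free_algebra_def)

declare free_algebra_simps(2-5) [simp]

lemma free_algebra_induct_monomials [consumes 1, case_names monomial add]:
  fixes p :: "'g word \<Rightarrow>\<^sub>0 'k::comm_ring_1"
  assumes p: "p \<in> carrier (free_algebra G)"
    and monomial: "\<And>gs c. set gs \<subseteq> G \<Longrightarrow> P (Poly_Mapping.single (Word gs) c)"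
    and add: "\<And>p q. p \<in> carrier (free_algebra G) \<Longrightarrow> q \<in> carrier (free_algebra G) \<Longrightarrow>
      P p \<Longrightarrow> P q \<Longrightarrow> P (p + q)"
  shows "P p"
proof -
  interpret F: ring "free_algebra G :: ('g word \<Rightarrow>\<^sub>0 'k) ring"
    by (rule ring_free_algebra)
  let ?s = "\<lambda>W. \<Sum>w\<in>W. Poly_Mapping.single w (Poly_Mapping.lookup p w)"
  have "?s W \<in> carrier (free_algebra G) \<and> P (?s W)" if "finite W" "W \<subseteq> Poly_Mapping.keys p" for W
    using that
  proof (induction W rule: finite_induct)
    case empty
    then show ?case using monomial[of "[]" 0] by (simp add: free_algebra_simps(1))
  next
    case (insert w W)
    have w: "set (letters w) \<subseteq> G" using p insert by (auto simp: free_algebra_simps(1))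
    then have "Poly_Mapping.single w (Poly_Mapping.lookup p w) \<in> carrier (free_algebra G)"
      by (auto simp: free_algebra_simps(1))
    moreover have "P (Poly_Mapping.single w (Poly_Mapping.lookup p w))"
      using monomial[of "letters w"] w by simp
    moreover have "?s W \<in> carrier (free_algebra G)" "P (?s W)"
      using insert by auto
    ultimately show ?case
      using insert F.add.m_closed add by (simp)
  qed
  moreover have "p = ?s (Poly_Mapping.keys p)"
  proof (rule poly_mapping_eqI)
    fix w
    show "Poly_Mapping.lookup p w = Poly_Mapping.lookup (?s (Poly_Mapping.keys p)) w"
      by (auto simp: lookup_sum lookup_single when_def in_keys_iff)
  qed
  ultimately show ?thesis
    by (metis finite_keys order_refl)
qed

lemma const_gen_simps:
  "const c + const d = const (c + d)" "const c * const d = const (c * d)"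
  "const 1 = 1" "const 0 = 0" "const c * gen g = gen g * const c"
  "const c \<in> carrier (free_algebra G)" "g \<in> G \<Longrightarrow> gen g \<in> carrier (free_algebra G)"
  by (auto simp: free_algebra_simps(1) const_def gen_def mult_single single_add zero_word_def[symmetric]
      split: if_splits) (simp_all add: zero_word_def)

text \<open>Words are products of letters, so statements about the whole algebra reduce to scalars
  and generators.\<close>

lemma free_algebra_induct [consumes 1, case_names const gen add mult]:
  fixes p :: "'g word \<Rightarrow>\<^sub>0 'k::comm_ring_1"
  assumes p: "p \<in> carrier (free_algebra G)"
    and const: "\<And>c. P (const c)" and gen: "\<And>g. g \<in> G \<Longrightarrow> P (gen g)"
    and add: "\<And>p q. p \<in> carrier (free_algebra G) \<Longrightarrow> q \<in> carrier (free_algebra G) \<Longrightarrow>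
      P p \<Longrightarrow> P q \<Longrightarrow> P (p + q)"
    and mult: "\<And>p q. p \<in> carrier (free_algebra G) \<Longrightarrow> q \<in> carrier (free_algebra G) \<Longrightarrow>
      P p \<Longrightarrow> P q \<Longrightarrow> P (p * q)"
  shows "P p"
  using p
proof (induction rule: free_algebra_induct_monomials)
  case (monomial gs c)
  then show ?case
  proof (induction gs)
    case Nil
    then show ?case using const[of c] by (simp add: const_def zero_word_def)
  next
    case (Cons g gs)
    have "Poly_Mapping.single (Word (g # gs)) c = gen g * Poly_Mapping.single (Word gs) c"
      by (simp add: gen_def mult_single plus_word_def)
    then show ?case
      using Cons mult[OF const_gen_simps(7) _ gen] by (auto simp: free_algebra_simps(1) split: if_splits)
  qed
qed (rule add)

abbreviation "free_alg \<equiv> carrier (free_algebra alg_gens)"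

lemma ideal_rel_ideal: "ideal (rel_ideal a) (free_algebra alg_gens)"
  unfolding rel_ideal_def by (intro ring.genideal_ideal ring_free_algebra relators_closed)

section \<open>The quotient map from the free algebra\<close>

definition alg_class :: "(perm \<Rightarrow> 'k::field) \<Rightarrow> ('k alg_gen word \<Rightarrow>\<^sub>0 'k) \<Rightarrow> ('k alg_gen word \<Rightarrow>\<^sub>0 'k) set"
  where "alg_class a p = rel_ideal a +>\<^bsub>free_algebra alg_gens\<^esub> p"

lemma alg_class_ring_hom: "alg_class a \<in> ring_hom (free_algebra alg_gens) (alg_A a)"
  unfolding alg_class_def[abs_def] alg_A_def by (rule ideal.rcos_ring_hom[OF ideal_rel_ideal])

lemma alg_class_closed [simp]:
  "p \<in> free_alg \<Longrightarrow> alg_class a p \<in> carrier (alg_A a)"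
  by (rule ring_hom_closed[OF alg_class_ring_hom])

lemma alg_class_add:
  "p \<in> free_alg \<Longrightarrow> q \<in> free_alg \<Longrightarrow>
    alg_class a (p + q) = alg_class a p \<oplus>\<^bsub>alg_A a\<^esub> alg_class a q"
  using ring_hom_add[OF alg_class_ring_hom] by (metis free_algebra_simps(3))

lemma alg_class_mult:
  "p \<in> free_alg \<Longrightarrow> q \<in> free_alg \<Longrightarrow>
    alg_class a (p * q) = alg_class a p \<otimes>\<^bsub>alg_A a\<^esub> alg_class a q"
  using ring_hom_mult[OF alg_class_ring_hom] by (metis free_algebra_simps(2))

lemma alg_class_one: "alg_class a 1 = \<one>\<^bsub>alg_A a\<^esub>"
  using ring_hom_one[OF alg_class_ring_hom[of a]] by (simp only: free_algebra_simps)

lemma carrier_alg_A: "carrier (alg_A a) = alg_class a ` free_alg"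
  unfolding alg_A_def FactRing_def A_RCOSETS_def' alg_class_def by auto

lemma alg_class_eqI:
  assumes "p - q \<in> relators a" and q: "q \<in> free_alg"
  shows "alg_class a p = alg_class a q"
proof -
  interpret I: ideal "rel_ideal a" "free_algebra alg_gens" by (rule ideal_rel_ideal)
  have "p - q \<in> rel_ideal a"
    using assms(1) I.genideal_self[OF relators_closed] unfolding rel_ideal_def by auto
  then have "p \<in> alg_class a q"
    unfolding alg_class_def a_r_coset_def' by (auto intro!: bexI[of _ "p - q"])
  then show ?thesis
    unfolding alg_class_def by (rule I.a_repr_independence[symmetric, OF _ q I.a_subgroup])
qed

lemma transposition_comp_S3: "t \<in> transpositions3 \<Longrightarrow> h \<in> S3 \<Longrightarrow> t \<circ> h \<in> S3"
  by (auto simp: transpositions3_def sym_group_carrier intro!: permutes_compose permutes_swap_id)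

lemma transpositions3_S3: "t \<in> transpositions3 \<Longrightarrow> t \<in> S3"
  by (auto simp: transpositions3_def sym_group_carrier intro!: permutes_swap_id)

lemma transpositions3_intros [simp]:
  "t12 \<in> transpositions3" "t13 \<in> transpositions3" "t23 \<in> transpositions3"
  by (simp_all add: transpositions3_def)

lemma delta_fun_S3 [simp]: "h \<in> S3 \<Longrightarrow> delta h \<in> carrier fun_S3"
  by (auto simp: fun_S3_def delta_def)

lemma f_elt_fun_S3 [simp]: "f_elt a t \<in> carrier fun_S3"
  by (auto simp: fun_S3_def f_elt_def delta_def intro!: sum.neutral)

lemma fun_S3_closed:
  "f \<in> carrier fun_S3 \<Longrightarrow> f' \<in> carrier fun_S3 \<Longrightarrow> (\<lambda>g. f g + f' g) \<in> carrier fun_S3"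
  "f \<in> carrier fun_S3 \<Longrightarrow> f' \<in> carrier fun_S3 \<Longrightarrow> (\<lambda>g. f g * f' g) \<in> carrier fun_S3"
  "f \<in> carrier fun_S3 \<Longrightarrow> (\<lambda>g. c * f g) \<in> carrier fun_S3"
  "(\<lambda>g. if g \<in> S3 then 1 else 0) \<in> carrier fun_S3"
  by (simp_all add: fun_S3_def)

lemma gens_closed [simp]:
  "f \<in> carrier fun_S3 \<Longrightarrow> fn f \<in> free_alg"
  "t \<in> transpositions3 \<Longrightarrow> xt t \<in> free_alg"
  "const c \<in> free_alg"
  by (auto intro!: const_gen_simps simp: alg_gens_def)

lemma free_algebra_closed:
  "p \<in> carrier (free_algebra G) \<Longrightarrow> q \<in> carrier (free_algebra G) \<Longrightarrow> p + q \<in> carrier (free_algebra G)"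
  "p \<in> carrier (free_algebra G) \<Longrightarrow> q \<in> carrier (free_algebra G) \<Longrightarrow> p * q \<in> carrier (free_algebra G)"
  "1 \<in> carrier (free_algebra G)" "0 \<in> carrier (free_algebra G)"
  using ring.ring_simprules(1)[OF ring_free_algebra, of p G q]
    ring.ring_simprules(5)[OF ring_free_algebra, of p G q]
    ring.ring_simprules(2,6)[OF ring_free_algebra, of G]
  unfolding free_algebra_simps(2-5) by blast+

section \<open>Scalars, generators and relations as operators on a module\<close>

locale alg_module = left_module "alg_A a" M
  for a :: "perm \<Rightarrow> 'k::field" and M :: "(('k alg_gen word \<Rightarrow>\<^sub>0 'k) set, 'm, 'd) module_scheme" (structure)
begin

definition scal :: "'k \<Rightarrow> 'm \<Rightarrow> 'm"
  where "scal c m = alg_class a (const c) \<odot> m"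

definition act :: "'k alg_gen \<Rightarrow> 'm \<Rightarrow> 'm"
  where "act g m = alg_class a (gen g) \<odot> m"

abbreviation (input) x_op :: "perm \<Rightarrow> 'm \<Rightarrow> 'm"
  where "x_op t \<equiv> act (Tr t)"

abbreviation (input) d_op :: "perm \<Rightarrow> 'm \<Rightarrow> 'm"
  where "d_op g \<equiv> act (Fn (delta g))"

lemma gen_alg_closed [simp]: "g \<in> alg_gens \<Longrightarrow> gen g \<in> free_alg"
  by (rule const_gen_simps(7))

lemma alg_gens_intros [simp]: "f \<in> carrier fun_S3 \<Longrightarrow> Fn f \<in> alg_gens"
  "t \<in> transpositions3 \<Longrightarrow> Tr t \<in> alg_gens"
  by (auto simp: alg_gens_def)

lemma scal_closed [simp]: "m \<in> carrier M \<Longrightarrow> scal c m \<in> carrier M"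
  unfolding scal_def by (intro smult_closed alg_class_closed gens_closed)

lemma act_closed [simp]: "g \<in> alg_gens \<Longrightarrow> m \<in> carrier M \<Longrightarrow> act g m \<in> carrier M"
  unfolding act_def by (intro smult_closed alg_class_closed gen_alg_closed)

lemma smult_add:
  assumes "p \<in> free_alg" "q \<in> free_alg" "m \<in> carrier M"
  shows "alg_class a (p + q) \<odot> m = alg_class a p \<odot> m \<oplus> alg_class a q \<odot> m"
  by (simp only: alg_class_add[OF assms(1,2)] smult_l_distr alg_class_closed assms)

lemma smult_mult:
  assumes "p \<in> free_alg" "q \<in> free_alg" "m \<in> carrier M"
  shows "alg_class a (p * q) \<odot> m = alg_class a p \<odot> (alg_class a q \<odot> m)"
  by (simp only: alg_class_mult[OF assms(1,2)] smult_assoc1 alg_class_closed assms)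

lemma scal_linear:
  assumes "m \<in> carrier M"
  shows "scal (c + d) m = scal c m \<oplus> scal d m" and "scal (c * d) m = scal c (scal d m)"
    and "scal 1 m = m" and "scal 0 m = \<zero>"
proof -
  show "scal (c + d) m = scal c m \<oplus> scal d m" "scal (c * d) m = scal c (scal d m)"
    unfolding scal_def const_gen_simps(1,2)[symmetric] using assms
    by (intro smult_add smult_mult gens_closed; assumption)+
  show "scal 1 m = m"
    using assms by (simp add: scal_def const_gen_simps alg_class_one)
  have "alg_class a 0 \<oplus>\<^bsub>alg_A a\<^esub> alg_class a 0 = alg_class a 0"
    using alg_class_add[OF free_algebra_closed(4,4), of a] by simp
  then have "alg_class a 0 = \<zero>\<^bsub>alg_A a\<^esub>"
    using R.add.l_cancel_one' alg_class_closed[OF free_algebra_closed(4), of a] by metis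
  then show "scal 0 m = \<zero>"
    using assms by (simp add: scal_def const_gen_simps)
qed

lemma scal_add: "m \<in> carrier M \<Longrightarrow> m' \<in> carrier M \<Longrightarrow> scal c (m \<oplus> m') = scal c m \<oplus> scal c m'"
  unfolding scal_def by (intro smult_r_distr alg_class_closed gens_closed)

lemma act_add: "g \<in> alg_gens \<Longrightarrow> m \<in> carrier M \<Longrightarrow> m' \<in> carrier M \<Longrightarrow>
    act g (m \<oplus> m') = act g m \<oplus> act g m'"
  unfolding act_def by (intro smult_r_distr alg_class_closed gen_alg_closed)

lemma scal_zero_right [simp]: "scal c \<zero> = \<zero>"
  unfolding scal_def by (intro smult_r_null alg_class_closed gens_closed)

lemma act_zero [simp]: "g \<in> alg_gens \<Longrightarrow> act g \<zero> = \<zero>"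
  unfolding act_def by (intro smult_r_null alg_class_closed gen_alg_closed)

lemma act_scal: "g \<in> alg_gens \<Longrightarrow> m \<in> carrier M \<Longrightarrow> act g (scal c m) = scal c (act g m)"
  unfolding act_def scal_def
  by (simp only: smult_mult[symmetric] gens_closed gen_alg_closed const_gen_simps(5))

lemma scal_minus_one: "m \<in> carrier M \<Longrightarrow> scal (- 1) m = \<ominus> m"
  using scal_linear(1)[of m "- 1" 1] by (simp add: scal_linear M.minus_equality)

lemma act_relator:
  assumes "p - q \<in> relators a" "q \<in> free_alg"
  shows "alg_class a p \<odot> m = alg_class a q \<odot> m"
  using alg_class_eqI[OF assms] by simp

lemma act_Fn:
  assumes m: "m \<in> carrier M" and f: "f \<in> carrier fun_S3" "f' \<in> carrier fun_S3"
  shows "act (Fn (\<lambda>g. f g + f' g)) m = act (Fn f) m \<oplus> act (Fn f') m"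
    and "act (Fn (\<lambda>g. c * f g)) m = scal c (act (Fn f) m)"
    and "act (Fn (\<lambda>g. f g * f' g)) m = act (Fn f) (act (Fn f') m)"
    and "act (Fn (\<lambda>g. if g \<in> S3 then 1 else 0)) m = m"
proof -
  have "fn (\<lambda>g. f g + f' g) - (fn f + fn f') \<in> relators a"
    "fn (\<lambda>g. c * f g) - const c * fn f \<in> relators a"
    "fn (\<lambda>g. f g * f' g) - fn f * fn f' \<in> relators a"
    "fn (\<lambda>g. if g \<in> S3 then 1 else 0) - 1 \<in> relators a"
    using f unfolding relators_def fun_S3_def by auto
  note rel = this[THEN act_relator]
  show "act (Fn (\<lambda>g. f g + f' g)) m = act (Fn f) m \<oplus> act (Fn f') m"
    unfolding act_def using rel(1) f m
    by (simp only: smult_add free_algebra_closed gens_closed)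
  show "act (Fn (\<lambda>g. c * f g)) m = scal c (act (Fn f) m)"
    unfolding act_def scal_def using rel(2) f m
    by (simp only: smult_mult free_algebra_closed gens_closed)
  show "act (Fn (\<lambda>g. f g * f' g)) m = act (Fn f) (act (Fn f') m)"
    unfolding act_def using rel(3) f m
    by (simp only: smult_mult free_algebra_closed gens_closed)
  show "act (Fn (\<lambda>g. if g \<in> S3 then 1 else 0)) m = m"
    unfolding act_def using rel(4) m
    by (simp only: free_algebra_closed alg_class_one smult_one)
qed

lemma act_relations:
  assumes m: "m \<in> carrier M"
  shows "h \<in> S3 \<Longrightarrow> t \<in> transpositions3 \<Longrightarrow> d_op h (x_op t m) = x_op t (d_op (t \<circ> h) m)"
    and "t \<in> transpositions3 \<Longrightarrow> x_op t (x_op t m) = act (Fn (f_elt a t)) m"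
    and "x_op t13 (x_op t23 m) \<oplus> x_op t23 (x_op t12 m) \<oplus> x_op t12 (x_op t13 m) = \<zero>"
    and "x_op t23 (x_op t13 m) \<oplus> x_op t13 (x_op t12 m) \<oplus> x_op t12 (x_op t23 m) = \<zero>"
proof -
  have zero: "alg_class a 0 \<odot> m = \<zero>"
    using scal_linear(4)[OF m] by (simp add: scal_def const_gen_simps)
  show "d_op h (x_op t m) = x_op t (d_op (t \<circ> h) m)" if "h \<in> S3" "t \<in> transpositions3"
  proof -
    have "fn (delta h) * xt t - xt t * fn (delta (t \<circ> h)) \<in> relators a"
      using that unfolding relators_def by blast
    note act_relator[OF this]
    then show ?thesis
      unfolding act_def using that m
      by (simp only: smult_mult[symmetric] free_algebra_closed gens_closed delta_fun_S3 transposition_comp_S3)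
  qed
  show "x_op t (x_op t m) = act (Fn (f_elt a t)) m" if "t \<in> transpositions3"
  proof -
    have "xt t * xt t - fn (f_elt a t) \<in> relators a"
      using that unfolding relators_def by blast
    note act_relator[OF this]
    then show ?thesis
      unfolding act_def using that m
      by (simp only: smult_mult[symmetric] free_algebra_closed gens_closed f_elt_fun_S3)
  qed
  have "xt t13 * xt t23 + xt t23 * xt t12 + xt t12 * xt t13 - 0 \<in> relators a"
    "xt t23 * xt t13 + xt t13 * xt t12 + xt t12 * xt t23 - 0 \<in> relators a"
    unfolding relators_def diff_zero by blast+
  note rel = this[THEN act_relator, OF free_algebra_closed(4)]
  show "x_op t13 (x_op t23 m) \<oplus> x_op t23 (x_op t12 m) \<oplus> x_op t12 (x_op t13 m) = \<zero>"
    "x_op t23 (x_op t13 m) \<oplus> x_op t13 (x_op t12 m) \<oplus> x_op t12 (x_op t23 m) = \<zero>"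
    unfolding act_def using rel[of m] m zero
    by (simp_all only: smult_mult[symmetric] smult_add[symmetric] free_algebra_closed gens_closed
        transpositions3_intros)
qed

lemma alg_submoduleD:
  assumes "submodule U (alg_A a) M" "x \<in> U"
  shows "scal c x \<in> U" and "g \<in> alg_gens \<Longrightarrow> act g x \<in> U"
  using submoduleD(4)[OF assms(1) alg_class_closed assms(2)] gens_closed gen_alg_closed
  unfolding scal_def act_def by blast+

end

text \<open>The classes of constants and generators generate \<open>alg_A a\<close>, so linearity
  has to be tested only on them.\<close>

lemma alg_module_homI:
  fixes a :: "perm \<Rightarrow> 'k::field"
  assumes M: "alg_module a M" and N: "alg_module a N"
    and closed: "\<And>x. x \<in> carrier M \<Longrightarrow> h x \<in> carrier N"
    and add: "\<And>x y. x \<in> carrier M \<Longrightarrow> y \<in> carrier M \<Longrightarrow> h (x \<oplus>\<^bsub>M\<^esub> y) = h x \<oplus>\<^bsub>N\<^esub> h y"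
    and scal: "\<And>c x. x \<in> carrier M \<Longrightarrow> h (alg_module.scal a M c x) = alg_module.scal a N c (h x)"
    and act: "\<And>g x. g \<in> alg_gens \<Longrightarrow> x \<in> carrier M \<Longrightarrow> h (alg_module.act a M g x) = alg_module.act a N g (h x)"
  shows "h \<in> lmod_hom (alg_A a) M N"
proof (rule lmod_homI[OF closed add])
  interpret M: alg_module a M by (rule M)
  interpret N: alg_module a N by (rule N)
  fix r x assume "r \<in> carrier (alg_A a)" and x: "x \<in> carrier M"
  then obtain p where p: "p \<in> free_alg" "r = alg_class a p"
    unfolding carrier_alg_A by blast
  \<comment> \<open>All \<open>x\<close> are needed at once: for a product, the hypothesis on
    \<open>p\<close> is applied at the image of \<open>x\<close> under \<open>q\<close>.\<close>
  have "\<forall>x\<in>carrier M. h (alg_class a p \<odot>\<^bsub>M\<^esub> x) = alg_class a p \<odot>\<^bsub>N\<^esub> h x"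
    using p(1)
  proof (induction rule: free_algebra_induct)
    case (add p q)
    then show ?case
      using assms(4) closed by (simp add: M.smult_add N.smult_add)
  next
    case (mult p q)
    then show ?case
      using closed by (simp add: M.smult_mult N.smult_mult)
  qed (use scal act in \<open>auto simp: M.scal_def M.act_def N.scal_def N.act_def\<close>)
  then show "h (r \<odot>\<^bsub>M\<^esub> x) = r \<odot>\<^bsub>N\<^esub> h x" using p(2) x by simp
qed

lemma alg_module_homD:
  fixes a :: "perm \<Rightarrow> 'k::field"
  assumes M: "alg_module a M" and N: "alg_module a N" and h: "h \<in> lmod_hom (alg_A a) M N"
    and x: "x \<in> carrier M"
  shows "h (alg_module.scal a M c x) = alg_module.scal a N c (h x)"
    and "g \<in> alg_gens \<Longrightarrow> h (alg_module.act a M g x) = alg_module.act a N g (h x)"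
proof -
  interpret M: alg_module a M by (rule M)
  interpret N: alg_module a N by (rule N)
  show "h (M.scal c x) = N.scal c (h x)"
    unfolding M.scal_def N.scal_def by (intro lmod_homD(3)[OF h] alg_class_closed gens_closed x)
  show "h (M.act g x) = N.act g (h x)" if "g \<in> alg_gens"
    unfolding M.act_def N.act_def by (intro lmod_homD(3)[OF h] alg_class_closed M.gen_alg_closed x that)
qed

text \<open>Keeps \<open>transpose 1 2\<close> in the form in which the definitions mention it.\<close>

declare One_nat_def [simp del]

section \<open>Modules of functions given by operators\<close>

definition word_action :: "('g \<Rightarrow> ('i \<Rightarrow> 'k) \<Rightarrow> ('i \<Rightarrow> 'k)) \<Rightarrow> ('g word \<Rightarrow>\<^sub>0 'k::comm_ring_1) \<Rightarrow> ('i \<Rightarrow> 'k) \<Rightarrow> ('i \<Rightarrow> 'k)"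
  where "word_action ga p v =
    (\<lambda>i. \<Sum>w\<in>Poly_Mapping.keys p. Poly_Mapping.lookup p w * foldr ga (letters w) v i)"

text \<open>\<open>graded_module\<close> with arbitrary index type, carrier and operators. A single
  proof that the action descends to \<open>alg_A a\<close> then serves the simple modules, the
  twelve-dimensional model and the dual spaces.\<close>

definition rep_module ::
  "('i \<Rightarrow> 'k) set \<Rightarrow> ('k alg_gen \<Rightarrow> ('i \<Rightarrow> 'k) \<Rightarrow> ('i \<Rightarrow> 'k)) \<Rightarrow>
    (('k::field alg_gen word \<Rightarrow>\<^sub>0 'k) set, 'i \<Rightarrow> 'k) module"
  where "rep_module C ga = \<lparr>carrier = C,
    monoid.mult = undefined, monoid.one = undefined, ring.zero = (\<lambda>_. 0), ring.add = (\<lambda>u v i. u i + v i),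
    module.smult = (\<lambda>r v. the_elem ((\<lambda>p. word_action ga p v) ` r))\<rparr>"

lemma rep_module_simps [simp]:
  "carrier (rep_module C ga) = C" "\<zero>\<^bsub>rep_module C ga\<^esub> = (\<lambda>_. 0)"
  "u \<oplus>\<^bsub>rep_module C ga\<^esub> v = (\<lambda>i. u i + v i)"
  by (simp_all add: rep_module_def)

lemma graded_module_eq_rep_module:
  "graded_module B \<xi> = rep_module {v. \<forall>g. g \<notin> B \<longrightarrow> v g = 0} (gen_act B \<xi>)"
  by (simp add: graded_module_def rep_module_def free_act_def word_action_def)

lemma word_action_eq_sum:
  assumes "finite W" "Poly_Mapping.keys p \<subseteq> W"
  shows "word_action ga p v i = (\<Sum>w\<in>W. Poly_Mapping.lookup p w * foldr ga (letters w) v i)"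
  unfolding word_action_def using assms by (intro sum.mono_neutral_left) (auto simp: in_keys_iff)

lemma word_action_add: "word_action ga (p + q) v = (\<lambda>i. word_action ga p v i + word_action ga q v i)"
proof
  fix i
  let ?W = "Poly_Mapping.keys p \<union> Poly_Mapping.keys q"
  have "word_action ga (p + q) v i =
      (\<Sum>w\<in>?W. Poly_Mapping.lookup (p + q) w * foldr ga (letters w) v i)"
    using Poly_Mapping.keys_add[of p q] by (intro word_action_eq_sum) auto
  also have "\<dots> = word_action ga p v i + word_action ga q v i"
    by (subst (1 2) word_action_eq_sum[of ?W]) (auto simp: lookup_add distrib_right sum.distrib)
  finally show "word_action ga (p + q) v i = word_action ga p v i + word_action ga q v i" .
qed

lemma word_action_single:
  "word_action ga (Poly_Mapping.single (Word gs) c) v = (\<lambda>i. c * foldr ga gs v i)"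
  by (rule ext) (simp add: word_action_def)

lemma word_action_simps:
  "word_action ga (const c) v = (\<lambda>i. c * v i)"
  "word_action ga (gen g) v = ga g v"
  "word_action ga 0 v = (\<lambda>i. 0)"
  using word_action_single[of ga "[]" c v] word_action_single[of ga "[g]" 1 v]
  by (simp_all add: const_def gen_def zero_word_def word_action_def)

lemma word_action_diff: "word_action ga (p - q) v = (\<lambda>i. word_action ga p v i - word_action ga q v i)"
  using word_action_add[of ga "p - q" q v] by (simp add: fun_eq_iff)

text \<open>A representation given by generators and relations. The axioms are asked only on the
  subspace \<open>C\<close>, since on a dual space the relations hold for linear functionals but not
  for arbitrary functions.\<close>

locale alg_rep =
  fixes a :: "perm \<Rightarrow> 'k::field" and C :: "('i \<Rightarrow> 'k) set"
    and ga :: "'k alg_gen \<Rightarrow> ('i \<Rightarrow> 'k) \<Rightarrow> ('i \<Rightarrow> 'k)"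
  assumes C_zero: "(\<lambda>_. 0) \<in> C" and C_add: "u \<in> C \<Longrightarrow> v \<in> C \<Longrightarrow> (\<lambda>i. u i + v i) \<in> C"
    and C_scale: "v \<in> C \<Longrightarrow> (\<lambda>i. c * v i) \<in> C"
    and ga_closed: "g \<in> alg_gens \<Longrightarrow> v \<in> C \<Longrightarrow> ga g v \<in> C"
    and ga_add: "g \<in> alg_gens \<Longrightarrow> u \<in> C \<Longrightarrow> v \<in> C \<Longrightarrow> ga g (\<lambda>i. u i + v i) = (\<lambda>i. ga g u i + ga g v i)"
    and ga_scale: "g \<in> alg_gens \<Longrightarrow> v \<in> C \<Longrightarrow> ga g (\<lambda>i. c * v i) = (\<lambda>i. c * ga g v i)"
    and Fn_add: "f \<in> carrier fun_S3 \<Longrightarrow> f' \<in> carrier fun_S3 \<Longrightarrow> v \<in> C \<Longrightarrow>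
      ga (Fn (\<lambda>g. f g + f' g)) v = (\<lambda>i. ga (Fn f) v i + ga (Fn f') v i)"
    and Fn_scale: "f \<in> carrier fun_S3 \<Longrightarrow> v \<in> C \<Longrightarrow> ga (Fn (\<lambda>g. c * f g)) v = (\<lambda>i. c * ga (Fn f) v i)"
    and Fn_mult: "f \<in> carrier fun_S3 \<Longrightarrow> f' \<in> carrier fun_S3 \<Longrightarrow> v \<in> C \<Longrightarrow>
      ga (Fn (\<lambda>g. f g * f' g)) v = ga (Fn f) (ga (Fn f') v)"
    and Fn_one: "v \<in> C \<Longrightarrow> ga (Fn (\<lambda>g. if g \<in> S3 then 1 else 0)) v = v"
    and Fn_Tr: "h \<in> S3 \<Longrightarrow> t \<in> transpositions3 \<Longrightarrow> v \<in> C \<Longrightarrow>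
      ga (Fn (delta h)) (ga (Tr t) v) = ga (Tr t) (ga (Fn (delta (t \<circ> h))) v)"
    and Tr_Tr: "t \<in> transpositions3 \<Longrightarrow> v \<in> C \<Longrightarrow> ga (Tr t) (ga (Tr t) v) = ga (Fn (f_elt a t)) v"
    and quadratic: "v \<in> C \<Longrightarrow>
      ga (Tr t13) (ga (Tr t23) v) i + ga (Tr t23) (ga (Tr t12) v) i + ga (Tr t12) (ga (Tr t13) v) i = 0"
      "v \<in> C \<Longrightarrow>
      ga (Tr t23) (ga (Tr t13) v) i + ga (Tr t13) (ga (Tr t12) v) i + ga (Tr t12) (ga (Tr t23) v) i = 0"
begin

lemma foldr_closed: "set gs \<subseteq> alg_gens \<Longrightarrow> v \<in> C \<Longrightarrow> foldr ga gs v \<in> C"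
  by (induction gs) (auto intro: ga_closed)

lemma foldr_add: "set gs \<subseteq> alg_gens \<Longrightarrow> u \<in> C \<Longrightarrow> v \<in> C \<Longrightarrow>
    foldr ga gs (\<lambda>i. u i + v i) = (\<lambda>i. foldr ga gs u i + foldr ga gs v i)"
  by (induction gs) (auto simp: ga_add foldr_closed)

lemma foldr_scale: "set gs \<subseteq> alg_gens \<Longrightarrow> v \<in> C \<Longrightarrow>
    foldr ga gs (\<lambda>i. c * v i) = (\<lambda>i. c * foldr ga gs v i)"
  by (induction gs) (auto simp: ga_scale foldr_closed)

lemma word_action_closed:
  assumes "p \<in> free_alg" "v \<in> C"
  shows "word_action ga p v \<in> C"
  using assms(1)
  by (induction rule: free_algebra_induct_monomials)
    (simp_all add: word_action_single word_action_add C_add C_scale foldr_closed assms(2))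

lemma word_action_linear:
  assumes "p \<in> free_alg" "u \<in> C" "v \<in> C"
  shows "word_action ga p (\<lambda>i. u i + v i) = (\<lambda>i. word_action ga p u i + word_action ga p v i)"
    and "word_action ga p (\<lambda>i. c * v i) = (\<lambda>i. c * word_action ga p v i)"
  using assms(1)
  by (induction rule: free_algebra_induct_monomials)
    (simp_all add: word_action_single word_action_add foldr_add foldr_scale assms(2,3) algebra_simps)

text \<open>Both sides are additive in each factor, so monomials suffice; there a concatenated word
  acts as a composition, because \<open>foldr\<close> applies the last letter first.\<close>

lemma word_action_mult:
  assumes p: "p \<in> free_alg" and q: "q \<in> free_alg"
    and v: "v \<in> C"
  shows "word_action ga (p * q) v = word_action ga p (word_action ga q v)"
  using p
proof (induction rule: free_algebra_induct_monomials)
  case (monomial gs c)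
  from q show ?case
  proof (induction rule: free_algebra_induct_monomials)
    case (monomial hs d)
    then show ?case
      using \<open>set gs \<subseteq> alg_gens\<close>
      by (simp add: mult_single plus_word_def word_action_single foldr_scale foldr_closed v mult.assoc)
  next
    case (add p q)
    then show ?case
      using \<open>set gs \<subseteq> alg_gens\<close>
      by (simp add: distrib_left word_action_add word_action_single foldr_add word_action_closed v)
  qed
qed (simp add: distrib_right word_action_add)

lemma relators_act_zero:
  assumes p: "p \<in> relators a" and v: "v \<in> C"
  shows "word_action ga p v = (\<lambda>_. 0)"
proof -
  note simps = word_action_add word_action_diff word_action_mult word_action_simps v ga_closed
    free_algebra_closed
  have [simp]: "t \<in> transpositions3 \<Longrightarrow> Tr t \<in> (alg_gens :: 'k alg_gen set)" "f \<in> carrier fun_S3 \<Longrightarrow> Fn f \<in> (alg_gens :: 'k alg_gen set)" for t f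
    by (auto simp: alg_gens_def)
  have one: "word_action ga 1 v = v"
    using word_action_simps(1)[of ga 1 v] by (simp add: const_gen_simps)
  from p consider
    f f' :: "perm \<Rightarrow> 'k" where "f \<in> carrier fun_S3" "f' \<in> carrier fun_S3" "p = fn (f \<oplus>\<^bsub>fun_S3\<^esub> f') - (fn f + fn f')"
  | c and f :: "perm \<Rightarrow> 'k" where "f \<in> carrier fun_S3" "p = fn (\<lambda>g. c * f g) - const c * fn f"
  | f f' :: "perm \<Rightarrow> 'k" where "f \<in> carrier fun_S3" "f' \<in> carrier fun_S3" "p = fn (f \<otimes>\<^bsub>fun_S3\<^esub> f') - fn f * fn f'"
  | "p = fn \<one>\<^bsub>fun_S3\<^esub> - 1"
  | h t where "h \<in> S3" "t \<in> transpositions3" "p = fn (delta h) * xt t - xt t * fn (delta (t \<circ> h))"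
  | t where "t \<in> transpositions3" "p = xt t * xt t - fn (f_elt a t)"
  | "p = xt t13 * xt t23 + xt t23 * xt t12 + xt t12 * xt t13"
  | "p = xt t23 * xt t13 + xt t13 * xt t12 + xt t12 * xt t23"
    unfolding relators_def by blast
  then show ?thesis
  proof cases
    case 1
    then show ?thesis using Fn_add[of f f' v] v by (simp add: simps) (simp add: fun_S3_def)
  next
    case 2
    then show ?thesis
      using Fn_scale[of f v c] v by (simp add: simps)
  next
    case 3
    then show ?thesis using Fn_mult[of f f' v] v
      by (simp add: simps) (simp add: fun_S3_def)
  next
    case 4
    then show ?thesis using Fn_one[of v] v one by (simp add: simps) (simp add: fun_S3_def)
  next
    case 5
    then show ?thesis
      using Fn_Tr[of h t v] v transposition_comp_S3[of t h]
      by (simp add: simps)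
  next
    case 6
    then show ?thesis using Tr_Tr[of t v] v by (simp add: simps)
  next
    case 7
    then show ?thesis using quadratic(1)[of v] v by (simp add: simps)
  next
    case 8
    then show ?thesis using quadratic(2)[of v] v by (simp add: simps)
  qed
qed

text \<open>The elements that annihilate \<open>C\<close> form a two-sided ideal, as the action maps
  \<open>C\<close> into itself and fixes zero. This ideal contains the relators, hence the ideal
  they generate.\<close>

lemma rel_ideal_act_zero:
  assumes p: "p \<in> rel_ideal a" and v: "v \<in> C"
  shows "word_action ga p v = (\<lambda>_. 0)"
proof -
  interpret F: ring "free_algebra alg_gens :: ('k alg_gen word \<Rightarrow>\<^sub>0 'k) ring"
    by (rule ring_free_algebra)
  define I where "I = {p \<in> free_alg. \<forall>v\<in>C. word_action ga p v = (\<lambda>_. 0)}"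
  have mult0: "word_action ga p (\<lambda>_. 0) = (\<lambda>_. 0)" if "p \<in> free_alg" for p
    using word_action_linear(2)[OF that C_zero C_zero, of 0] by simp
  have "ideal I (free_algebra alg_gens)"
  proof (rule idealI[OF ring_free_algebra])
    show "subgroup I (add_monoid (free_algebra alg_gens))"
    proof (rule F.add.subgroupI)
      have "0 \<in> I"
        by (simp add: I_def word_action_simps free_algebra_closed)
      then show "I \<noteq> {}" by blast
    next
      fix p assume p: "p \<in> I"
      then have "- p \<in> free_alg" by (simp add: I_def free_algebra_simps(1))
      moreover have "\<ominus>\<^bsub>free_algebra alg_gens\<^esub> p = - p"
        using calculation p unfolding I_def by (intro F.minus_equality) auto
      ultimately show "\<ominus>\<^bsub>free_algebra alg_gens\<^esub> p \<in> I"
        using p word_action_diff[of ga 0 p] by (simp add: I_def word_action_simps)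
    next
      fix p q assume "p \<in> I" "q \<in> I"
      then show "p \<oplus>\<^bsub>free_algebra alg_gens\<^esub> q \<in> I"
        using free_algebra_closed(1)[of p alg_gens q]
        by (simp add: I_def word_action_add)
    qed (auto simp: I_def)
  next
    fix p x :: "'k alg_gen word \<Rightarrow>\<^sub>0 'k"
    assume "p \<in> I" "x \<in> free_alg"
    then show "x \<otimes>\<^bsub>free_algebra alg_gens\<^esub> p \<in> I" "p \<otimes>\<^bsub>free_algebra alg_gens\<^esub> x \<in> I"
      using free_algebra_closed(2)[of p alg_gens x] free_algebra_closed(2)[of x alg_gens p] mult0
      by (simp_all add: I_def word_action_mult word_action_closed)
  qed
  moreover have "relators a \<subseteq> I"
    using relators_act_zero relators_closed[of a] by (auto simp: I_def)
  ultimately have "rel_ideal a \<subseteq> I"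
    unfolding rel_ideal_def by (rule F.genideal_minimal)
  then show ?thesis using assms by (auto simp: I_def)
qed

text \<open>Representatives of a class differ by elements of \<open>rel_ideal a\<close>, which act
  by zero, so the set under \<open>the_elem\<close> is a singleton.\<close>

lemma smult_rep_module:
  assumes p: "p \<in> free_alg" and v: "v \<in> C"
  shows "alg_class a p \<odot>\<^bsub>rep_module C ga\<^esub> v = word_action ga p v"
proof -
  interpret I: ideal "rel_ideal a" "free_algebra alg_gens" by (rule ideal_rel_ideal)
  have "(\<lambda>p. word_action ga p v) ` alg_class a p = {word_action ga p v}"
  proof (intro equalityI subsetI)
    fix u assume "u \<in> (\<lambda>p. word_action ga p v) ` alg_class a p"
    then obtain j where "j \<in> rel_ideal a" "u = word_action ga (j + p) v"
      unfolding alg_class_def a_r_coset_def' by auto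
    then show "u \<in> {word_action ga p v}"
      using rel_ideal_act_zero[OF _ v, of j] by (simp add: word_action_add)
  next
    fix u assume "u \<in> {word_action ga p v}"
    moreover have "p \<in> alg_class a p"
      using I.a_rcos_self[OF p] by (simp add: alg_class_def)
    ultimately show "u \<in> (\<lambda>p. word_action ga p v) ` alg_class a p" by blast
  qed
  then show ?thesis by (simp add: rep_module_def)
qed

lemma alg_module_rep_module: "alg_module a (rep_module C ga)"
  unfolding alg_module_def left_module_def left_module_axioms_def
proof (intro conjI allI impI ring_alg_A)
  show "abelian_group (rep_module C ga)"
  proof (rule abelian_groupI)
    fix x assume "x \<in> carrier (rep_module C ga)"
    then show "\<exists>y\<in>carrier (rep_module C ga). y \<oplus>\<^bsub>rep_module C ga\<^esub> x = \<zero>\<^bsub>rep_module C ga\<^esub>"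
      using C_scale[of x "- 1"] by (intro bexI[of _ "\<lambda>i. - 1 * x i"]) auto
  qed (auto simp: C_zero C_add algebra_simps)
next
  fix r s x y
  assume "r \<in> carrier (alg_A a)" "x \<in> carrier (rep_module C ga)"
  then obtain p where p: "p \<in> free_alg" "r = alg_class a p" and x: "x \<in> C"
    by (auto simp: carrier_alg_A)
  show "r \<odot>\<^bsub>rep_module C ga\<^esub> x \<in> carrier (rep_module C ga)"
    using p x by (simp add: smult_rep_module word_action_closed)
  show "r \<odot>\<^bsub>rep_module C ga\<^esub> (x \<oplus>\<^bsub>rep_module C ga\<^esub> y) =
      r \<odot>\<^bsub>rep_module C ga\<^esub> x \<oplus>\<^bsub>rep_module C ga\<^esub> r \<odot>\<^bsub>rep_module C ga\<^esub> y"
    if "y \<in> carrier (rep_module C ga)"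
    using p x that by (simp add: smult_rep_module word_action_linear C_add)
  assume "s \<in> carrier (alg_A a)"
  then obtain q where q: "q \<in> free_alg" "s = alg_class a q"
    by (auto simp: carrier_alg_A)
  show "(r \<oplus>\<^bsub>alg_A a\<^esub> s) \<odot>\<^bsub>rep_module C ga\<^esub> x =
      r \<odot>\<^bsub>rep_module C ga\<^esub> x \<oplus>\<^bsub>rep_module C ga\<^esub> s \<odot>\<^bsub>rep_module C ga\<^esub> x"
    using p q x by (simp add: smult_rep_module alg_class_add[symmetric] word_action_add
        free_algebra_closed)
  show "(r \<otimes>\<^bsub>alg_A a\<^esub> s) \<odot>\<^bsub>rep_module C ga\<^esub> x =
      r \<odot>\<^bsub>rep_module C ga\<^esub> (s \<odot>\<^bsub>rep_module C ga\<^esub> x)"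
    using p q x by (simp add: smult_rep_module alg_class_mult[symmetric] word_action_mult
        word_action_closed free_algebra_closed)
next
  fix x assume "x \<in> carrier (rep_module C ga)"
  then show "\<one>\<^bsub>alg_A a\<^esub> \<odot>\<^bsub>rep_module C ga\<^esub> x = x"
    using word_action_simps(1)[of ga 1 x] smult_rep_module[OF free_algebra_closed(3), of x]
    by (simp add: alg_class_one[symmetric] const_gen_simps)
qed

sublocale rep: alg_module a "rep_module C ga"
  by (rule alg_module_rep_module)

lemma rep_module_ops [simp]:
  assumes "v \<in> C"
  shows "rep.scal c v = (\<lambda>i. c * v i)" and "g \<in> alg_gens \<Longrightarrow> rep.act g v = ga g v"
  unfolding rep.scal_def rep.act_def using assms
  by (simp_all only: smult_rep_module gens_closed rep.gen_alg_closed word_action_simps)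

end

section \<open>Induced modules\<close>

locale induction_data = A?: ring A + N: abelian_monoid N
  for A :: "('a, 'c) ring_scheme" (structure) and B :: "('b, 'd) ring_scheme" and \<iota> :: "'b \<Rightarrow> 'a"
    and N :: "('b, 'n, 'e) module_scheme" +
  assumes \<iota>_closed: "b \<in> carrier B \<Longrightarrow> \<iota> b \<in> carrier A"
    and N_smult_closed: "b \<in> carrier B \<Longrightarrow> n \<in> carrier N \<Longrightarrow> b \<odot>\<^bsub>N\<^esub> n \<in> carrier N"
begin

declare carrier_free_Abelian_group_iff [simp del]

abbreviation "F \<equiv> free_Abelian_group (carrier A \<times> carrier N)"
abbreviation "K \<equiv> generate F (tensor_relators A B \<iota> N)"
abbreviation "Ind \<equiv> induced_module A B \<iota> N"

definition tensor_class :: "('a \<times> 'n \<Rightarrow>\<^sub>0 int) \<Rightarrow> ('a \<times> 'n \<Rightarrow>\<^sub>0 int) set"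
  where "tensor_class c = K #>\<^bsub>F\<^esub> c"

definition left_mult :: "'a \<Rightarrow> ('a \<times> 'n \<Rightarrow>\<^sub>0 int) \<Rightarrow> ('a \<times> 'n \<Rightarrow>\<^sub>0 int)"
  where "left_mult x = frag_extend (\<lambda>(y, n). frag_of (x \<otimes> y, n))"

lemma F_diff_closed: "c \<in> carrier F \<Longrightarrow> d \<in> carrier F \<Longrightarrow> c - d \<in> carrier F"
  "c \<in> carrier F \<Longrightarrow> d \<in> carrier F \<Longrightarrow> c + d \<in> carrier F"
  using keys_diff[of c d] Poly_Mapping.keys_add[of c d] by (auto simp: carrier_free_Abelian_group_iff)

lemma zero_F [simp]: "0 \<in> carrier F"
  by (simp add: carrier_free_Abelian_group_iff)

lemma F_uminus: "c \<in> carrier F \<Longrightarrow> - c \<in> carrier F" "c \<in> carrier F \<Longrightarrow> inv\<^bsub>F\<^esub> c = - c"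
  by (simp_all add: carrier_free_Abelian_group_iff)

lemma relators_sub: "tensor_relators A B \<iota> N \<subseteq> carrier F"
proof -
  have "frag_of (x, n) \<in> carrier F" if "x \<in> carrier A" "n \<in> carrier N" for x n
    using that by simp
  then show ?thesis
    unfolding tensor_relators_def
    using \<iota>_closed N_smult_closed
    by (auto intro!: F_diff_closed simp del: frag_of_in_free_Abelian_group)
qed

lemma K_subgroup: "subgroup K F"
  by (rule group.generate_is_subgroup[OF group_free_Abelian_group relators_sub])

lemma K_sub: "c \<in> K \<Longrightarrow> c \<in> carrier F"
  using subgroup.subset[OF K_subgroup] by blast

lemma K_closed: "0 \<in> K" "c \<in> K \<Longrightarrow> d \<in> K \<Longrightarrow> c + d \<in> K" "c \<in> K \<Longrightarrow> d \<in> K \<Longrightarrow> c - d \<in> K" "c \<in> K \<Longrightarrow> - c \<in> K"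
proof -
  show zero: "0 \<in> K" using subgroup.one_closed[OF K_subgroup] by simp
  show add: "c + d \<in> K" if "c \<in> K" "d \<in> K" for c d using subgroup.m_closed[OF K_subgroup that] by simp
  show minus: "- c \<in> K" if "c \<in> K" for c
    using subgroup.m_inv_closed[OF K_subgroup that] K_sub[OF that] by (simp add: F_uminus)
  show "c \<in> K \<Longrightarrow> d \<in> K \<Longrightarrow> c - d \<in> K"
    using add[of c "- d"] minus[of d] by simp
qed

lemma tensor_class_eq_iff:
  assumes "c \<in> carrier F" "d \<in> carrier F"
  shows "tensor_class c = tensor_class d \<longleftrightarrow> c - d \<in> K"
proof
  have *: "tensor_class c = {k + c | k. k \<in> K}" for c by (auto simp: tensor_class_def r_coset_def)
  assume "tensor_class c = tensor_class d"
  then have "0 + c \<in> tensor_class d" using K_closed(1) unfolding * by blast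
  then show "c - d \<in> K" by (auto simp: *)
next
  have *: "tensor_class c = {k + c | k. k \<in> K}" for c by (auto simp: tensor_class_def r_coset_def)
  assume cd: "c - d \<in> K"
  have "k + c = (k + (c - d)) + d" "k + d = (k - (c - d)) + c" for k by simp_all
  then show "tensor_class c = tensor_class d"
    unfolding * using K_closed(2,3)[OF _ cd] by blast
qed

lemma left_mult_simps [simp]:
  "left_mult x 0 = 0" "left_mult x (c + d) = left_mult x c + left_mult x d"
  "left_mult x (c - d) = left_mult x c - left_mult x d"
  "left_mult x (frag_of (y, n)) = frag_of (x \<otimes> y, n)"
  by (simp_all add: left_mult_def frag_extend_add frag_extend_diff)

lemma F_induct [consumes 1, case_names zero diff frag]:
  assumes "c \<in> carrier F" and "P 0"
    and "\<And>c d. c \<in> carrier F \<Longrightarrow> d \<in> carrier F \<Longrightarrow> P c \<Longrightarrow> P d \<Longrightarrow> P (c - d)"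
    and "\<And>x n. x \<in> carrier A \<Longrightarrow> n \<in> carrier N \<Longrightarrow> P (frag_of (x, n))"
  shows "P c"
  using free_Abelian_group_induct[of c "carrier A \<times> carrier N" P] assms
  by (auto simp: carrier_free_Abelian_group_iff)

lemma left_mult_closed:
  assumes x: "x \<in> carrier A" and c: "c \<in> carrier F"
  shows "left_mult x c \<in> carrier F"
  using c
proof (induction rule: F_induct)
  case (diff c d)
  then show ?case unfolding left_mult_simps by (intro F_diff_closed)
qed (use x in auto)

lemma K_generators: "c \<in> tensor_relators A B \<iota> N \<Longrightarrow> c \<in> K"
  by (rule generate.incl)

text \<open>Multiplication by \<open>x\<close> turns a relator into a relator of the same kind, by
  distributivity and associativity of \<open>A\<close>. This makes the action on cosets
  single-valued.\<close>

lemma left_mult_K: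
  assumes x: "x \<in> carrier A" and c: "c \<in> K"
  shows "left_mult x c \<in> K"
proof -
  have rel: "left_mult x r \<in> K" if "r \<in> tensor_relators A B \<iota> N" for r
    using that[unfolded tensor_relators_def]
  proof (elim UnE CollectE exE conjE)
    fix y z n assume *: "r = frag_of (y \<oplus> z, n) - frag_of (y, n) - frag_of (z, n)"
      "y \<in> carrier A" "z \<in> carrier A" "n \<in> carrier N"
    show ?thesis
      unfolding * left_mult_simps A.r_distr[OF *(2,3) x]
      using * x by (intro K_generators) (auto simp: tensor_relators_def)
  next
    fix y m n assume *: "r = frag_of (y, m \<oplus>\<^bsub>N\<^esub> n) - frag_of (y, m) - frag_of (y, n)"
      "y \<in> carrier A" "m \<in> carrier N" "n \<in> carrier N"
    show ?thesis
      unfolding * left_mult_simps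
      using * x A.m_closed[of x y] by (intro K_generators) (auto simp: tensor_relators_def)
  next
    fix y b n assume *: "r = frag_of (y \<otimes> \<iota> b, n) - frag_of (y, b \<odot>\<^bsub>N\<^esub> n)"
      "y \<in> carrier A" "b \<in> carrier B" "n \<in> carrier N"
    show ?thesis
      unfolding * left_mult_simps A.m_assoc[OF x *(2) \<iota>_closed[OF *(3)], symmetric]
      using * x A.m_closed[of x y] by (intro K_generators) (auto simp: tensor_relators_def)
  qed
  from c show ?thesis
  proof (induction rule: generate.induct)
    case one
    then show ?case using K_closed(1) by simp
  next
    case (inv h)
    then have "h \<in> carrier F" using relators_sub by blast
    then have "left_mult x (inv\<^bsub>F\<^esub> h) = - left_mult x h"
      using left_mult_simps(3)[of x 0 h] by (simp add: F_uminus)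
    then show ?case using rel[OF inv] K_closed(4) by simp
  next
    case (eng h1 h2)
    then show ?case using K_closed(2) by simp
  qed (use rel in blast)
qed

lemma Ind_simps:
  "carrier Ind = tensor_class ` carrier F" "\<zero>\<^bsub>Ind\<^esub> = tensor_class 0"
  "c \<in> carrier F \<Longrightarrow> d \<in> carrier F \<Longrightarrow> tensor_class c \<oplus>\<^bsub>Ind\<^esub> tensor_class d = tensor_class (c + d)"
  "x \<in> carrier A \<Longrightarrow> c \<in> carrier F \<Longrightarrow> x \<odot>\<^bsub>Ind\<^esub> tensor_class c = tensor_class (left_mult x c)"
proof -
  show "carrier Ind = tensor_class ` carrier F"
    by (auto simp: induced_module_def Let_def RCOSETS_def tensor_class_def)
  have eq: "tensor_class c = {k + c | k. k \<in> K}" for c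
    by (auto simp: tensor_class_def r_coset_def)
  have "\<zero>\<^bsub>Ind\<^esub> = K" by (simp add: induced_module_def Let_def)
  then show "\<zero>\<^bsub>Ind\<^esub> = tensor_class 0" by (simp add: eq)
  have "tensor_class c <#>\<^bsub>F\<^esub> tensor_class d = tensor_class (c + d)"
  proof
    show "tensor_class c <#>\<^bsub>F\<^esub> tensor_class d \<subseteq> tensor_class (c + d)"
    proof
      fix x assume "x \<in> tensor_class c <#>\<^bsub>F\<^esub> tensor_class d"
      then obtain k l where "k \<in> K" "l \<in> K" "x = k + c + (l + d)"
        unfolding set_mult_def eq by auto
      then have "k + l \<in> K" "x = (k + l) + (c + d)"
        using K_closed(2) by (simp_all add: algebra_simps)
      then show "x \<in> tensor_class (c + d)" unfolding eq by blast
    qed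
    show "tensor_class (c + d) \<subseteq> tensor_class c <#>\<^bsub>F\<^esub> tensor_class d"
    proof
      fix x assume "x \<in> tensor_class (c + d)"
      then obtain k where k: "k \<in> K" "x = k + (c + d)" unfolding eq by blast
      have "k + c \<in> tensor_class c" "0 + d \<in> tensor_class d"
        unfolding eq using k(1) K_closed(1) by blast+
      moreover have "x = (k + c) \<otimes>\<^bsub>F\<^esub> (0 + d)" using k(2) by (simp add: add.assoc)
      ultimately show "x \<in> tensor_class c <#>\<^bsub>F\<^esub> tensor_class d"
        unfolding set_mult_def by blast
    qed
  qed
  then show "tensor_class c \<oplus>\<^bsub>Ind\<^esub> tensor_class d = tensor_class (c + d)"
    by (simp add: induced_module_def Let_def)
  show "x \<odot>\<^bsub>Ind\<^esub> tensor_class c = tensor_class (left_mult x c)" if x: "x \<in> carrier A" and c: "c \<in> carrier F"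
  proof -
    have "tensor_class (left_mult x (k + c)) = tensor_class (left_mult x c)" if "k \<in> K" for k
      using left_mult_K[OF x that] left_mult_closed[OF x c] left_mult_closed[OF x K_sub[OF that]]
      by (subst tensor_class_eq_iff) (auto intro: F_diff_closed)
    then have "(\<lambda>c. tensor_class (left_mult x c)) ` tensor_class c = {tensor_class (left_mult x c)}"
      using K_closed(1) unfolding eq[of c] by (auto simp: image_iff)
    then show ?thesis
      by (simp add: induced_module_def Let_def tensor_class_def[symmetric] left_mult_def[symmetric])
  qed
qed

lemma left_module_Ind: "left_module A Ind"
  unfolding left_module_def left_module_axioms_def
proof (intro conjI allI impI A.ring_axioms)
  show "abelian_group Ind"
  proof (rule abelian_groupI)
    fix x assume "x \<in> carrier Ind"
    then obtain c where "c \<in> carrier F" "x = tensor_class c" by (auto simp: Ind_simps)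
    moreover have "- c \<in> carrier F" using calculation by (simp add: F_uminus)
    ultimately show "\<exists>y\<in>carrier Ind. y \<oplus>\<^bsub>Ind\<^esub> x = \<zero>\<^bsub>Ind\<^esub>"
      by (intro bexI[of _ "tensor_class (- c)"])
        (auto simp: Ind_simps)
  next
    fix x y z assume "x \<in> carrier Ind" "y \<in> carrier Ind" "z \<in> carrier Ind"
    then show "(x \<oplus>\<^bsub>Ind\<^esub> y) \<oplus>\<^bsub>Ind\<^esub> z = x \<oplus>\<^bsub>Ind\<^esub> (y \<oplus>\<^bsub>Ind\<^esub> z)"
      by (auto simp: Ind_simps F_diff_closed Groups.add.assoc)
  next
    fix x y assume "x \<in> carrier Ind" "y \<in> carrier Ind"
    then show "x \<oplus>\<^bsub>Ind\<^esub> y \<in> carrier Ind" "x \<oplus>\<^bsub>Ind\<^esub> y = y \<oplus>\<^bsub>Ind\<^esub> x"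
      by (auto simp: Ind_simps F_diff_closed Groups.add.commute)
  qed (auto simp: Ind_simps zero_F)
next
  fix x y u v assume "x \<in> carrier A" "u \<in> carrier Ind"
  then obtain c where x: "x \<in> carrier A" and c: "c \<in> carrier F" "u = tensor_class c"
    by (auto simp: Ind_simps)
  show "x \<odot>\<^bsub>Ind\<^esub> u \<in> carrier Ind"
    using x c left_mult_closed by (auto simp: Ind_simps)
  show "x \<odot>\<^bsub>Ind\<^esub> (u \<oplus>\<^bsub>Ind\<^esub> v) = x \<odot>\<^bsub>Ind\<^esub> u \<oplus>\<^bsub>Ind\<^esub> x \<odot>\<^bsub>Ind\<^esub> v" if "v \<in> carrier Ind"
    using that x c left_mult_closed F_diff_closed
    by (auto simp: Ind_simps)
  assume y: "y \<in> carrier A"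
  \<comment> \<open>Additivity in the scalar holds only modulo \<open>K\<close>: on a generator the
    difference is a relator of the first kind. Associativity, below, holds already for formal
    sums.\<close>
  have "left_mult (x \<oplus> y) c - (left_mult x c + left_mult y c) \<in> K"
    using c(1)
  proof (induction rule: F_induct)
    case (diff c d)
    then show ?case using K_closed(3)[OF diff(3,4)] by (simp add: algebra_simps)
  next
    case (frag z n)
    then have "frag_of (x \<otimes> z \<oplus> y \<otimes> z, n) - frag_of (x \<otimes> z, n) - frag_of (y \<otimes> z, n) \<in> K"
      using x y A.m_closed[of x z] A.m_closed[of y z]
      by (intro K_generators) (auto simp: tensor_relators_def)
    then show ?case using frag x y by (simp add: A.l_distr algebra_simps)
  qed (simp add: K_closed)
  then show "(x \<oplus> y) \<odot>\<^bsub>Ind\<^esub> u = x \<odot>\<^bsub>Ind\<^esub> u \<oplus>\<^bsub>Ind\<^esub> y \<odot>\<^bsub>Ind\<^esub> u"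
    using x y c left_mult_closed F_diff_closed
    by (simp add: Ind_simps tensor_class_eq_iff)
  have "left_mult (x \<otimes> y) c = left_mult x (left_mult y c)"
    using c(1) by (induction rule: F_induct) (use x y in \<open>simp_all add: A.m_assoc\<close>)
  then show "(x \<otimes> y) \<odot>\<^bsub>Ind\<^esub> u = x \<odot>\<^bsub>Ind\<^esub> (y \<odot>\<^bsub>Ind\<^esub> u)"
    using x y c left_mult_closed by (simp add: Ind_simps)
next
  fix u assume "u \<in> carrier Ind"
  then obtain c where c: "c \<in> carrier F" "u = tensor_class c" by (auto simp: Ind_simps)
  have "left_mult \<one> c = c"
    using c(1) by (induction rule: F_induct) simp_all
  then show "\<one> \<odot>\<^bsub>Ind\<^esub> u = u" using c by (simp add: Ind_simps)
qed

text \<open>Universal property of the tensor product. The additive extension of the map sending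
  \<open>(x, n)\<close> to x times \<open>\<phi> n\<close> kills the three kinds of relators by, in
  turn, the module law, additivity of \<phi> and its compatibility with \<open>B\<close>.\<close>

lemma Ind_universal:
  assumes M: "left_module A M" and \<phi>: "\<And>n. n \<in> carrier N \<Longrightarrow> \<phi> n \<in> carrier M"
    and add: "\<And>m n. m \<in> carrier N \<Longrightarrow> n \<in> carrier N \<Longrightarrow> \<phi> (m \<oplus>\<^bsub>N\<^esub> n) = \<phi> m \<oplus>\<^bsub>M\<^esub> \<phi> n"
    and smult: "\<And>b n. b \<in> carrier B \<Longrightarrow> n \<in> carrier N \<Longrightarrow> \<phi> (b \<odot>\<^bsub>N\<^esub> n) = \<iota> b \<odot>\<^bsub>M\<^esub> \<phi> n"
  obtains h where "h \<in> lmod_hom A Ind M"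
    "\<And>x n. x \<in> carrier A \<Longrightarrow> n \<in> carrier N \<Longrightarrow> h (tensor_class (frag_of (x, n))) = x \<odot>\<^bsub>M\<^esub> \<phi> n"
proof -
  interpret M: left_module A M by (rule M)
  obtain k where k: "k \<in> hom F (add_monoid M)"
    and k_of: "\<And>xn. xn \<in> carrier A \<times> carrier N \<Longrightarrow> k (frag_of xn) = fst xn \<odot>\<^bsub>M\<^esub> \<phi> (snd xn)"
    using comm_group.free_Abelian_group_universal[OF M.M.a_comm_group, of "\<lambda>xn. fst xn \<odot>\<^bsub>M\<^esub> \<phi> (snd xn)"
        "carrier A \<times> carrier N"] \<phi> by (auto simp: image_subset_iff)
  interpret k: group_hom F "add_monoid M" k
    using k M.M.a_group by (simp add: group_hom_def group_hom_axioms_def)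
  have k_closed: "k c \<in> carrier M" if "c \<in> carrier F" for c using k.hom_closed[OF that] by simp
  have k_zero: "k 0 = \<zero>\<^bsub>M\<^esub>" using k.hom_one by simp
  have k_add: "k (c + d) = k c \<oplus>\<^bsub>M\<^esub> k d" if "c \<in> carrier F" "d \<in> carrier F" for c d
    using k.hom_mult[OF that] by simp
  have k_diff: "k (c - d) = k c \<oplus>\<^bsub>M\<^esub> \<ominus>\<^bsub>M\<^esub> k d" if "c \<in> carrier F" "d \<in> carrier F" for c d
  proof -
    have "k (- d) = \<ominus>\<^bsub>M\<^esub> k d" using k.hom_inv[OF that(2)] that(2) by (simp add: a_inv_def F_uminus)
    moreover have "- d \<in> carrier F" using that(2) by (simp add: F_uminus)
    ultimately show ?thesis using k_add[OF that(1), of "- d"] by simp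
  qed
  have k_frag: "k (frag_of (x, n)) = x \<odot>\<^bsub>M\<^esub> \<phi> n" if "x \<in> carrier A" "n \<in> carrier N" for x n
    using k_of[of "(x, n)"] that by simp
  have frag_closed: "frag_of (x, n) \<in> carrier F" if "x \<in> carrier A" "n \<in> carrier N" for x n
    using that by simp
  have cancel: "(x \<oplus>\<^bsub>M\<^esub> y) \<oplus>\<^bsub>M\<^esub> \<ominus>\<^bsub>M\<^esub> x \<oplus>\<^bsub>M\<^esub> \<ominus>\<^bsub>M\<^esub> y = \<zero>\<^bsub>M\<^esub>" if "x \<in> carrier M" "y \<in> carrier M" for x y
    using that M.M.eq_iff_minus_zero[of "x \<oplus>\<^bsub>M\<^esub> y" "x \<oplus>\<^bsub>M\<^esub> y"] by (simp add: M.M.minus_add M.M.a_assoc)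
  have "k r = \<zero>\<^bsub>M\<^esub>" if "r \<in> tensor_relators A B \<iota> N" for r
    using that unfolding tensor_relators_def
  proof (elim UnE CollectE exE conjE)
    fix y z n assume *: "r = frag_of (y \<oplus> z, n) - frag_of (y, n) - frag_of (z, n)"
      "y \<in> carrier A" "z \<in> carrier A" "n \<in> carrier N"
    then show ?thesis
      using \<phi> cancel by (simp add: k_diff F_diff_closed k_frag M.smult_l_distr frag_closed del: frag_of_in_free_Abelian_group)
  next
    fix y m n assume *: "r = frag_of (y, m \<oplus>\<^bsub>N\<^esub> n) - frag_of (y, m) - frag_of (y, n)"
      "y \<in> carrier A" "m \<in> carrier N" "n \<in> carrier N"
    then show ?thesis
      using \<phi> cancel by (simp add: k_diff F_diff_closed k_frag M.smult_r_distr add frag_closed del: frag_of_in_free_Abelian_group)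
  next
    fix y b n assume *: "r = frag_of (y \<otimes> \<iota> b, n) - frag_of (y, b \<odot>\<^bsub>N\<^esub> n)"
      "y \<in> carrier A" "b \<in> carrier B" "n \<in> carrier N"
    then show ?thesis
      using \<phi> \<iota>_closed N_smult_closed
      by (simp add: k_diff F_diff_closed k_frag M.smult_assoc1 smult M.M.r_neg frag_closed del: frag_of_in_free_Abelian_group)
  qed
  then have "tensor_relators A B \<iota> N \<subseteq> kernel F (add_monoid M) k"
    using relators_sub by (auto simp: kernel_def)
  then have K: "k c = \<zero>\<^bsub>M\<^esub>" if "c \<in> K" for c
    using group.generate_subgroup_incl[OF group_free_Abelian_group _ k.subgroup_kernel] that
    by (auto simp: kernel_def)
  \<comment> \<open>Defined through a chosen representative; \<open>k\<close> vanishes on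
    \<open>K\<close>, so the choice does not matter.\<close>
  define h where "h U = k (SOME c. c \<in> carrier F \<and> U = tensor_class c)" for U
  have h: "h (tensor_class c) = k c" if c: "c \<in> carrier F" for c
  proof -
    let ?d = "SOME d. d \<in> carrier F \<and> tensor_class c = tensor_class d"
    have d: "?d \<in> carrier F \<and> tensor_class c = tensor_class ?d"
      by (rule someI[of _ c]) (use c in simp)
    then have "c - ?d \<in> K" using c tensor_class_eq_iff by blast
    then have "k c \<oplus>\<^bsub>M\<^esub> \<ominus>\<^bsub>M\<^esub> k ?d = \<zero>\<^bsub>M\<^esub>"
      using K k_diff[OF c, of ?d] d by simp
    then have "k c = k ?d"
      using M.M.eq_iff_minus_zero[of "k c" "k ?d"] k_closed c d by blast
    then show ?thesis by (simp add: h_def)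
  qed
  have k_left_mult: "k (left_mult x c) = x \<odot>\<^bsub>M\<^esub> k c" if x: "x \<in> carrier A" and c: "c \<in> carrier F" for x c
    using c
  proof (induction rule: F_induct)
    case (diff c d)
    have "x \<odot>\<^bsub>M\<^esub> (\<ominus>\<^bsub>M\<^esub> k d) = \<ominus>\<^bsub>M\<^esub> (x \<odot>\<^bsub>M\<^esub> k d)"
      using M.smult_r_distr[OF x, of "\<ominus>\<^bsub>M\<^esub> k d" "k d"] k_closed[OF diff(2)] x
        M.M.minus_equality[of "x \<odot>\<^bsub>M\<^esub> (\<ominus>\<^bsub>M\<^esub> k d)" "x \<odot>\<^bsub>M\<^esub> k d"] by (simp add: M.M.l_neg)
    then show ?case
      using diff x by (simp add: k_diff left_mult_closed M.smult_r_distr k_closed)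
  qed (use x \<phi> in \<open>simp_all add: k_zero k_frag M.smult_assoc1\<close>)
  have "h \<in> lmod_hom A Ind M"
    by (rule lmod_homI) (auto simp: Ind_simps h k_closed k_add F_diff_closed k_left_mult left_mult_closed)
  moreover have "h (tensor_class (frag_of (x, n))) = x \<odot>\<^bsub>M\<^esub> \<phi> n" if "x \<in> carrier A" "n \<in> carrier N" for x n
    using that h[OF frag_closed[OF that]] k_frag by simp
  ultimately show thesis by (rule that)
qed

end

section \<open>Weight spaces\<close>

lemma neq_if_values_neq: "(f 1, f 2) \<noteq> (g 1, g 2) \<Longrightarrow> f \<noteq> (g :: perm)"
  by auto

text \<open>The six permutations are already separated by their values at 1 and 2.\<close>

lemma S3_distinct: "distinct [id, t12, t13, t23, t13 \<circ> t23, t23 \<circ> t13]"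
  unfolding distinct.simps list.set
  by (intro conjI; simp only: insert_iff empty_iff de_Morgan_disj not_False_eq_True simp_thms;
      (intro conjI)?; (rule neq_if_values_neq, simp add: transpose_def)?)

lemma S3_distinct_simps [simp]:
  "id \<noteq> t12" "id \<noteq> t13" "id \<noteq> t23" "id \<noteq> t13 \<circ> t23" "id \<noteq> t23 \<circ> t13"
  "t12 \<noteq> id" "t12 \<noteq> t13" "t12 \<noteq> t23" "t12 \<noteq> t13 \<circ> t23" "t12 \<noteq> t23 \<circ> t13"
  "t13 \<noteq> id" "t13 \<noteq> t12" "t13 \<noteq> t23" "t13 \<noteq> t13 \<circ> t23" "t13 \<noteq> t23 \<circ> t13"
  "t23 \<noteq> id" "t23 \<noteq> t12" "t23 \<noteq> t13" "t23 \<noteq> t13 \<circ> t23" "t23 \<noteq> t23 \<circ> t13"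
  "t13 \<circ> t23 \<noteq> id" "t13 \<circ> t23 \<noteq> t12" "t13 \<circ> t23 \<noteq> t13" "t13 \<circ> t23 \<noteq> t23" "t13 \<circ> t23 \<noteq> t23 \<circ> t13"
  "t23 \<circ> t13 \<noteq> id" "t23 \<circ> t13 \<noteq> t12" "t23 \<circ> t13 \<noteq> t13" "t23 \<circ> t13 \<noteq> t23" "t23 \<circ> t13 \<noteq> t13 \<circ> t23"
  using S3_distinct unfolding distinct.simps list.set by (simp_all only: insert_iff empty_iff de_Morgan_disj simp_thms) (metis+)

lemma S3_eq: "S3 = {id, t12, t13, t23, t13 \<circ> t23, t23 \<circ> t13}"
proof -
  have "{id, t12, t13, t23, t13 \<circ> t23, t23 \<circ> t13} \<subseteq> S3"
    using transposition_comp_S3[of t13 t23] transposition_comp_S3[of t23 t13]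
    by (auto simp: transpositions3_S3 transpositions3_def sym_group_carrier permutes_id permutes_swap_id)
  moreover have "card {id, t12, t13, t23, t13 \<circ> t23, t23 \<circ> t13} = 6"
    using distinct_card[OF S3_distinct] by simp
  moreover have "S3 = {p. p permutes {1..3}}"
    by (auto simp: sym_group_carrier)
  then have "finite S3" "card S3 = 6"
    using finite_permutations[of "{1..3::nat}"] card_permutations[of "{1..3::nat}" 3]
    by (simp_all add: fact_numeral)
  ultimately show ?thesis by (metis card_subset_eq)
qed

lemma finite_S3 [simp]: "finite S3"
  unfolding S3_eq by simp

lemma S3_closed [simp]:
  "id \<in> S3" "t12 \<in> S3" "t13 \<in> S3" "t23 \<in> S3"
  "g \<in> S3 \<Longrightarrow> t12 \<circ> g \<in> S3" "g \<in> S3 \<Longrightarrow> t13 \<circ> g \<in> S3" "g \<in> S3 \<Longrightarrow> t23 \<circ> g \<in> S3"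
  by (auto intro!: transposition_comp_S3 simp: transpositions3_def) (simp_all add: S3_eq)

text \<open>Rewrite rules that bring products of transpositions to one of the six forms of
  \<open>S3_eq\<close>. The trailing \<open>g\<close> lets them apply inside right-nested
  compositions.\<close>

lemma comp_normalize:
  "t12 \<circ> (t12 \<circ> g) = g" "t13 \<circ> (t13 \<circ> g) = g" "t23 \<circ> (t23 \<circ> g) = g"
  "t12 \<circ> (t13 \<circ> g) = t13 \<circ> (t23 \<circ> g)" "t23 \<circ> (t12 \<circ> g) = t13 \<circ> (t23 \<circ> g)"
  "t12 \<circ> (t23 \<circ> g) = t23 \<circ> (t13 \<circ> g)" "t13 \<circ> (t12 \<circ> g) = t23 \<circ> (t13 \<circ> g)"
  "t13 \<circ> (t23 \<circ> (t13 \<circ> g)) = t12 \<circ> g" "t23 \<circ> (t13 \<circ> (t23 \<circ> g)) = t12 \<circ> g"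
  by (auto simp: fun_eq_iff transpose_def)

lemma comp_normalize_closed:
  "t12 \<circ> t12 = id" "t13 \<circ> t13 = id" "t23 \<circ> t23 = id"
  "t12 \<circ> t13 = t13 \<circ> t23" "t23 \<circ> t12 = t13 \<circ> t23"
  "t12 \<circ> t23 = t23 \<circ> t13" "t13 \<circ> t12 = t23 \<circ> t13"
  "t13 \<circ> (t23 \<circ> t13) = t12" "t23 \<circ> (t13 \<circ> t23) = t12"
  using comp_normalize[of id] by simp_all

lemma S3_inv_comp:
  assumes g: "g \<in> S3"
  shows "inv' (t12 \<circ> g) = inv' g \<circ> t12" "inv' (t13 \<circ> g) = inv' g \<circ> t13" "inv' (t23 \<circ> g) = inv' g \<circ> t23"
proof -
  have "bij g" using g permutes_bij by (auto simp: sym_group_carrier)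
  then show "inv' (t12 \<circ> g) = inv' g \<circ> t12" "inv' (t13 \<circ> g) = inv' g \<circ> t13" "inv' (t23 \<circ> g) = inv' g \<circ> t23"
    by (simp_all add: o_inv_distrib)
qed

lemma S3_inv:
  "inv' id = (id :: perm)" "inv' t12 = t12" "inv' t13 = t13" "inv' t23 = t23"
  "inv' (t13 \<circ> t23) = t23 \<circ> t13" "inv' (t23 \<circ> t13) = t13 \<circ> t23"
  by (simp_all add: o_inv_distrib)

section \<open>The functions f_ij through conjugated parameters\<close>

lemma f_elt_eq:
  assumes "h \<in> S3"
  shows "f_elt a t h = a t - a (inv' h \<circ> (t \<circ> h))"
  unfolding f_elt_def delta_def using assms
  by (simp add: if_distrib sum.delta comp_assoc cong: if_cong)

text \<open>Introduced because \<open>a t - conj_param a g t\<close> is the scalar by which the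
  square of the generator for \<open>t\<close> acts on vectors of weight \<open>g\<close>.\<close>

definition conj_param :: "(perm \<Rightarrow> 'k) \<Rightarrow> perm \<Rightarrow> perm \<Rightarrow> 'k"
  where "conj_param a g t = a (inv' g \<circ> (t \<circ> g))"

lemma conj_param_sum:
  assumes "a \<in> params3" "g \<in> S3"
  shows "conj_param a g t12 + conj_param a g t13 + conj_param a g t23 = 0"
  using assms unfolding S3_eq params3_def
  by (auto simp: conj_param_def S3_inv comp_assoc comp_normalize comp_normalize_closed add.commute add.left_commute)

text \<open>Passing from the weight \<open>g\<close> to \<open>t \<circ> g\<close> conjugates the
  argument by \<open>t\<close>, which fixes \<open>t\<close> and swaps the other two transpositions.
  All scalars met along a word are thus expressed by the parameter at its starting weight.\<close>

lemma conj_param_comp: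
  assumes "g \<in> S3"
  shows "conj_param a (t12 \<circ> g) t12 = conj_param a g t12" "conj_param a (t12 \<circ> g) t13 = conj_param a g t23"
    "conj_param a (t12 \<circ> g) t23 = conj_param a g t13" "conj_param a (t13 \<circ> g) t12 = conj_param a g t23"
    "conj_param a (t13 \<circ> g) t13 = conj_param a g t13" "conj_param a (t13 \<circ> g) t23 = conj_param a g t12"
    "conj_param a (t23 \<circ> g) t12 = conj_param a g t13" "conj_param a (t23 \<circ> g) t13 = conj_param a g t12"
    "conj_param a (t23 \<circ> g) t23 = conj_param a g t23"
  using assms by (simp_all add: conj_param_def S3_inv_comp comp_assoc comp_normalize)

lemma f_elt_conj_param:
  "h \<in> S3 \<Longrightarrow> f_elt a t h = a t - conj_param a h t"
  by (simp add: f_elt_eq conj_param_def)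

text \<open>Solving both sum conditions for the third value turns the later checks of the tables
  into polynomial identities in four quantities.\<close>

lemma params3_eliminate:
  assumes "a \<in> params3" "g \<in> S3"
  shows "a t23 = - a t12 - a t13"
    and "conj_param a g t23 = - conj_param a g t12 - conj_param a g t13"
  using assms(1) conj_param_sum[OF assms] by (simp_all add: params3_def eq_neg_iff_add_eq_0 algebra_simps)

section \<open>Weight vectors and the rewriting rules on them\<close>

context alg_module
begin

text \<open>\<delta>_h acts as an idempotent, so its image M[h] is its set of fixed vectors.\<close>

definition wt_space :: "perm \<Rightarrow> 'm set"
  where "wt_space h = {m \<in> carrier M. d_op h m = m}"

lemma wt_space_closed: "m \<in> wt_space h \<Longrightarrow> m \<in> carrier M"
  by (simp add: wt_space_def)

lemma act_Fn_wt:
  assumes "h \<in> S3" "m \<in> wt_space h" "f \<in> carrier fun_S3"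
  shows "act (Fn f) m = scal (f h) m"
proof -
  have m: "m \<in> carrier M" "d_op h m = m" using assms(2) by (auto simp: wt_space_def)
  have "(\<lambda>g. f g * delta h g) = (\<lambda>g. f h * delta h g)"
    by (auto simp: delta_def)
  then show ?thesis
    using act_Fn(2,3)[OF m(1) assms(3) delta_fun_S3[OF assms(1)]] act_Fn(2)[OF m(1) delta_fun_S3[OF assms(1)] assms(3)]
      m(2) by metis
qed

lemma d_op_wt_space:
  assumes "h \<in> S3" "m \<in> carrier M"
  shows "d_op h m \<in> wt_space h"
proof -
  have "(\<lambda>g. delta h g * delta h g) = (delta h :: _ \<Rightarrow> 'k)" by (auto simp: delta_def)
  then show ?thesis
    using act_Fn(3)[OF assms(2) delta_fun_S3[OF assms(1)] delta_fun_S3[OF assms(1)]] assms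
    by (simp add: wt_space_def)
qed

lemma transposition_involution: "t \<in> transpositions3 \<Longrightarrow> t \<circ> (t \<circ> h) = h"
  by (auto simp: transpositions3_def comp_normalize)

lemma x_op_wt_space:
  assumes "h \<in> S3" "m \<in> wt_space h" "t \<in> transpositions3"
  shows "x_op t m \<in> wt_space (t \<circ> h)"
  using assms act_relations(1)[of m "t \<circ> h" t]
  by (auto simp: wt_space_def transposition_comp_S3 transposition_involution)

lemma x_op_wt:
  assumes "h \<in> S3" "m \<in> wt_space h"
  shows "x_op t12 m \<in> wt_space (t12 \<circ> h)" "x_op t13 m \<in> wt_space (t13 \<circ> h)" "x_op t23 m \<in> wt_space (t23 \<circ> h)"
  using x_op_wt_space[OF assms] by simp_all

lemma x_op_square:
  assumes "h \<in> S3" "m \<in> wt_space h" "t \<in> transpositions3"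
  shows "x_op t (x_op t m) = scal (a t - conj_param a h t) m"
  using act_relations(2)[of m t] act_Fn_wt[OF assms(1,2), of "f_elt a t"] assms
  by (simp add: wt_space_closed f_elt_conj_param)

lemma scal_scal: "m \<in> carrier M \<Longrightarrow> scal c (scal d m) = scal (c * d) m"
  by (simp add: scal_linear)

lemma scal_combine:
  assumes "m \<in> carrier M"
  shows "n \<in> carrier M \<Longrightarrow> scal c m \<oplus> (scal d m \<oplus> n) = scal (c + d) m \<oplus> n"
    and "scal c m \<oplus> scal d m = scal (c + d) m"
  using assms by (simp_all add: scal_linear M.a_assoc)

lemma eq_zero_solve:
  assumes "x \<oplus> y \<oplus> z = \<zero>" "x \<in> carrier M" "y \<in> carrier M" "z \<in> carrier M"
  shows "y = scal (- 1) z \<oplus> scal (- 1) x"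
proof -
  have "y \<oplus> (x \<oplus> z) = \<zero>" using assms by (simp add: M.a_ac)
  then have "\<ominus> (x \<oplus> z) = y" using assms by (intro M.minus_equality) auto
  then show ?thesis using assms by (simp add: scal_minus_one M.minus_add M.a_comm)
qed

text \<open>The quadratic relations, here and in the next lemma, are oriented so that
  \<open>x23\<close> moves to the right past \<open>x12\<close> and \<open>x13\<close>. Together
  with the squares they leave at most one \<open>x23\<close>, at the end of a word.\<close>

lemma x23_x12: "m \<in> carrier M \<Longrightarrow>
    x_op t23 (x_op t12 m) = scal (- 1) (x_op t12 (x_op t13 m)) \<oplus> scal (- 1) (x_op t13 (x_op t23 m))"
  using eq_zero_solve[OF act_relations(3)] by simp

lemma x23_x13: "m \<in> carrier M \<Longrightarrow>
    x_op t23 (x_op t13 m) = scal (- 1) (x_op t13 (x_op t12 m)) \<oplus> scal (- 1) (x_op t12 (x_op t23 m))"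
  using eq_zero_solve[of "x_op t12 (x_op t23 m)" "x_op t23 (x_op t13 m)" "x_op t13 (x_op t12 m)"]
    act_relations(4)[of m] by (simp add: M.a_ac)

text \<open>The deformed braid relation arises from the overlap \<open>x23 x12 x12\<close>.\<close>

lemma x_braid:
  assumes h: "h \<in> S3" and m: "m \<in> wt_space h"
  shows "x_op t13 (x_op t12 (x_op t13 m)) =
    x_op t12 (x_op t13 (x_op t12 m)) \<oplus> scal (a t12 - a t13) (x_op t23 m)"
proof -
  have [simp]: "m \<in> carrier M" using m by (rule wt_space_closed)
  let ?aba = "x_op t12 (x_op t13 (x_op t12 m))" and ?bab = "x_op t13 (x_op t12 (x_op t13 m))"
  let ?c = "x_op t23 m"
  have "x_op t23 (x_op t12 (x_op t12 m)) = scal (a t12 - conj_param a h t12) ?c"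
    using h m by (simp add: x_op_square act_scal)
  moreover have "x_op t23 (x_op t12 (x_op t12 m)) =
      scal (- 1) ?aba \<oplus> (?bab \<oplus> scal (a t13 - conj_param a h t12) ?c)"
    using h m x_op_square[OF _ x_op_wt(3)[OF h m], of t13]
    by (subst x23_x12) (simp_all add: x23_x12 act_add act_scal scal_add scal_scal scal_linear(3) conj_param_comp)
  ultimately have eq: "scal (a t12 - conj_param a h t12) ?c =
      scal (- 1) ?aba \<oplus> (?bab \<oplus> scal (a t13 - conj_param a h t12) ?c)" by simp
  \<comment> \<open>The coefficient is split at \<open>conj_param a h t12\<close>, so that its first
    part is the left side of \<open>eq\<close>.\<close>
  have "?aba \<oplus> scal (a t12 - a t13) ?c = ?aba \<oplus>
      (scal (a t12 - conj_param a h t12) ?c \<oplus> scal (conj_param a h t12 - a t13) ?c)"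
    by (simp add: scal_combine)
  also have "\<dots> = ?bab"
    unfolding eq using scal_combine(2)[of ?c "a t13 - conj_param a h t12" "conj_param a h t12 - a t13"]
      M.r_neg2[of ?aba]
    by (simp add: M.a_assoc scal_linear(4) scal_minus_one)
  finally show ?thesis by simp
qed

text \<open>The braid relation replaces \<open>x12 x13 x12\<close> by \<open>x13 x12 x13\<close>
  plus a multiple of \<open>x23\<close>; then the leading \<open>x13\<close> meets a second one and
  the square applies.\<close>

lemma x13_aba:
  assumes h: "h \<in> S3" and m: "m \<in> wt_space h"
  shows "x_op t13 (x_op t12 (x_op t13 (x_op t12 m))) =
    scal (a t13 - conj_param a h t12) (x_op t12 (x_op t13 m)) \<oplus>
    scal (a t13 - a t12) (x_op t13 (x_op t23 m))"
proof -
  have [simp]: "m \<in> carrier M" using m by (rule wt_space_closed)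
  let ?aba = "x_op t12 (x_op t13 (x_op t12 m))" and ?bab = "x_op t13 (x_op t12 (x_op t13 m))"
  have "?bab \<oplus> scal (a t13 - a t12) (x_op t23 m) = ?aba"
    by (simp add: x_braid[OF h m] M.a_assoc scal_combine scal_linear(4))
  then have "x_op t13 ?aba = x_op t13 (?bab \<oplus> scal (a t13 - a t12) (x_op t23 m))" by simp
  moreover have "x_op t12 (x_op t13 m) \<in> wt_space (t12 \<circ> (t13 \<circ> h))"
    using h m by (intro x_op_wt) simp_all
  ultimately show ?thesis
    using x_op_square[of "t12 \<circ> (t13 \<circ> h)" "x_op t12 (x_op t13 m)" t13] h
    by (simp add: act_add act_scal conj_param_comp)
qed

text \<open>In letters: cab = - abb - bcb = - abb + bba + bac. The two squares of b are taken at the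
  weights \<open>h\<close> and \<open>t12 \<circ> h\<close>, so \<open>a t13\<close> cancels and a
  difference of conjugated values remains.\<close>

lemma x23_ab:
  assumes h: "h \<in> S3" and m: "m \<in> wt_space h"
  shows "x_op t23 (x_op t12 (x_op t13 m)) =
    scal (conj_param a h t13 - conj_param a h t23) (x_op t12 m) \<oplus> x_op t13 (x_op t12 (x_op t23 m))"
proof -
  have [simp]: "m \<in> carrier M" using m by (rule wt_space_closed)
  have "x_op t23 (x_op t12 (x_op t13 m)) = scal (conj_param a h t13 - a t13) (x_op t12 m) \<oplus>
      (scal (a t13 - conj_param a h t23) (x_op t12 m) \<oplus> x_op t13 (x_op t12 (x_op t23 m)))"
    using h m x_op_square[OF _ x_op_wt(1)[OF h m], of t13]
    by (subst x23_x12) (simp_all add: x23_x13 act_add act_scal scal_add scal_scal scal_linear(3)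
        conj_param_comp x_op_square)
  then show ?thesis by (simp add: scal_combine)
qed

text \<open>The same computation with a and b exchanged: cba = - baa - aca = - baa + aab +
  abc.\<close>

lemma x23_ba:
  assumes h: "h \<in> S3" and m: "m \<in> wt_space h"
  shows "x_op t23 (x_op t13 (x_op t12 m)) =
    scal (conj_param a h t12 - conj_param a h t23) (x_op t13 m) \<oplus> x_op t12 (x_op t13 (x_op t23 m))"
proof -
  have [simp]: "m \<in> carrier M" using m by (rule wt_space_closed)
  have "x_op t23 (x_op t13 (x_op t12 m)) = scal (conj_param a h t12 - a t12) (x_op t13 m) \<oplus>
      (scal (a t12 - conj_param a h t23) (x_op t13 m) \<oplus> x_op t12 (x_op t13 (x_op t23 m)))"
    using h m x_op_square[OF _ x_op_wt(2)[OF h m], of t12]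
    by (subst x23_x13) (simp_all add: x23_x12 act_add act_scal scal_add scal_scal scal_linear(3)
        conj_param_comp x_op_square)
  then show ?thesis by (simp add: scal_combine)
qed

text \<open>In letters: caba is (cab)a, that is, a multiple of aa plus baca, and baca = - baab -
  babc. The braid relation turns babc into abac plus a multiple of cc, so every correction collapses
  to a multiple of \<open>m\<close>.\<close>

lemma x23_aba:
  assumes h: "h \<in> S3" and m: "m \<in> wt_space h"
  shows "x_op t23 (x_op t12 (x_op t13 (x_op t12 m))) =
    scal ((conj_param a h t23 - conj_param a h t13) * (a t12 - conj_param a h t12) +
      (conj_param a h t23 - a t12) * (a t13 - conj_param a h t13) -
      (a t12 - a t13) * (a t23 - conj_param a h t23)) m \<oplus>
    scal (- 1) (x_op t12 (x_op t13 (x_op t12 (x_op t23 m))))"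
proof -
  have [simp]: "m \<in> carrier M" using m by (rule wt_space_closed)
  let ?p = "conj_param a h"
  let ?abac = "x_op t12 (x_op t13 (x_op t12 (x_op t23 m)))"
  have "x_op t23 (x_op t12 (x_op t13 (x_op t12 m))) =
      scal ((?p t23 - ?p t13) * (a t12 - ?p t12)) m \<oplus>
      x_op t13 (x_op t12 (x_op t23 (x_op t12 m)))"
    using h m x23_ab[OF _ x_op_wt(1)[OF h m]]
    by (simp add: x_op_square scal_scal conj_param_comp)
  also have "x_op t13 (x_op t12 (x_op t23 (x_op t12 m))) =
      scal (- (a t12 - ?p t23) * (a t13 - ?p t13)) m \<oplus>
      scal (- 1) (x_op t13 (x_op t12 (x_op t13 (x_op t23 m))))"
    using h m x_op_square[OF _ x_op_wt(2)[OF h m], of t12]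
    by (simp add: x23_x12 act_add act_scal scal_scal conj_param_comp x_op_square)
  also have "x_op t13 (x_op t12 (x_op t13 (x_op t23 m))) =
      ?abac \<oplus> scal ((a t12 - a t13) * (a t23 - ?p t23)) m"
    using h m x_braid[OF _ x_op_wt(3)[OF h m]] by (simp add: x_op_square scal_scal)
  also have "scal ((?p t23 - ?p t13) * (a t12 - ?p t12)) m \<oplus>
      (scal (- (a t12 - ?p t23) * (a t13 - ?p t13)) m \<oplus>
       scal (- 1) (?abac \<oplus> scal ((a t12 - a t13) * (a t23 - ?p t23)) m)) =
      scal ((?p t23 - ?p t13) * (a t12 - ?p t12) + - (a t12 - ?p t23) * (a t13 - ?p t13) +
        - ((a t12 - a t13) * (a t23 - ?p t23))) m \<oplus> scal (- 1) ?abac"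
    by (simp only: scal_add scal_scal scal_linear(1) scal_closed act_closed alg_gens_intros M.a_ac M.a_closed
        transpositions3_intros \<open>m \<in> carrier M\<close> mult_minus1 minus_mult_left)
  finally show ?thesis by simp
qed

end

section \<open>Verma modules by generators and a basis\<close>

text \<open>The basis of a Verma module consists of the words that avoid the squares, \<open>x23 x12\<close>,
  \<open>x23 x13\<close> and \<open>x13 x12 x13\<close>; the letters \<open>a\<close>, \<open>b\<close>, \<open>c\<close> in the names of the constructors stand for
  \<open>x12\<close>, \<open>x13\<close>, \<open>x23\<close>.\<close>

datatype nf = N1 | Na | Nb | Nab | Nba | Naba | Nc | Nac | Nbc | Nabc | Nbac | Nabac

primrec nf_word :: "nf \<Rightarrow> perm list" where
    "nf_word N1 = []"
  | "nf_word Na = [t12]"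
  | "nf_word Nb = [t13]"
  | "nf_word Nab = [t12, t13]"
  | "nf_word Nba = [t13, t12]"
  | "nf_word Naba = [t12, t13, t12]"
  | "nf_word Nc = [t23]"
  | "nf_word Nac = [t12, t23]"
  | "nf_word Nbc = [t13, t23]"
  | "nf_word Nabc = [t12, t13, t23]"
  | "nf_word Nbac = [t13, t12, t23]"
  | "nf_word Nabac = [t12, t13, t12, t23]"

lemma UNIV_nf: "UNIV = {N1, Na, Nb, Nab, Nba, Naba, Nc, Nac, Nbc, Nabc, Nbac, Nabac}"
  using nf.exhaust by auto

instance nf :: finite
  by standard (simp add: UNIV_nf)

definition nf_weight :: "nf \<Rightarrow> perm \<Rightarrow> perm"
  where "nf_weight i g = foldr (\<circ>) (nf_word i) g"

text \<open>The tables list coefficients and basis elements, with \<open>p\<close> for the parameter conjugated by \<open>g\<close>.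
  They arise by rewriting with \<open>ca = - ab - bc\<close>, \<open>cb = - ba - ac\<close>, the squares, and the deformed
  braid relation.\<close>

primrec nf_x12 :: "(perm \<Rightarrow> 'k::field) \<Rightarrow> (perm \<Rightarrow> 'k) \<Rightarrow> nf \<Rightarrow> ('k \<times> nf) list" where
    "nf_x12 a p N1 = [(1, Na)]"
  | "nf_x12 a p Na = [(a t12 - p t12, N1)]"
  | "nf_x12 a p Nb = [(1, Nab)]"
  | "nf_x12 a p Nab = [(a t12 - p t23, Nb)]"
  | "nf_x12 a p Nba = [(1, Naba)]"
  | "nf_x12 a p Naba = [(a t12 - p t13, Nba)]"
  | "nf_x12 a p Nc = [(1, Nac)]"
  | "nf_x12 a p Nac = [(a t12 - p t13, Nc)]"
  | "nf_x12 a p Nbc = [(1, Nabc)]"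
  | "nf_x12 a p Nabc = [(a t12 - p t23, Nbc)]"
  | "nf_x12 a p Nbac = [(1, Nabac)]"
  | "nf_x12 a p Nabac = [(a t12 - p t12, Nbac)]"

primrec nf_x13 :: "(perm \<Rightarrow> 'k::field) \<Rightarrow> (perm \<Rightarrow> 'k) \<Rightarrow> nf \<Rightarrow> ('k \<times> nf) list" where
    "nf_x13 a p N1 = [(1, Nb)]"
  | "nf_x13 a p Na = [(1, Nba)]"
  | "nf_x13 a p Nb = [(a t13 - p t13, N1)]"
  | "nf_x13 a p Nab = [(1, Naba), (a t12 - a t13, Nc)]"
  | "nf_x13 a p Nba = [(a t13 - p t23, Na)]"
  | "nf_x13 a p Naba = [(a t13 - p t12, Nab), (a t13 - a t12, Nbc)]"
  | "nf_x13 a p Nc = [(1, Nbc)]"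
  | "nf_x13 a p Nac = [(1, Nbac)]"
  | "nf_x13 a p Nbc = [(a t13 - p t12, Nc)]"
  | "nf_x13 a p Nabc = [(1, Nabac), ((a t12 - a t13) * (a t23 - p t23), N1)]"
  | "nf_x13 a p Nbac = [(a t13 - p t23, Nac)]"
  | "nf_x13 a p Nabac = [(a t13 - p t13, Nabc), ((a t13 - a t12) * (a t23 - p t23), Nb)]"

primrec nf_x23 :: "(perm \<Rightarrow> 'k::field) \<Rightarrow> (perm \<Rightarrow> 'k) \<Rightarrow> nf \<Rightarrow> ('k \<times> nf) list" where
    "nf_x23 a p N1 = [(1, Nc)]"
  | "nf_x23 a p Na = [(- 1, Nab), (- 1, Nbc)]"
  | "nf_x23 a p Nb = [(- 1, Nba), (- 1, Nac)]"
  | "nf_x23 a p Nab = [(p t13 - p t23, Na), (1, Nbac)]"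
  | "nf_x23 a p Nba = [(p t12 - p t23, Nb), (1, Nabc)]"
  | "nf_x23 a p Naba = [((p t23 - p t13) * (a t12 - p t12) + (p t23 - a t12) * (a t13 - p t13) - (a t12 - a t13) * (a t23 - p t23), N1), (- 1, Nabac)]"
  | "nf_x23 a p Nc = [(a t23 - p t23, N1)]"
  | "nf_x23 a p Nac = [(- 1, Nabc), (p t23 - a t23, Nb)]"
  | "nf_x23 a p Nbc = [(- 1, Nbac), (p t23 - a t23, Na)]"
  | "nf_x23 a p Nabc = [(p t12 - p t23, Nac), (a t23 - p t23, Nba)]"
  | "nf_x23 a p Nbac = [(p t13 - p t23, Nbc), (a t23 - p t23, Nab)]"
  | "nf_x23 a p Nabac = [((p t23 - p t12) * (a t12 - p t13) + (p t23 - a t12) * (a t13 - p t12) - (a t12 - a t13) * (a t23 - p t23), Nc), (p t23 - a t23, Naba)]"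

definition nf_x ::
  "(perm \<Rightarrow> 'k::field) \<Rightarrow> (perm \<Rightarrow> 'k) \<Rightarrow> perm \<Rightarrow> nf \<Rightarrow> ('k \<times> nf) list"
  where "nf_x a p t = (if t = t12 then nf_x12 a p else if t = t13 then nf_x13 a p else nf_x23 a p)"

definition nf_op :: "(nf \<Rightarrow> ('k::field \<times> nf) list) \<Rightarrow> (nf \<Rightarrow> 'k) \<Rightarrow> (nf \<Rightarrow> 'k)"
  where "nf_op tab v = (\<lambda>j. \<Sum>i\<in>UNIV. v i * (\<Sum>(c, k)\<leftarrow>tab i. if j = k then c else 0))"

text \<open>The tables list images of basis vectors. This and the next two lemmas list the
  coordinates of an image instead, so that identities of operators can be checked coordinate by
  coordinate.\<close>

lemma nf_op_x12:
  "nf_op (nf_x12 a p) v = (\<lambda>j. case j of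
      N1 \<Rightarrow> (a t12 - p t12) * v Na
    | Na \<Rightarrow> v N1
    | Nb \<Rightarrow> (a t12 - p t23) * v Nab
    | Nab \<Rightarrow> v Nb
    | Nba \<Rightarrow> (a t12 - p t13) * v Naba
    | Naba \<Rightarrow> v Nba
    | Nc \<Rightarrow> (a t12 - p t13) * v Nac
    | Nac \<Rightarrow> v Nc
    | Nbc \<Rightarrow> (a t12 - p t23) * v Nabc
    | Nabc \<Rightarrow> v Nbc
    | Nbac \<Rightarrow> (a t12 - p t12) * v Nabac
    | Nabac \<Rightarrow> v Nbac)"
  by (rule ext, rename_tac j, case_tac j) (simp_all add: nf_op_def UNIV_nf algebra_simps)

lemma nf_op_x13:
  "nf_op (nf_x13 a p) v = (\<lambda>j. case j of
      N1 \<Rightarrow> (a t13 - p t13) * v Nb + ((a t12 - a t13) * (a t23 - p t23)) * v Nabc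
    | Na \<Rightarrow> (a t13 - p t23) * v Nba
    | Nb \<Rightarrow> v N1 + ((a t13 - a t12) * (a t23 - p t23)) * v Nabac
    | Nab \<Rightarrow> (a t13 - p t12) * v Naba
    | Nba \<Rightarrow> v Na
    | Naba \<Rightarrow> v Nab
    | Nc \<Rightarrow> (a t12 - a t13) * v Nab + (a t13 - p t12) * v Nbc
    | Nac \<Rightarrow> (a t13 - p t23) * v Nbac
    | Nbc \<Rightarrow> (a t13 - a t12) * v Naba + v Nc
    | Nabc \<Rightarrow> (a t13 - p t13) * v Nabac
    | Nbac \<Rightarrow> v Nac
    | Nabac \<Rightarrow> v Nabc)"
  by (rule ext, rename_tac j, case_tac j) (simp_all add: nf_op_def UNIV_nf algebra_simps)

lemma nf_op_x23:
  "nf_op (nf_x23 a p) v = (\<lambda>j. case j of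
      N1 \<Rightarrow> ((p t23 - p t13) * (a t12 - p t12) + (p t23 - a t12) * (a t13 - p t13) - (a t12 - a t13) * (a t23 - p t23)) * v Naba + (a t23 - p t23) * v Nc
    | Na \<Rightarrow> (p t13 - p t23) * v Nab + (p t23 - a t23) * v Nbc
    | Nb \<Rightarrow> (p t12 - p t23) * v Nba + (p t23 - a t23) * v Nac
    | Nab \<Rightarrow> - v Na + (a t23 - p t23) * v Nbac
    | Nba \<Rightarrow> - v Nb + (a t23 - p t23) * v Nabc
    | Naba \<Rightarrow> (p t23 - a t23) * v Nabac
    | Nc \<Rightarrow> v N1 + ((p t23 - p t12) * (a t12 - p t13) + (p t23 - a t12) * (a t13 - p t12) - (a t12 - a t13) * (a t23 - p t23)) * v Nabac
    | Nac \<Rightarrow> - v Nb + (p t12 - p t23) * v Nabc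
    | Nbc \<Rightarrow> - v Na + (p t13 - p t23) * v Nbac
    | Nabc \<Rightarrow> v Nba - v Nac
    | Nbac \<Rightarrow> v Nab - v Nbc
    | Nabac \<Rightarrow> - v Naba)"
  by (rule ext, rename_tac j, case_tac j) (simp_all add: nf_op_def UNIV_nf algebra_simps)

lemmas nf_op_simps = nf_x_def nf_op_x12 nf_op_x13 nf_op_x23

fun nf_act :: "(perm \<Rightarrow> 'k::field) \<Rightarrow> perm \<Rightarrow> 'k alg_gen \<Rightarrow> (nf \<Rightarrow> 'k) \<Rightarrow> (nf \<Rightarrow> 'k)" where
    "nf_act a g (Fn f) v = (\<lambda>i. f (nf_weight i g) * v i)"
  | "nf_act a g (Tr t) v = nf_op (nf_x a (conj_param a g) t) v"

lemma nf_weight_S3 [simp]: "g \<in> S3 \<Longrightarrow> nf_weight i g \<in> S3"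
  by (cases i) (simp_all add: nf_weight_def)

lemma delta_transposition:
  "t \<in> transpositions3 \<Longrightarrow> delta (t \<circ> h) k = delta h (t \<circ> k)"
  by (auto simp: delta_def transpositions3_def comp_normalize)

text \<open>The source of linear independence: the tables do define a module. In each coordinate a
  relation becomes a polynomial identity after both third parameter values are eliminated.\<close>

lemma nf_alg_rep:
  assumes a: "a \<in> params3" and g: "g \<in> S3"
  shows "alg_rep a UNIV (nf_act a g)"
proof
  fix v :: "nf \<Rightarrow> 'a" and i :: nf
  note elim = params3_eliminate[OF a g]
  note f = f_elt_conj_param conj_param_comp g
  show "nf_act a g (Fn (\<lambda>g. if g \<in> S3 then 1 else 0)) v = v"
    using g by simp
  show "nf_act a g (Fn (delta h)) (nf_act a g (Tr t) v) = nf_act a g (Tr t) (nf_act a g (Fn (delta (t \<circ> h))) v)"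
    if "t \<in> transpositions3" for h t
    unfolding fun_eq_iff
  proof
    fix i
    show "nf_act a g (Fn (delta h)) (nf_act a g (Tr t) v) i =
        nf_act a g (Tr t) (nf_act a g (Fn (delta (t \<circ> h))) v) i"
      using that unfolding transpositions3_def
      by (cases i) (auto simp: nf_op_simps nf_weight_def delta_transposition
          comp_normalize algebra_simps)
  qed
  show "nf_act a g (Tr t) (nf_act a g (Tr t) v) = nf_act a g (Fn (f_elt a t)) v"
    if "t \<in> transpositions3" for t
    unfolding fun_eq_iff
  proof
    fix i
    show "nf_act a g (Tr t) (nf_act a g (Tr t) v) i = nf_act a g (Fn (f_elt a t)) v i"
      using that unfolding transpositions3_def
      by (cases i) (auto simp: nf_op_simps nf_weight_def f,
        simp_all add: elim algebra_simps)
  qed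
  show "nf_act a g (Tr t13) (nf_act a g (Tr t23) v) i + nf_act a g (Tr t23) (nf_act a g (Tr t12) v) i +
      nf_act a g (Tr t12) (nf_act a g (Tr t13) v) i = 0"
    by (cases i) (simp_all add: nf_op_simps elim algebra_simps)
  show "nf_act a g (Tr t23) (nf_act a g (Tr t13) v) i + nf_act a g (Tr t13) (nf_act a g (Tr t12) v) i +
      nf_act a g (Tr t12) (nf_act a g (Tr t23) v) i = 0"
    by (cases i) (simp_all add: nf_op_simps elim algebra_simps)
  fix u :: "nf \<Rightarrow> 'a" and gen :: "'a alg_gen" and c
  show "nf_act a g gen (\<lambda>i. u i + v i) = (\<lambda>i. nf_act a g gen u i + nf_act a g gen v i)"
    "nf_act a g gen (\<lambda>i. c * v i) = (\<lambda>i. c * nf_act a g gen v i)"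
    by (cases gen; simp add: fun_eq_iff nf_op_def sum.distrib sum_distrib_left algebra_simps)+
qed (simp_all add: algebra_simps)

definition nf_unit :: "nf \<Rightarrow> nf \<Rightarrow> 'k::field"
  where "nf_unit i = (\<lambda>j. if j = i then 1 else 0)"

lemma nf_function_induct [case_names unit add]:
  fixes v :: "nf \<Rightarrow> 'k::field"
  assumes unit: "\<And>i c. P (\<lambda>j. c * nf_unit i j)"
    and add: "\<And>u v. P u \<Longrightarrow> P v \<Longrightarrow> P (\<lambda>i. u i + v i)"
  shows "P v"
proof -
  have "P (\<lambda>j. \<Sum>i\<in>I. v i * nf_unit i j)" if "finite I" for I
    using that
  proof (induction I rule: finite_induct)
    case empty
    then show ?case using unit[of 0] by simp
  next
    case (insert i I)
    then show ?case using add[OF unit[of "v i" i]] by simp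
  qed
  from this[of UNIV] show ?thesis by (simp add: nf_unit_def if_distrib cong: if_cong)
qed

section \<open>Evaluation of normal forms in an arbitrary module\<close>

context alg_module
begin

definition nf_elt :: "'m \<Rightarrow> nf \<Rightarrow> 'm"
  where "nf_elt n i = foldr x_op (nf_word i) n"

text \<open>The candidate for the homomorphism that sends the generator of the model to
  \<open>n\<close>.\<close>

definition nf_comb :: "'m \<Rightarrow> (nf \<Rightarrow> 'k) \<Rightarrow> 'm"
  where "nf_comb n v = (\<Oplus>i\<in>UNIV. scal (v i) (nf_elt n i))"

definition list_comb :: "'m \<Rightarrow> ('k \<times> nf) list \<Rightarrow> 'm"
  where "list_comb n xs = foldr (\<lambda>(c, k) s. scal c (nf_elt n k) \<oplus> s) xs \<zero>"

lemma nf_elt_closed [simp]: "n \<in> carrier M \<Longrightarrow> nf_elt n i \<in> carrier M"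
  by (cases i) (simp_all add: nf_elt_def)

lemma nf_comb_closed [simp]: "n \<in> carrier M \<Longrightarrow> nf_comb n v \<in> carrier M"
  unfolding nf_comb_def by (intro M.finsum_closed) auto

lemma nf_comb_add:
  "n \<in> carrier M \<Longrightarrow> nf_comb n (\<lambda>i. u i + v i) = nf_comb n u \<oplus> nf_comb n v"
  unfolding nf_comb_def by (subst M.finsum_addf[symmetric]) (auto simp: scal_linear)

lemma nf_comb_scale:
  assumes n: "n \<in> carrier M"
  shows "nf_comb n (\<lambda>i. c * v i) = scal c (nf_comb n v)"
proof -
  have "(\<Oplus>i\<in>I. scal (c * v i) (nf_elt n i)) = scal c (\<Oplus>i\<in>I. scal (v i) (nf_elt n i))"
    if "finite I" for I
    using that by (induction I rule: finite_induct)
      (use n in \<open>simp_all add: scal_add scal_scal Pi_def\<close>)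
  then show ?thesis by (simp add: nf_comb_def)
qed

lemma nf_comb_unit:
  assumes n: "n \<in> carrier M"
  shows "nf_comb n (nf_unit i) = nf_elt n i"
proof -
  have "nf_comb n (nf_unit i) = (\<Oplus>j\<in>UNIV. if i = j then nf_elt n j else \<zero>)"
    unfolding nf_comb_def nf_unit_def using n
    by (intro M.finsum_cong') (auto simp: scal_linear)
  also have "\<dots> = nf_elt n i"
    using n by (intro M.finsum_singleton) auto
  finally show ?thesis .
qed

lemma nf_comb_list:
  assumes n: "n \<in> carrier M"
  shows "nf_comb n (\<lambda>j. \<Sum>(c, k)\<leftarrow>xs. if j = k then c else 0) = list_comb n xs"
proof (induction xs)
  case Nil
  have "nf_comb n (\<lambda>j. 0 * (0::'k)) = scal 0 (nf_comb n (\<lambda>j. 0))"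
    by (rule nf_comb_scale[OF n])
  then show ?case using n by (simp add: list_comb_def scal_linear)
next
  case (Cons x xs)
  obtain c k where x: "x = (c, k)" by fastforce
  have "(\<lambda>j. \<Sum>(c, k)\<leftarrow>x # xs. if j = k then c else 0) =
      (\<lambda>j. c * nf_unit k j + (\<Sum>(c, k)\<leftarrow>xs. if j = k then c else 0))"
    by (auto simp: x nf_unit_def)
  then show ?case
    by (simp only: nf_comb_add[OF n] nf_comb_scale[OF n] nf_comb_unit[OF n] Cons.IH)
      (simp add: x list_comb_def)
qed

lemma nf_elt_wt_space:
  assumes "g \<in> S3" "n \<in> wt_space g"
  shows "nf_elt n i \<in> wt_space (nf_weight i g)"
  by (cases i) (simp_all add: nf_elt_def nf_weight_def x_op_wt assms)

text \<open>Here the tables are justified as consequences of the relations: all 36 entries follow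
  from the squares and the rewriting rules above, for any vector of weight \<open>g\<close> in any
  module.\<close>

lemma x_op_nf_elt:
  assumes g: "g \<in> S3" and n: "n \<in> wt_space g" and t: "t \<in> transpositions3"
  shows "x_op t (nf_elt n i) = list_comb n (nf_x a (conj_param a g) t i)"
proof -
  have [simp]: "n \<in> carrier M" using n by (rule wt_space_closed)
  \<comment> \<open>A basis word ending in \<open>x23\<close> is a word in \<open>x12\<close> and
    \<open>x13\<close> applied to \<open>x23 n\<close>, so the rules are also instantiated at that
    vector.\<close>
  have g': "t23 \<circ> g \<in> S3" and n': "x_op t23 n \<in> wt_space (t23 \<circ> g)"
    using g n by (simp_all add: x_op_wt)
  have square: "x_op t (x_op t (nf_elt n i)) =
      scal (a t - conj_param a (nf_weight i g) t) (nf_elt n i)" if "t \<in> transpositions3" for t i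
    by (rule x_op_square[OF _ nf_elt_wt_space[OF g n] that]) (simp add: g)
  note squares = square[of _ N1] square[of _ Na] square[of _ Nb] square[of _ Nab] square[of _ Nba]
    square[of _ Nc] square[of _ Nac] square[of _ Nbc] square[of _ Nbac]
  note rules = x23_x12[of n] x23_x13[of n] x23_x12[of "x_op t23 n"] x23_x13[of "x_op t23 n"]
    x_braid[OF g n] x_braid[OF g' n'] x13_aba[OF g n] x13_aba[OF g' n']
    x23_ab[OF g n] x23_ab[OF g' n'] x23_ba[OF g n] x23_ba[OF g' n'] x23_aba[OF g n] x23_aba[OF g' n']
  show ?thesis
    using t unfolding transpositions3_def
    by (elim insertE emptyE; cases i)
      (simp_all add: nf_x_def list_comb_def nf_elt_def scal_linear(3,4) rules conj_param_comp g
        squares[unfolded nf_elt_def nf_word.simps foldr.simps comp_apply id_apply] nf_weight_def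
        act_add act_scal scal_add scal_scal M.a_ac)
qed

lemma x_op_nf_comb:
  assumes g: "g \<in> S3" and n: "n \<in> wt_space g" and t: "t \<in> transpositions3"
  shows "x_op t (nf_comb n v) = nf_comb n (nf_op (nf_x a (conj_param a g) t) v)"
proof -
  have n': "n \<in> carrier M" using n by (rule wt_space_closed)
  show ?thesis
  proof (induction v rule: nf_function_induct)
    case (unit i c)
    have "nf_op tab (\<lambda>j. c * nf_unit i j) = (\<lambda>j. c * (\<Sum>(c, k)\<leftarrow>tab i. if j = k then c else 0))" for tab
      by (rule ext) (simp add: nf_op_def nf_unit_def if_distrib if_distribR cong: if_cong)
    then show ?case
      using n' t by (simp only: nf_comb_scale nf_comb_unit nf_comb_list x_op_nf_elt[OF g n t, symmetric]
          act_scal alg_gens_intros nf_elt_closed)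
  next
    case (add u v)
    have "nf_op tab (\<lambda>i. u i + v i) = (\<lambda>i. nf_op tab u i + nf_op tab v i)" for tab
      by (simp add: nf_op_def sum.distrib algebra_simps)
    then show ?case
      using add n' t by (simp only: nf_comb_add act_add alg_gens_intros nf_comb_closed)
  qed
qed

lemma act_Fn_nf_comb:
  assumes g: "g \<in> S3" and n: "n \<in> wt_space g" and f: "f \<in> carrier fun_S3"
  shows "act (Fn f) (nf_comb n v) = nf_comb n (\<lambda>i. f (nf_weight i g) * v i)"
proof -
  have n': "n \<in> carrier M" using n by (rule wt_space_closed)
  show ?thesis
  proof (induction v rule: nf_function_induct)
    case (unit i c)
    have "(\<lambda>j. f (nf_weight j g) * (c * nf_unit i j)) = (\<lambda>j. (c * f (nf_weight i g)) * nf_unit i j)"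
      by (auto simp: nf_unit_def)
    then show ?case
      using n' f act_Fn_wt[OF nf_weight_S3[OF g] nf_elt_wt_space[OF g n] f]
      by (simp only: nf_comb_scale nf_comb_unit act_scal alg_gens_intros nf_elt_closed scal_scal)
  next
    case (add u v)
    then show ?case
      using n' f by (simp only: nf_comb_add act_add alg_gens_intros nf_comb_closed distrib_left)
  qed
qed

end

section \<open>The model on twelve coordinates\<close>

definition nf_module :: "(perm \<Rightarrow> 'k::field) \<Rightarrow> perm \<Rightarrow> (('k alg_gen word \<Rightarrow>\<^sub>0 'k) set, nf \<Rightarrow> 'k) module"
  where "nf_module a g = rep_module UNIV (nf_act a g)"

text \<open>The model is free on a vector of weight \<open>g\<close>: the table identities hold at
  \<open>n\<close>, so evaluating coordinates at \<open>n\<close> respects all operators.\<close>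

lemma nf_module_universal:
  assumes a: "a \<in> params3" and g: "g \<in> S3" and N: "alg_module a N" and n: "n \<in> alg_module.wt_space a N g"
  shows "\<exists>h\<in>lmod_hom (alg_A a) (nf_module a g) N. h (nf_unit N1) = n"
proof -
  interpret V: alg_rep a UNIV "nf_act a g" by (rule nf_alg_rep[OF a g])
  interpret N: alg_module a N by (rule N)
  have n': "n \<in> carrier N" using n by (rule N.wt_space_closed)
  have "N.nf_comb n \<in> lmod_hom (alg_A a) (nf_module a g) N"
    unfolding nf_module_def
  proof (rule alg_module_homI[OF V.alg_module_rep_module N])
    fix v :: "nf \<Rightarrow> 'a" and gen :: "'a alg_gen" assume "gen \<in> alg_gens"
    then show "N.nf_comb n (V.rep.act gen v) = N.act gen (N.nf_comb n v)"
      using N.act_Fn_nf_comb[OF g n] N.x_op_nf_comb[OF g n] by (auto simp: alg_gens_def)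
  qed (use n' in \<open>simp_all add: N.nf_comb_add N.nf_comb_scale\<close>)
  moreover have "N.nf_comb n (nf_unit N1) = n"
    using n' by (simp add: N.nf_comb_unit N.nf_elt_def)
  ultimately show ?thesis by blast
qed

lemma nf_module_unit:
  assumes "a \<in> params3" "g \<in> S3"
  shows "nf_unit N1 \<in> alg_module.wt_space a (nf_module a g) g"
    and "foldr (alg_module.act a (nf_module a g) \<circ> Tr) (nf_word i) (nf_unit N1) = nf_unit i"
proof -
  interpret V: alg_rep a UNIV "nf_act a g" by (rule nf_alg_rep[OF assms])
  show "nf_unit N1 \<in> alg_module.wt_space a (nf_module a g) g"
    using assms(2) by (simp add: nf_module_def V.rep.wt_space_def)
      (auto simp: nf_unit_def nf_weight_def delta_def)
  have *: "V.rep.act (Tr t) v = nf_op (nf_x a (conj_param a g) t) v" if "t \<in> transpositions3" for t v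
    using that by simp
  show "foldr (alg_module.act a (nf_module a g) \<circ> Tr) (nf_word i) (nf_unit N1) = nf_unit i"
    unfolding nf_module_def
    by (rule ext, rename_tac j, cases i; case_tac j)
      (simp_all add: * nf_op_simps nf_unit_def del: V.rep_module_ops)
qed

lemma nf_module_submodule_eq:
  assumes a: "a \<in> params3" and g: "g \<in> S3"
    and U: "submodule U (alg_A a) (nf_module a g)" and unit: "nf_unit N1 \<in> U"
  shows "U = UNIV"
proof -
  interpret V: alg_rep a UNIV "nf_act a g" by (rule nf_alg_rep[OF a g])
  note U = U[unfolded nf_module_def]
  have "foldr (V.rep.act \<circ> Tr) ts (nf_unit N1) \<in> U" if "set ts \<subseteq> transpositions3" for ts
    using that by (induction ts) (use unit V.rep.alg_submoduleD(2)[OF U] in \<open>auto simp del: V.rep_module_ops\<close>)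
  moreover have "set (nf_word i) \<subseteq> transpositions3" for i
    by (cases i) auto
  ultimately have "nf_unit i \<in> U" for i
    using nf_module_unit(2)[OF a g, of i] unfolding nf_module_def by metis
  then have "v \<in> U" for v
  proof (induction v rule: nf_function_induct)
    case (unit i c)
    then show ?case using V.rep.alg_submoduleD(1)[OF U unit, of c i] by simp
  next
    case (add u v)
    then show ?case using V.rep.submoduleD(3)[OF U] by simp
  qed
  then show ?thesis by blast
qed

section \<open>Comparison of the tensor product with the model\<close>

lemma verma_induction_data:
  "induction_data (alg_A a) fun_S3 (fun_S3_map a) (point_module g :: (_, 'k::field) module)"
proof -
  have "abelian_monoid (point_module g :: (_, 'k) module)"
    by (rule abelian_monoidI) (simp_all add: point_module_def algebra_simps)
  then show ?thesis
    using ring_alg_A[of a]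
    by (auto simp: induction_data_def induction_data_axioms_def fun_S3_map_def alg_class_def[symmetric]
        point_module_def)
qed

definition verma_gen :: "(perm \<Rightarrow> 'k::field) \<Rightarrow> perm \<Rightarrow>
    (('k alg_gen word \<Rightarrow>\<^sub>0 'k) set \<times> 'k \<Rightarrow>\<^sub>0 int) set"
  where "verma_gen a g = induction_data.tensor_class (alg_A a) fun_S3 (fun_S3_map a) (point_module g)
    (frag_of (\<one>\<^bsub>alg_A a\<^esub>, 1))"

lemma verma_alg_module: "alg_module a (verma a g)"
  unfolding alg_module_def verma_def
  by (rule induction_data.left_module_Ind[OF verma_induction_data])

text \<open>The function \<open>c * delta g\<close> acts on the point module by c, so balancing
  moves the scalar of the right factor into the algebra. Hence the class of 1 (x) 1
  generates.\<close>

lemma verma_tensor_class: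
  fixes a :: "perm \<Rightarrow> 'k::field"
  assumes g: "g \<in> S3"
  defines "tc \<equiv> induction_data.tensor_class (alg_A a) fun_S3 (fun_S3_map a) (point_module g)"
  shows "verma_gen a g \<in> carrier (verma a g)"
    and "x \<in> carrier (alg_A a) \<Longrightarrow>
      tc (frag_of (x, c)) = x \<odot>\<^bsub>verma a g\<^esub> alg_module.act a (verma a g) (Fn (\<lambda>h. c * delta g h)) (verma_gen a g)"
    and "verma_gen a g \<in> alg_module.wt_space a (verma a g) g"
proof -
  interpret I: induction_data "alg_A a" fun_S3 "fun_S3_map a" "point_module g :: (_, 'k) module"
    by (rule verma_induction_data)
  interpret V: alg_module a "verma a g" by (rule verma_alg_module)
  have N [simp]: "carrier (point_module g :: (_, 'k) module) = UNIV" "f \<odot>\<^bsub>point_module g\<^esub> c = f g * c" for f and c :: 'k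
    by (simp_all add: point_module_def)
  have F: "frag_of (x, c) \<in> carrier I.F" if "x \<in> carrier (alg_A a)" for x and c :: 'k
    using that by simp
  have tc: "tc = I.tensor_class" by (simp add: tc_def)
  show gen: "verma_gen a g \<in> carrier (verma a g)"
    using F[OF I.A.one_closed, of 1] unfolding verma_gen_def verma_def I.Ind_simps by blast
  have smult: "x \<odot>\<^bsub>verma a g\<^esub> I.tensor_class (frag_of (y, c)) = I.tensor_class (frag_of (x \<otimes>\<^bsub>alg_A a\<^esub> y, c))"
    if "x \<in> carrier (alg_A a)" "y \<in> carrier (alg_A a)" for x y c
    using I.Ind_simps(4)[OF that(1) F[OF that(2), of c]] by (simp add: verma_def)
  have act: "V.act (Fn f) (verma_gen a g) = I.tensor_class (frag_of (\<one>\<^bsub>alg_A a\<^esub>, f g))"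
    if f: "f \<in> carrier fun_S3" for f
  proof -
    have closed: "fun_S3_map a f \<in> carrier (alg_A a)" by (rule I.\<iota>_closed[OF f])
    have "V.act (Fn f) (verma_gen a g) = fun_S3_map a f \<odot>\<^bsub>verma a g\<^esub> I.tensor_class (frag_of (\<one>\<^bsub>alg_A a\<^esub>, 1))"
      by (simp add: V.act_def fun_S3_map_def alg_class_def verma_gen_def)
    also have "\<dots> = I.tensor_class (frag_of (\<one>\<^bsub>alg_A a\<^esub> \<otimes>\<^bsub>alg_A a\<^esub> fun_S3_map a f, 1))"
      using closed by (simp add: smult)
    also have "\<dots> = I.tensor_class (frag_of (\<one>\<^bsub>alg_A a\<^esub>, f \<odot>\<^bsub>point_module g\<^esub> 1))"
    proof (subst I.tensor_class_eq_iff)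
      show "frag_of (\<one>\<^bsub>alg_A a\<^esub> \<otimes>\<^bsub>alg_A a\<^esub> fun_S3_map a f, 1) - frag_of (\<one>\<^bsub>alg_A a\<^esub>, f \<odot>\<^bsub>point_module g\<^esub> 1) \<in> I.K"
        using f by (intro I.K_generators) (auto simp: tensor_relators_def simp del: N(2))
    qed (use closed F in \<open>simp_all\<close>)
    finally show ?thesis by simp
  qed
  have delta: "(\<lambda>h. c * delta g h) \<in> carrier fun_S3" for c :: 'k
    using g by (intro fun_S3_closed delta_fun_S3)
  have "delta g g = (1 :: 'k)" by (simp add: delta_def)
  then show "tc (frag_of (x, c)) = x \<odot>\<^bsub>verma a g\<^esub> V.act (Fn (\<lambda>h. c * delta g h)) (verma_gen a g)"
    if "x \<in> carrier (alg_A a)"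
    using that by (simp add: act[OF delta] smult tc)
  show "verma_gen a g \<in> V.wt_space g"
    using act[OF delta_fun_S3[OF g]] gen by (simp add: V.wt_space_def delta_def verma_gen_def)
qed

text \<open>Induction is adjoint to restriction: a vector \<open>n\<close> of weight
  \<open>g\<close> amounts to the map \<open>\<lambda>c. scal c n\<close> from the point module,
  which respects the action of functions.\<close>

lemma verma_universal:
  fixes a :: "perm \<Rightarrow> 'k::field"
  assumes g: "g \<in> S3" and N: "alg_module a N" and n: "n \<in> alg_module.wt_space a N g"
  shows "\<exists>h\<in>lmod_hom (alg_A a) (verma a g) N. h (verma_gen a g) = n"
proof -
  interpret I: induction_data "alg_A a" fun_S3 "fun_S3_map a" "point_module g :: (_, 'k) module"
    by (rule verma_induction_data)
  interpret N: alg_module a N by (rule N)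
  have n': "n \<in> carrier N" using n by (rule N.wt_space_closed)
  have smult: "N.scal (f g * c) n = fun_S3_map a f \<odot>\<^bsub>N\<^esub> N.scal c n" if f: "f \<in> carrier fun_S3" for f c
  proof -
    have "fun_S3_map a f \<odot>\<^bsub>N\<^esub> N.scal c n = N.act (Fn f) (N.scal c n)"
      by (simp add: N.act_def fun_S3_map_def alg_class_def)
    also have "\<dots> = N.scal (f g * c) n"
      using N.act_Fn_wt[OF g n f] n' f by (simp add: N.act_scal N.scal_scal mult.commute)
    finally show ?thesis by simp
  qed
  obtain h where h: "h \<in> lmod_hom (alg_A a) I.Ind N"
    and h_tc: "\<And>x c. x \<in> carrier (alg_A a) \<Longrightarrow> c \<in> carrier (point_module g) \<Longrightarrow>
      h (I.tensor_class (frag_of (x, c))) = x \<odot>\<^bsub>N\<^esub> N.scal c n"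
    by (rule I.Ind_universal[OF N.left_module_axioms, of "\<lambda>c. N.scal c n"])
      (use n' smult in \<open>auto simp: point_module_def N.scal_linear\<close>)
  have "h (verma_gen a g) = n"
    unfolding verma_gen_def using n' by (subst h_tc) (simp_all add: point_module_def N.scal_linear)
  then show ?thesis using h by (auto simp: verma_def)
qed

lemma verma_hom_eqI:
  fixes a :: "perm \<Rightarrow> 'k::field"
  assumes g: "g \<in> S3" and N: "alg_module a N"
    and h: "h \<in> lmod_hom (alg_A a) (verma a g) N" and k: "k \<in> lmod_hom (alg_A a) (verma a g) N"
    and eq: "h (verma_gen a g) = k (verma_gen a g)" and u: "u \<in> carrier (verma a g)"
  shows "h u = k u"
proof -
  interpret I: induction_data "alg_A a" fun_S3 "fun_S3_map a" "point_module g :: (_, 'k) module"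
    by (rule verma_induction_data)
  interpret V: alg_module a "verma a g" by (rule verma_alg_module)
  interpret N: alg_module a N by (rule N)
  interpret h: left_module_hom "alg_A a" "verma a g" N h
    using h by (simp add: left_module_homI V.left_module_axioms N.left_module_axioms)
  interpret k: left_module_hom "alg_A a" "verma a g" N k
    using k by (simp add: left_module_homI V.left_module_axioms N.left_module_axioms)
  have gen: "verma_gen a g \<in> carrier (verma a g)"
    by (rule verma_tensor_class(1)[OF g])
  obtain c where c: "c \<in> carrier I.F" "u = I.tensor_class c"
    using u by (auto simp: verma_def I.Ind_simps)
  have tc: "I.tensor_class c \<in> carrier (verma a g)" if "c \<in> carrier I.F" for c
    using that unfolding verma_def I.Ind_simps by blast
  have "h (I.tensor_class c) = k (I.tensor_class c)"
    using c(1)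
  proof (induction rule: I.F_induct)
    case zero
    then show ?case
      using h.zero k.zero by (simp add: verma_def I.Ind_simps)
  next
    case (diff c d)
    have "c - d \<in> carrier I.F" using diff by (intro I.F_diff_closed)
    moreover have "(c - d) + d = c" by simp
    ultimately have "I.tensor_class c = I.tensor_class (c - d) \<oplus>\<^bsub>verma a g\<^esub> I.tensor_class d"
      using I.Ind_simps(3)[of "c - d" d] diff(2) unfolding verma_def by metis
    then have "h (I.tensor_class (c - d)) \<oplus>\<^bsub>N\<^esub> h (I.tensor_class d) = k (I.tensor_class (c - d)) \<oplus>\<^bsub>N\<^esub> k (I.tensor_class d)"
      using diff tc \<open>c - d \<in> carrier I.F\<close> by (metis h.add k.add)
    then show ?case
      using diff tc \<open>c - d \<in> carrier I.F\<close> h.closed k.closed by (metis N.M.add.r_cancel)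
  next
    case (frag x c)
    have "(\<lambda>h. c * delta g h) \<in> carrier fun_S3" using g by (intro fun_S3_closed delta_fun_S3)
    then show ?case
      using verma_tensor_class(2)[OF g frag(1), of c] frag(1) gen eq
        alg_module_homD(2)[OF verma_alg_module N h gen] alg_module_homD(2)[OF verma_alg_module N k gen]
      by (simp add: h.smult k.smult)
  qed
  then show ?thesis using c(2) by simp
qed

text \<open>Both universal properties give maps that exchange the generators. The composite on the
  tensor product fixes its generator and is therefore the identity; the map to the model is onto
  because its image contains the generator.\<close>

lemma verma_iso_nf_module:
  assumes a: "a \<in> params3" and g: "g \<in> S3"
  shows "lmod_iso (alg_A a) (verma a g) (nf_module a g)"
proof -
  interpret V: alg_rep a UNIV "nf_act a g" by (rule nf_alg_rep[OF a g])
  have nf: "alg_module a (nf_module a g)" unfolding nf_module_def by (rule V.alg_module_rep_module)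
  obtain p where p: "p \<in> lmod_hom (alg_A a) (verma a g) (nf_module a g)" "p (verma_gen a g) = nf_unit N1"
    using verma_universal[OF g nf nf_module_unit(1)[OF a g]] by blast
  obtain q where q: "q \<in> lmod_hom (alg_A a) (nf_module a g) (verma a g)" "q (nf_unit N1) = verma_gen a g"
    using nf_module_universal[OF a g verma_alg_module verma_tensor_class(3)[OF g]]
    by blast
  interpret p: left_module_hom "alg_A a" "verma a g" "nf_module a g" p
    using left_module_homI[OF _ _ p(1)] nf verma_alg_module[of a g] by (simp add: alg_module_def)
  have gen: "verma_gen a g \<in> carrier (verma a g)"
    by (rule verma_tensor_class(1)[OF g])
  have "q (p u) = u" if "u \<in> carrier (verma a g)" for u
  proof -
    have "(q \<circ> p) u = (\<lambda>u. u) u"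
      by (rule verma_hom_eqI[OF g verma_alg_module lmod_hom_compose[OF p(1) q(1)] _ _ that])
        (auto simp: p(2) q(2) lmod_hom_def)
    then show ?thesis by simp
  qed
  moreover have "p ` carrier (verma a g) = UNIV"
    using p(2) gen by (intro nf_module_submodule_eq[OF a g p.submodule_image[OF p.M.submodule_carrier]]) force
  then have "p ` carrier (verma a g) = carrier (nf_module a g)"
    by (simp add: nf_module_def)
  ultimately show ?thesis
    unfolding lmod_iso_def bij_betw_def using p(1) by (metis inj_on_inverseI)
qed

section \<open>Verma modules are projective and injective\<close>

lemma alg_module_left_module: "left_module (alg_A a) M \<longleftrightarrow> alg_module a M"
  by (simp add: alg_module_def)

lemma nf_module_alg_module:
  assumes "a \<in> params3" "g \<in> S3"
  shows "alg_module a (nf_module a g)"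
  unfolding nf_module_def by (rule alg_rep.alg_module_rep_module[OF nf_alg_rep[OF assms]])

lemma hom_wt_space:
  assumes M: "alg_module a M" and N: "alg_module a N" and h: "h \<in> lmod_hom (alg_A a) M N"
    and g: "g \<in> S3" and m: "m \<in> alg_module.wt_space a M g"
  shows "h m \<in> alg_module.wt_space a N g"
proof -
  interpret M: alg_module a M by (rule M)
  interpret N: alg_module a N by (rule N)
  show ?thesis
    using m alg_module_homD(2)[OF M N h, of m "Fn (delta g)"] lmod_homD(1)[OF h] g
    by (simp add: M.wt_space_def N.wt_space_def)
qed

lemma hom_words:
  assumes M: "alg_module a M" and N: "alg_module a N" and h: "h \<in> lmod_hom (alg_A a) M N"
    and ts: "set ts \<subseteq> transpositions3" and m: "m \<in> carrier M"
  shows "h (foldr (alg_module.act a M \<circ> Tr) ts m) = foldr (alg_module.act a N \<circ> Tr) ts (h m)"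
    and "foldr (alg_module.act a M \<circ> Tr) ts m \<in> carrier M"
proof -
  interpret M: alg_module a M by (rule M)
  have "h (foldr (M.act \<circ> Tr) ts m) = foldr (alg_module.act a N \<circ> Tr) ts (h m) \<and>
      foldr (M.act \<circ> Tr) ts m \<in> carrier M"
    using ts
  proof (induction ts)
    case (Cons t ts)
    then show ?case
      using alg_module_homD(2)[OF M N h, of "foldr (M.act \<circ> Tr) ts m" "Tr t"]
      by (simp add: comp_def)
  qed (use m in simp)
  then show "h (foldr (M.act \<circ> Tr) ts m) = foldr (alg_module.act a N \<circ> Tr) ts (h m)"
    "foldr (M.act \<circ> Tr) ts m \<in> carrier M" by auto
qed

text \<open>The vectors on which \<open>h\<close> and \<open>k\<close> agree form a submodule
  containing the generator.\<close>

lemma nf_module_hom_eqI: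
  assumes a: "a \<in> params3" and g: "g \<in> S3" and N: "alg_module a N"
    and h: "h \<in> lmod_hom (alg_A a) (nf_module a g) N" and k: "k \<in> lmod_hom (alg_A a) (nf_module a g) N"
    and eq: "h (nf_unit N1) = k (nf_unit N1)"
  shows "h v = k v"
proof -
  interpret V: alg_module a "nf_module a g" by (rule nf_module_alg_module[OF a g])
  interpret h: left_module_hom "alg_A a" "nf_module a g" N h
    using h N V.left_module_axioms by (simp add: left_module_homI alg_module_def)
  interpret k: left_module_hom "alg_A a" "nf_module a g" N k
    using k N V.left_module_axioms by (simp add: left_module_homI alg_module_def)
  have "carrier (nf_module a g) = UNIV" by (simp add: nf_module_def)
  then have "submodule {v. h v = k v} (alg_A a) (nf_module a g)"
    by (intro V.submoduleI) (auto simp: h.add k.add h.smult k.smult h.zero k.zero)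
  from nf_module_submodule_eq[OF a g this] eq show ?thesis by auto
qed

text \<open>A lift amounts to a preimage of weight \<open>g\<close> of the image of the generator.
  Any preimage \<open>n\<close> can be replaced by \<delta>_g n: this has weight \<open>g\<close>
  and the same image, since \<open>p\<close> commutes with \<delta>_g.\<close>

lemma projective_nf_module:
  fixes TN :: "'n itself" and TP :: "'p itself" and a :: "perm \<Rightarrow> 'k::field"
  assumes a: "a \<in> params3" and g: "g \<in> S3"
  shows "projective_module TN TP (alg_A a) (nf_module a g)"
  unfolding projective_module_def alg_module_left_module
proof (intro conjI allI impI ballI)
  note V = nf_module_alg_module[OF a g]
  show "alg_module a (nf_module a g)" by (rule V)
  fix N :: "(('k alg_gen word \<Rightarrow>\<^sub>0 'k) set, 'n) module" and Q :: "(('k alg_gen word \<Rightarrow>\<^sub>0 'k) set, 'p) module"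
    and p f
  assume N: "alg_module a N" and Q: "alg_module a Q" and p: "p \<in> lmod_hom (alg_A a) N Q"
    and f: "f \<in> lmod_hom (alg_A a) (nf_module a g) Q" and surj: "p ` carrier N = carrier Q"
  interpret N: alg_module a N by (rule N)
  interpret Q: alg_module a Q by (rule Q)
  have f1: "f (nf_unit N1) \<in> Q.wt_space g"
    by (rule hom_wt_space[OF V Q f g nf_module_unit(1)[OF a g]])
  then obtain n where n: "n \<in> carrier N" "p n = f (nf_unit N1)"
    using surj Q.wt_space_closed by (metis imageE)
  obtain h where h: "h \<in> lmod_hom (alg_A a) (nf_module a g) N" "h (nf_unit N1) = N.act (Fn (delta g)) n"
    using nf_module_universal[OF a g N N.d_op_wt_space[OF g n(1)]] by blast
  have "(p \<circ> h) (nf_unit N1) = f (nf_unit N1)"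
    using alg_module_homD(2)[OF N Q p n(1), of "Fn (delta g)"] f1 g h(2) n(2) by (simp add: Q.wt_space_def)
  then have "(p \<circ> h) v = f v" for v
    by (rule nf_module_hom_eqI[OF a g Q lmod_hom_compose[OF h(1) p] f])
  then show "\<exists>h\<in>lmod_hom (alg_A a) (nf_module a g) N. \<forall>x\<in>carrier (nf_module a g). p (h x) = f x"
    using h(1) by auto
qed

section \<open>Dual spaces and extension of functionals\<close>

context alg_module
begin

definition linear_functional :: "('m \<Rightarrow> 'k) \<Rightarrow> bool"
  where "linear_functional \<phi> \<longleftrightarrow> (\<forall>x\<in>carrier M. \<forall>y\<in>carrier M. \<phi> (x \<oplus> y) = \<phi> x + \<phi> y) \<and>
    (\<forall>c. \<forall>x\<in>carrier M. \<phi> (scal c x) = c * \<phi> x)"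

text \<open>Extended by zero off the carrier, so that functionals agreeing on \<open>M\<close> are
  equal as functions.\<close>

definition dual_space :: "('m \<Rightarrow> 'k) set"
  where "dual_space = {\<phi>. linear_functional \<phi> \<and> (\<forall>x. x \<notin> carrier M \<longrightarrow> \<phi> x = 0)}"

definition dual_act :: "'k alg_gen \<Rightarrow> ('m \<Rightarrow> 'k) \<Rightarrow> ('m \<Rightarrow> 'k)"
  where "dual_act g \<phi> = (\<lambda>x. if x \<in> carrier M then \<phi> (act g x) else 0)"

lemma dual_spaceD:
  assumes "\<phi> \<in> dual_space"
  shows "x \<in> carrier M \<Longrightarrow> y \<in> carrier M \<Longrightarrow> \<phi> (x \<oplus> y) = \<phi> x + \<phi> y"
    and "x \<in> carrier M \<Longrightarrow> \<phi> (scal c x) = c * \<phi> x" and "x \<notin> carrier M \<Longrightarrow> \<phi> x = 0"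
    and "\<phi> \<zero> = 0"
proof -
  show 1: "x \<in> carrier M \<Longrightarrow> y \<in> carrier M \<Longrightarrow> \<phi> (x \<oplus> y) = \<phi> x + \<phi> y"
    "x \<in> carrier M \<Longrightarrow> \<phi> (scal c x) = c * \<phi> x" "x \<notin> carrier M \<Longrightarrow> \<phi> x = 0" for x y c
    using assms by (auto simp: dual_space_def linear_functional_def)
  show "\<phi> \<zero> = 0"
    using 1(2)[of "\<zero>" 0] by simp
qed

text \<open>The relations are invariant under reversing all words, so the transposed operators on the
  dual space form again a left module.\<close>

lemma dual_alg_rep: "alg_rep a dual_space dual_act"
proof
  note simps = dual_act_def fun_eq_iff dual_spaceD
  fix \<phi> \<psi> :: "'m \<Rightarrow> 'k" and g :: "'k alg_gen" and c
  assume \<phi>: "\<phi> \<in> dual_space"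
  show "(\<lambda>i. c * \<phi> i) \<in> dual_space"
    using \<phi> by (simp add: dual_space_def linear_functional_def algebra_simps)
  show "dual_act g (\<lambda>i. c * \<phi> i) = (\<lambda>i. c * dual_act g \<phi> i)"
    by (auto simp: simps)
  show "dual_act g \<phi> \<in> dual_space" if "g \<in> alg_gens"
    using \<phi> that unfolding dual_space_def linear_functional_def dual_act_def
    by (simp add: act_add act_scal)
  show "(\<lambda>i. \<phi> i + \<psi> i) \<in> dual_space" if "\<psi> \<in> dual_space"
    using \<phi> that by (simp add: dual_space_def linear_functional_def algebra_simps)
  show "dual_act g (\<lambda>i. \<phi> i + \<psi> i) = (\<lambda>i. dual_act g \<phi> i + dual_act g \<psi> i)"
    by (auto simp: simps)
  show "dual_act (Fn (\<lambda>g. if g \<in> S3 then 1 else 0)) \<phi> = \<phi>"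
    using \<phi> act_Fn(4)[OF _ f_elt_fun_S3 f_elt_fun_S3] by (auto simp: simps)
  fix i
  \<comment> \<open>Reversal exchanges the two quadratic relations.\<close>
  show "dual_act (Tr t13) (dual_act (Tr t23) \<phi>) i + dual_act (Tr t23) (dual_act (Tr t12) \<phi>) i +
      dual_act (Tr t12) (dual_act (Tr t13) \<phi>) i = 0"
    using arg_cong[OF act_relations(4), of i \<phi>] dual_spaceD[OF \<phi>] by (simp add: dual_act_def algebra_simps)
  show "dual_act (Tr t23) (dual_act (Tr t13) \<phi>) i + dual_act (Tr t13) (dual_act (Tr t12) \<phi>) i +
      dual_act (Tr t12) (dual_act (Tr t23) \<phi>) i = 0"
    using arg_cong[OF act_relations(3), of i \<phi>] dual_spaceD[OF \<phi>] by (simp add: dual_act_def algebra_simps)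
  show "dual_act (Tr t) (dual_act (Tr t) \<phi>) = dual_act (Fn (f_elt a t)) \<phi>" if "t \<in> transpositions3" for t
    using that by (auto simp: simps act_relations(2))
  \<comment> \<open>Reversed, the weight relation at \<open>h\<close> is the original one at
    \<open>t \<circ> h\<close>, because \<open>t\<close> is an involution.\<close>
  show "dual_act (Fn (delta h)) (dual_act (Tr t) \<phi>) = dual_act (Tr t) (dual_act (Fn (delta (t \<circ> h))) \<phi>)"
    if "h \<in> S3" "t \<in> transpositions3" for h t
    using that act_relations(1)[of _ "t \<circ> h" t]
    by (auto simp: simps transposition_comp_S3 transposition_involution)
  fix f f' :: "perm \<Rightarrow> 'k" assume f: "f \<in> carrier fun_S3"
  show "dual_act (Fn (\<lambda>g. c * f g)) \<phi> = (\<lambda>i. c * dual_act (Fn f) \<phi> i)"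
    using f \<phi> by (auto simp: simps act_Fn(2)[OF _ f f])
  assume f': "f' \<in> carrier fun_S3"
  show "dual_act (Fn (\<lambda>g. f g + f' g)) \<phi> = (\<lambda>i. dual_act (Fn f) \<phi> i + dual_act (Fn f') \<phi> i)"
    using f f' \<phi> by (auto simp: simps act_Fn(1))
  \<comment> \<open>Transposition reverses the factors, which is harmless because functions
    commute.\<close>
  have "act (Fn (\<lambda>g. f g * f' g)) m = act (Fn f') (act (Fn f) m)" if "m \<in> carrier M" for m
    using act_Fn(3)[OF that f' f] by (simp add: mult.commute)
  then show "dual_act (Fn (\<lambda>g. f g * f' g)) \<phi> = dual_act (Fn f) (dual_act (Fn f') \<phi>)"
    using f f' by (auto simp: simps)
qed (simp add: dual_space_def linear_functional_def)

text \<open>A subspace without (0, 1) contains no (0, c) with c nonzero and is thus the graph of a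
  functional on a subspace of \<open>M\<close>. Extending functionals becomes enlarging
  sets.\<close>

definition graph_space :: "('m \<times> 'k) set \<Rightarrow> bool"
  where "graph_space H \<longleftrightarrow> H \<subseteq> carrier M \<times> UNIV \<and> (\<zero>, 0) \<in> H \<and> (\<zero>, 1) \<notin> H \<and>
    (\<forall>x c y d. (x, c) \<in> H \<longrightarrow> (y, d) \<in> H \<longrightarrow> (x \<oplus> y, c + d) \<in> H) \<and>
    (\<forall>e x c. (x, c) \<in> H \<longrightarrow> (scal e x, e * c) \<in> H)"

lemma graph_spaceD:
  assumes "graph_space H"
  shows "(x, c) \<in> H \<Longrightarrow> x \<in> carrier M" and "(\<zero>, 0) \<in> H" and "(\<zero>, 1) \<notin> H"
    and "(x, c) \<in> H \<Longrightarrow> (y, d) \<in> H \<Longrightarrow> (x \<oplus> y, c + d) \<in> H"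
    and "(x, c) \<in> H \<Longrightarrow> (scal e x, e * c) \<in> H"
  using assms unfolding graph_space_def by blast+

text \<open>Zorn's lemma is applied to the subspaces of \<open>M \<times> k\<close> without the vector \<open>(0, 1)\<close>; a maximal one
  is the graph of a functional on all of \<open>M\<close>.\<close>

lemma graph_space_extend:
  assumes G: "graph_space G"
  obtains \<phi> where "\<phi> \<in> dual_space" "\<And>x c. (x, c) \<in> G \<Longrightarrow> \<phi> x = c"
proof -
  define S where "S = {H. graph_space H \<and> G \<subseteq> H}"
  have "\<exists>H\<in>S. \<forall>H'\<in>S. H \<subseteq> H' \<longrightarrow> H' = H"
  proof (rule subset_Zorn_nonempty)
    show "S \<noteq> {}" using G by (auto simp: S_def)
    fix \<C> assume ne: "\<C> \<noteq> {}" and chain: "subset.chain S \<C>"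
    have sub: "graph_space H" "G \<subseteq> H" if "H \<in> \<C>" for H
      using chain that by (auto simp: subset_chain_def S_def)
    have common: "\<exists>H\<in>\<C>. p \<in> H \<and> q \<in> H" if pq: "p \<in> \<Union>\<C>" "q \<in> \<Union>\<C>" for p q
    proof -
      obtain H H' where "H \<in> \<C>" "H' \<in> \<C>" "p \<in> H" "q \<in> H'" using pq by blast
      moreover have "H \<subseteq> H' \<or> H' \<subseteq> H"
        using chain calculation(1,2) by (auto simp: subset_chain_def)
      ultimately show ?thesis by blast
    qed
    have "graph_space (\<Union>\<C>)"
      unfolding graph_space_def
    proof (intro conjI allI impI)
      show "\<Union>\<C> \<subseteq> carrier M \<times> UNIV"
        using graph_spaceD(1)[OF sub(1)] by force
      show "(\<zero>, 1) \<notin> \<Union>\<C>"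
        using graph_spaceD(3)[OF sub(1)] by blast
      show "(\<zero>, 0) \<in> \<Union>\<C>"
        using graph_spaceD(2)[OF sub(1)] ne by blast
      show "(x \<oplus> y, c + d) \<in> \<Union>\<C>" if xy: "(x, c) \<in> \<Union>\<C>" "(y, d) \<in> \<Union>\<C>" for x c y d
        using common[OF xy] graph_spaceD(4)[OF sub(1)] by blast
      show "(scal e x, e * c) \<in> \<Union>\<C>" if x: "(x, c) \<in> \<Union>\<C>" for e x c
        using x graph_spaceD(5)[OF sub(1)] by blast
    qed
    then show "\<Union>\<C> \<in> S"
      using sub(2) ne unfolding S_def by blast
  qed
  then obtain H where H: "graph_space H" "G \<subseteq> H"
    and max: "\<And>H'. graph_space H' \<Longrightarrow> H \<subseteq> H' \<Longrightarrow> H' = H"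
    by (auto simp: S_def)
  note H_sub = graph_spaceD(1)[OF H(1)] and H_zero = graph_spaceD(2)[OF H(1)]
    and H_one = graph_spaceD(3)[OF H(1)] and H_add = graph_spaceD(4)[OF H(1)]
    and H_scal = graph_spaceD(5)[OF H(1)]
  have unique: "c = d" if xc: "(x, c) \<in> H" and xd: "(x, d) \<in> H" for x c d
  proof (rule ccontr)
    assume "c \<noteq> d"
    have "(x \<oplus> scal (- 1) x, c + - 1 * d) \<in> H"
      by (rule H_add[OF xc H_scal[OF xd]])
    then have "(\<zero>, c - d) \<in> H"
      using H_sub[OF xc] by (simp add: scal_minus_one M.r_neg)
    from H_scal[OF this, of "1 / (c - d)"] show False
      using H_one \<open>c \<noteq> d\<close> by simp
  qed
  have total: "\<exists>c. (x, c) \<in> H" if x: "x \<in> carrier M" for x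
  proof (rule ccontr)
    assume none: "\<nexists>c. (x, c) \<in> H"
    \<comment> \<open>The line through (x, 0) is added, that is, the functional is extended by the
      value 0 at \<open>x\<close>. If this produced (0, 1), then (x, - 1 / e) would already lie in
      \<open>H\<close>.\<close>
    define H' where "H' = {(y \<oplus> scal e x, c) | y c e. (y, c) \<in> H}"
    have H'I: "(y \<oplus> scal e x, c) \<in> H'" if "(y, c) \<in> H" for y c e
      using that by (auto simp: H'_def)
    have "graph_space H'"
      unfolding graph_space_def
    proof (intro conjI allI impI)
      show "H' \<subseteq> carrier M \<times> UNIV" using H_sub x by (auto simp: H'_def)
      show "(\<zero>, 0) \<in> H'" using H'I[OF H_zero, of 0] x by (simp add: scal_linear)
      show "(\<zero>, 1) \<notin> H'"
      proof
        assume "(\<zero>, 1) \<in> H'"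
        then obtain y e where y: "(y, 1) \<in> H" "\<zero> = y \<oplus> scal e x" by (auto simp: H'_def)
        have yM: "y \<in> carrier M" by (rule H_sub[OF y(1)])
        have "e \<noteq> 0"
          using y H_one yM x by (auto simp: scal_linear)
        have "\<ominus> (scal e x) = y"
          using y(2) yM x by (intro M.minus_equality) auto
        then have "y = scal (- e) x"
          using x scal_scal[of x "- 1" e] by (simp add: scal_minus_one)
        then have "(scal (- 1 / e) (scal (- e) x), - 1 / e * 1) \<in> H"
          using H_scal[OF y(1), of "- 1 / e"] by simp
        then have "(x, - 1 / e) \<in> H"
          using \<open>e \<noteq> 0\<close> x by (simp add: scal_scal scal_linear(3))
        then show False using none by blast
      qed
    next
      fix u c v d assume "(u, c) \<in> H'" "(v, d) \<in> H'"
      then obtain y e z e' where *: "(y, c) \<in> H" "(z, d) \<in> H" "u = y \<oplus> scal e x" "v = z \<oplus> scal e' x"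
        by (auto simp: H'_def)
      have "u \<oplus> v = (y \<oplus> z) \<oplus> scal (e + e') x"
        using *(3,4) H_sub[OF *(1)] H_sub[OF *(2)] x by (simp add: scal_linear(1) M.a_ac)
      then show "(u \<oplus> v, c + d) \<in> H'"
        using H'I[OF H_add[OF *(1,2)], of "e + e'"] by simp
    next
      fix r u c assume "(u, c) \<in> H'"
      then obtain y e where *: "(y, c) \<in> H" "u = y \<oplus> scal e x"
        by (auto simp: H'_def)
      then show "(scal r u, r * c) \<in> H'"
        using H'I[OF H_scal[OF *(1), of r], of "r * e"] H_sub[OF *(1)] x by (simp add: scal_add scal_scal)
    qed
    moreover have "H \<subseteq> H'"
    proof
      fix p assume "p \<in> H"
      then obtain y c where p: "p = (y, c)" "(y, c) \<in> H" by (metis surj_pair)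
      then show "p \<in> H'" using H'I[OF p(2), of 0] H_sub[OF p(2)] x by (simp add: scal_linear)
    qed
    ultimately have "H' = H" by (rule max)
    then have "(x, 0) \<in> H"
      using H'I[OF H_zero, of 1] x by (simp add: scal_linear)
    then show False using none by blast
  qed
  define \<phi> where "\<phi> x = (if x \<in> carrier M then THE c. (x, c) \<in> H else 0)" for x
  have \<phi>: "\<phi> x = c" if "(x, c) \<in> H" for x c
    using that unique H_sub by (auto simp: \<phi>_def intro: the_equality)
  have \<phi>': "(x, \<phi> x) \<in> H" if "x \<in> carrier M" for x
    using total[OF that] \<phi> by blast
  have "\<phi> \<in> dual_space"
    unfolding dual_space_def linear_functional_def
    using \<phi>[OF H_add[OF \<phi>' \<phi>']] \<phi>[OF H_scal[OF \<phi>']] by (auto simp: \<phi>_def)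
  then show thesis using that \<phi> H(2) by blast
qed

end

text \<open>Along an injective map \<phi> is a functional on the image of \<open>N\<close>, whose
  graph consists of the pairs \<open>(k n, \<phi> n)\<close>; injectivity keeps (0, 1) out of
  it.\<close>

lemma extend_functional:
  assumes N: "alg_module a N" and Q: "alg_module a Q" and k: "k \<in> lmod_hom (alg_A a) N Q"
    and inj: "inj_on k (carrier N)" and \<phi>: "alg_module.linear_functional a N \<phi>"
  obtains \<psi> where "\<psi> \<in> alg_module.dual_space a Q" "\<And>n. n \<in> carrier N \<Longrightarrow> \<psi> (k n) = \<phi> n"
proof -
  interpret N: alg_module a N by (rule N)
  interpret Q: alg_module a Q by (rule Q)
  interpret k: left_module_hom "alg_A a" N Q k
    using k by (simp add: left_module_homI N.left_module_axioms Q.left_module_axioms)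
  define G where "G = (\<lambda>n. (k n, \<phi> n)) ` carrier N"
  have \<phi>_add: "\<phi> (x \<oplus>\<^bsub>N\<^esub> y) = \<phi> x + \<phi> y" if "x \<in> carrier N" "y \<in> carrier N" for x y
    using \<phi> that by (auto simp: N.linear_functional_def)
  have \<phi>_scal: "\<phi> (N.scal c x) = c * \<phi> x" if "x \<in> carrier N" for c x
    using \<phi> that by (auto simp: N.linear_functional_def)
  have \<phi>_zero: "\<phi> \<zero>\<^bsub>N\<^esub> = 0" using \<phi>_scal[of "\<zero>\<^bsub>N\<^esub>" 0] by simp
  have "Q.graph_space G"
    unfolding Q.graph_space_def
  proof (intro conjI allI impI)
    show "G \<subseteq> carrier Q \<times> UNIV" using k.closed by (auto simp: G_def)
    show "(\<zero>\<^bsub>Q\<^esub>, 0) \<in> G" unfolding G_def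
      by (rule image_eqI[of _ _ "\<zero>\<^bsub>N\<^esub>"]) (simp_all add: k.zero \<phi>_zero)
    show "(\<zero>\<^bsub>Q\<^esub>, 1) \<notin> G"
    proof
      assume "(\<zero>\<^bsub>Q\<^esub>, 1) \<in> G"
      then obtain n where n: "n \<in> carrier N" "k n = \<zero>\<^bsub>Q\<^esub>" "\<phi> n = 1" unfolding G_def by fastforce
      then have "k n = k \<zero>\<^bsub>N\<^esub>" by (simp add: k.zero)
      then have "n = \<zero>\<^bsub>N\<^esub>" using inj_onD[OF inj] n(1) by blast
      then show False using n(3) \<phi>_zero by simp
    qed
    show "(x \<oplus>\<^bsub>Q\<^esub> y, c + d) \<in> G" if "(x, c) \<in> G" "(y, d) \<in> G" for x c y d
    proof -
      obtain n n' where "n \<in> carrier N" "n' \<in> carrier N" "x = k n" "c = \<phi> n" "y = k n'" "d = \<phi> n'"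
        using \<open>(x, c) \<in> G\<close> \<open>(y, d) \<in> G\<close> by (auto simp: G_def)
      then show ?thesis
        unfolding G_def by (intro image_eqI[of _ _ "n \<oplus>\<^bsub>N\<^esub> n'"]) (simp_all add: k.add \<phi>_add)
    qed
    show "(Q.scal e x, e * c) \<in> G" if xc: "(x, c) \<in> G" for e x c
    proof -
      obtain n where n: "n \<in> carrier N" "x = k n" "c = \<phi> n"
        using xc by (auto simp: G_def)
      then show ?thesis
        unfolding G_def using alg_module_homD(1)[OF N Q k n(1)]
        by (intro image_eqI[of _ _ "N.scal e n"]) (simp_all add: \<phi>_scal)
    qed
  qed
  then obtain \<psi> where "\<psi> \<in> Q.dual_space" "\<And>x c. (x, c) \<in> G \<Longrightarrow> \<psi> x = c"
    using Q.graph_space_extend by blast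
  then show thesis using that by (auto simp: G_def)
qed

text \<open>The functional \<open>v \<mapsto> v Nabac\<close> is a Frobenius form: with respect to it the basis is dual to itself
  up to the following permutation and signs.\<close>

primrec nf_dual :: "nf \<Rightarrow> nf" where
    "nf_dual N1 = Nabac" | "nf_dual Na = Nbac" | "nf_dual Nb = Nabc" | "nf_dual Nab = Nbc"
  | "nf_dual Nba = Nac" | "nf_dual Naba = Nc" | "nf_dual Nc = Naba" | "nf_dual Nac = Nba"
  | "nf_dual Nbc = Nab" | "nf_dual Nabc = Nb" | "nf_dual Nbac = Na" | "nf_dual Nabac = N1"

definition nf_sign :: "nf \<Rightarrow> 'k::field"
  where "nf_sign i = (if i \<in> {Nc, Nac, Nbc, Nabc, Nbac, Nabac} then 1 else - 1)"

text \<open>Let X be the operator of \<open>t\<close> and D the signed permutation sending w to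
  \<open>\<lambda>j. nf_sign j * w (nf_dual j)\<close>. The identity is X D = D X^T: D identifies
  the transposed operators with the operators themselves.\<close>

lemma nf_frobenius:
  assumes a: "a \<in> params3" and g: "g \<in> S3"
  shows "nf_op (nf_x a (conj_param a g) t) (\<lambda>j. nf_sign j * w (nf_dual j)) i =
    nf_sign i * (\<Sum>k\<in>UNIV. nf_op (nf_x a (conj_param a g) t) (nf_unit (nf_dual i)) k * w k)"
  by (cases i) (simp_all add: nf_op_simps nf_unit_def nf_sign_def UNIV_nf
      params3_eliminate[OF a g] algebra_simps)

text \<open>The reversed word of \<open>nf_dual i\<close> takes basis vector i to the longest word
  up to the sign \<open>nf_sign i\<close>, and no other basis vector contributes to that coordinate.
  Consequently a homomorphism into the model is determined by its coordinate at
  \<open>Nabac\<close>.\<close>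

lemma nf_coordinate:
  assumes a: "a \<in> params3" and g: "g \<in> S3"
  shows "v i = nf_sign i * foldr (alg_module.act a (nf_module a g) \<circ> Tr) (rev (nf_word (nf_dual i))) v Nabac"
proof -
  interpret V: alg_rep a UNIV "nf_act a g" by (rule nf_alg_rep[OF a g])
  have *: "V.rep.act (Tr t) v = nf_op (nf_x a (conj_param a g) t) v" if "t \<in> transpositions3" for t v
    using that by simp
  show ?thesis
    unfolding nf_module_def
    by (cases i) (simp_all add: * nf_op_simps nf_sign_def
        params3_eliminate[OF a g] algebra_simps del: V.rep_module_ops)
qed

lemma set_nf_word: "set (nf_word i) \<subseteq> transpositions3"
  by (cases i) auto

text \<open>Among the twelve words only the empty one and abac multiply to the identity
  permutation.\<close>

lemma nf_weight_eq_iff: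
  assumes "g \<in> S3"
  shows "nf_weight i g = g \<longleftrightarrow> i \<in> {N1, Nabac}"
proof -
  have "surj g" using assms permutes_surj by (auto simp: sym_group_carrier)
  then have *: "w \<circ> g = g \<longleftrightarrow> w = id" for w :: perm
    using \<open>surj g\<close> by (auto simp: fun_eq_iff) (metis surjD)
  show ?thesis
    by (cases i) (simp_all add: nf_weight_def comp_normalize *
        *[of "t13 \<circ> t23", unfolded comp_assoc] *[of "t23 \<circ> t13", unfolded comp_assoc])
qed

text \<open>The functional \<open>\<lambda>n. f n Nabac\<close> extends along \<open>k\<close> to
  \<psi> on \<open>Q\<close>. Its part of weight \<open>g\<close> in the dual of \<open>Q\<close> is
  the image of the generator under a homomorphism \<theta> from the model to the dual; transposing
  \<theta> gives the map \<open>h\<close> from \<open>Q\<close> to the model. Then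
  \<open>h \<circ> k\<close> and \<open>f\<close> agree at \<open>Nabac\<close>, hence
  everywhere.\<close>

lemma injective_nf_module:
  fixes TN :: "'n itself" and TP :: "'p itself" and a :: "perm \<Rightarrow> 'k::field"
  assumes a: "a \<in> params3" and g: "g \<in> S3"
  shows "injective_module TN TP (alg_A a) (nf_module a g)"
  unfolding injective_module_def alg_module_left_module
proof (intro conjI allI impI ballI)
  note V = nf_module_alg_module[OF a g]
  show "alg_module a (nf_module a g)" by (rule V)
  interpret V: alg_rep a UNIV "nf_act a g" by (rule nf_alg_rep[OF a g])
  fix N :: "(('k alg_gen word \<Rightarrow>\<^sub>0 'k) set, 'n) module" and Q :: "(('k alg_gen word \<Rightarrow>\<^sub>0 'k) set, 'p) module"
    and k f
  assume N: "alg_module a N" and Q: "alg_module a Q" and k: "k \<in> lmod_hom (alg_A a) N Q"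
    and f: "f \<in> lmod_hom (alg_A a) N (nf_module a g)" and inj: "inj_on k (carrier N)"
  interpret N: alg_module a N by (rule N)
  interpret Q: alg_module a Q by (rule Q)
  interpret D: alg_rep a Q.dual_space Q.dual_act by (rule Q.dual_alg_rep)
  let ?D = "rep_module Q.dual_space Q.dual_act"
  have f': "f \<in> lmod_hom (alg_A a) N (rep_module UNIV (nf_act a g))"
    using f by (simp add: nf_module_def)
  have "N.linear_functional (\<lambda>n. f n Nabac)"
    unfolding N.linear_functional_def
    using lmod_homD(2)[OF f'] alg_module_homD(1)[OF N V.alg_module_rep_module f'] by simp
  then obtain \<psi> where \<psi>: "\<psi> \<in> Q.dual_space" "\<And>n. n \<in> carrier N \<Longrightarrow> \<psi> (k n) = f n Nabac"
    by (rule extend_functional[OF N Q k inj]) blast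
  \<comment> \<open>The universal property needs a vector of weight \<open>g\<close>. The projection
    does not disturb the values at \<open>Nabac\<close>, a word which itself has weight
    \<open>g\<close>.\<close>
  define \<psi>g where "\<psi>g = Q.dual_act (Fn (delta g)) \<psi>"
  have "\<psi>g \<in> D.rep.wt_space g"
    using D.rep.d_op_wt_space[OF g, of \<psi>] \<psi>(1) g by (simp add: \<psi>g_def)
  then obtain \<theta> where \<theta>: "\<theta> \<in> lmod_hom (alg_A a) (nf_module a g) ?D" "\<theta> (nf_unit N1) = \<psi>g"
    using nf_module_universal[OF a g D.alg_module_rep_module] by blast
  have \<theta>': "\<theta> \<in> lmod_hom (alg_A a) (rep_module UNIV (nf_act a g)) ?D"
    using \<theta>(1) by (simp add: nf_module_def)
  have \<theta>_dual: "\<theta> v \<in> Q.dual_space" for v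
    using lmod_homD(1)[OF \<theta>', of v] by simp
  have \<theta>_add: "\<theta> (\<lambda>i. u i + v i) = (\<lambda>q. \<theta> u q + \<theta> v q)" for u v
    using lmod_homD(2)[OF \<theta>', of u v] by simp
  have \<theta>_scal: "\<theta> (\<lambda>i. c * v i) = (\<lambda>q. c * \<theta> v q)" for c v
    using alg_module_homD(1)[OF V.alg_module_rep_module D.alg_module_rep_module \<theta>', of v c] \<theta>_dual by simp
  have \<theta>_act: "\<theta> (nf_act a g x v) q = \<theta> v (Q.act x q)" if "x \<in> alg_gens" "q \<in> carrier Q" for x v q
    using alg_module_homD(2)[OF V.alg_module_rep_module D.alg_module_rep_module \<theta>', of v x] \<theta>_dual that
    by (simp add: Q.dual_act_def)
  have \<theta>_sum: "\<theta> v q = (\<Sum>i\<in>UNIV. v i * \<theta> (nf_unit i) q)" for v q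
  proof (induction v rule: nf_function_induct)
    case (unit i c)
    have "(\<Sum>j\<in>UNIV. c * nf_unit i j * \<theta> (nf_unit j) q) = (\<Sum>j\<in>UNIV. if j = i then c * \<theta> (nf_unit i) q else 0)"
      by (intro sum.cong) (auto simp: nf_unit_def)
    then show ?case by (simp add: \<theta>_scal)
  next
    case (add u v)
    then show ?case by (simp add: \<theta>_add sum.distrib distrib_right)
  qed
  \<comment> \<open>The transpose of \<theta>, followed by the signed permutation of
    \<open>nf_frobenius\<close>, which turns transposed operators back into the original
    ones.\<close>
  define h where "h q = (\<lambda>i. nf_sign i * \<theta> (nf_unit (nf_dual i)) q)" for q
  have h: "h \<in> lmod_hom (alg_A a) Q (nf_module a g)"
    unfolding nf_module_def
  proof (rule alg_module_homI[OF Q V.alg_module_rep_module])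
    fix x y assume "x \<in> carrier Q" "y \<in> carrier Q"
    then show "h (x \<oplus>\<^bsub>Q\<^esub> y) = h x \<oplus>\<^bsub>rep_module UNIV (nf_act a g)\<^esub> h y"
      using Q.dual_spaceD(1)[OF \<theta>_dual] by (simp add: h_def distrib_left)
  next
    fix c x assume "x \<in> carrier Q"
    then show "h (Q.scal c x) = V.rep.scal c (h x)"
      using Q.dual_spaceD(2)[OF \<theta>_dual] by (simp add: h_def mult.left_commute)
  next
    fix x q assume x: "(x :: 'k alg_gen) \<in> alg_gens" and q: "q \<in> carrier Q"
    have "h (Q.act x q) i = nf_act a g x (h q) i" for i
    proof -
      have "h (Q.act x q) i = nf_sign i * \<theta> (nf_act a g x (nf_unit (nf_dual i))) q"
        by (simp add: h_def \<theta>_act[OF x q])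
      also have "\<dots> = nf_act a g x (h q) i"
      proof (cases x)
        case (Fn f)
        have "nf_act a g x (nf_unit (nf_dual i)) = (\<lambda>j. f (nf_weight (nf_dual i) g) * nf_unit (nf_dual i) j)"
          by (auto simp: Fn nf_unit_def)
        moreover have "nf_weight (nf_dual i) g = nf_weight i g"
          by (cases i) (simp_all add: nf_weight_def comp_normalize)
        ultimately show ?thesis
          by (simp only: \<theta>_scal) (simp add: Fn h_def)
      next
        case (Tr t)
        show ?thesis
          using nf_frobenius[OF a g, of t "\<lambda>i. \<theta> (nf_unit i) q" i]
          by (subst \<theta>_sum) (simp add: Tr h_def)
      qed
      finally show ?thesis .
    qed
    then show "h (Q.act x q) = V.rep.act x (h q)"
      using x by auto
  qed simp
  have top: "h (k n) Nabac = f n Nabac" if n: "n \<in> carrier N" for n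
  proof -
    have "h (k n) Nabac = \<psi> (Q.act (Fn (delta g)) (k n))"
      using lmod_homD(1)[OF k n] by (simp add: h_def nf_sign_def \<theta>(2) \<psi>g_def Q.dual_act_def)
    also have "Q.act (Fn (delta g)) (k n) = k (N.act (Fn (delta g)) n)"
      using alg_module_homD(2)[OF N Q k n, of "Fn (delta g)"] g by simp
    also have "\<psi> \<dots> = f (N.act (Fn (delta g)) n) Nabac"
      using \<psi>(2) n g by simp
    also have "\<dots> = nf_act a g (Fn (delta g)) (f n) Nabac"
      using alg_module_homD(2)[OF N V.alg_module_rep_module f' n, of "Fn (delta g)"] g by simp
    also have "\<dots> = f n Nabac"
      using nf_weight_eq_iff[OF g, of Nabac] by (simp add: delta_def)
    finally show ?thesis .
  qed
  have "h (k n) = f n" if n: "n \<in> carrier N" for n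
  proof
    fix i
    let ?w = "rev (nf_word (nf_dual i))"
    have w: "set ?w \<subseteq> transpositions3" using set_nf_word by simp
    have hk: "h \<circ> k \<in> lmod_hom (alg_A a) N (nf_module a g)" by (rule lmod_hom_compose[OF k h])
    have "h (k n) i = nf_sign i * (h \<circ> k) (foldr (N.act \<circ> Tr) ?w n) Nabac"
      unfolding hom_words(1)[OF N V hk w n] using nf_coordinate[OF a g, of "h (k n)" i] by simp
    also have "\<dots> = nf_sign i * f (foldr (N.act \<circ> Tr) ?w n) Nabac"
      using top hom_words(2)[OF N V f w n] by simp
    also have "\<dots> = f n i"
      unfolding hom_words(1)[OF N V f w n] using nf_coordinate[OF a g, of "f n" i] by simp
    finally show "h (k n) i = f n i" .
  qed
  then show "\<exists>h\<in>lmod_hom (alg_A a) Q (nf_module a g). \<forall>x\<in>carrier N. h (k x) = f x"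
    using h by blast
qed

section \<open>Local Verma modules\<close>

text \<open>If \<open>z = x12 x13 x12 x23\<close> squares to zero on the generator of \<open>M\<^sub>g\<close>, then the weight space
  \<open>M\<^sub>g[g]\<close> is the local algebra of dual numbers in \<open>z\<close>: its elements outside \<open>k z\<close> generate \<open>M\<^sub>g\<close>, and
  \<open>z\<close> lies in every nonzero submodule.\<close>

abbreviation z_op :: "(perm \<Rightarrow> 'k::field) \<Rightarrow> perm \<Rightarrow> (nf \<Rightarrow> 'k) \<Rightarrow> (nf \<Rightarrow> 'k)"
  where "z_op a g \<equiv> foldr (nf_act a g \<circ> Tr) [t12, t13, t12, t23]"

locale local_verma =
  fixes a :: "perm \<Rightarrow> 'k::field" and g :: perm
  assumes a: "a \<in> params3" and g: "g \<in> S3"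
    and z_square: "z_op a g (nf_unit Nabac) = (\<lambda>_. 0)"
begin

sublocale V: alg_rep a UNIV "nf_act a g"
  by (rule nf_alg_rep[OF a g])

lemma nf_module_simps: "carrier (nf_module a g) = UNIV" "\<zero>\<^bsub>nf_module a g\<^esub> = (\<lambda>_. 0)"
  by (simp_all add: nf_module_def)

lemma act_words:
  "set ts \<subseteq> transpositions3 \<Longrightarrow> foldr (V.rep.act \<circ> Tr) ts v = foldr (nf_act a g \<circ> Tr) ts v"
  by (induction ts) simp_all

lemma d_op_eq:
  "nf_act a g (Fn (delta g)) v = (\<lambda>i. v N1 * nf_unit N1 i + v Nabac * nf_unit Nabac i)"
proof
  fix i
  have "nf_act a g (Fn (delta g)) v i = (if i \<in> {N1, Nabac} then v i else 0)"
    using nf_weight_eq_iff[OF g, of i] by (simp add: delta_def)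
  then show "nf_act a g (Fn (delta g)) v i = v N1 * nf_unit N1 i + v Nabac * nf_unit Nabac i"
    by (auto simp: nf_unit_def)
qed

lemma words_linear:
  "set ts \<subseteq> transpositions3 \<Longrightarrow> foldr (nf_act a g \<circ> Tr) ts (\<lambda>i. c * u i + d * v i) =
    (\<lambda>i. c * foldr (nf_act a g \<circ> Tr) ts u i + d * foldr (nf_act a g \<circ> Tr) ts v i)"
proof (induction ts)
  case (Cons t ts)
  then have "Tr t \<in> (alg_gens :: 'k alg_gen set)" by simp
  from V.ga_add[OF this, of "\<lambda>i. c * foldr (nf_act a g \<circ> Tr) ts u i" "\<lambda>i. d * foldr (nf_act a g \<circ> Tr) ts v i"]
    V.ga_scale[OF this, of "foldr (nf_act a g \<circ> Tr) ts u" c]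
    V.ga_scale[OF this, of "foldr (nf_act a g \<circ> Tr) ts v" d]
  show ?case using Cons by (simp add: comp_def del: nf_act.simps)
qed simp

lemma z_unit: "z_op a g (nf_unit N1) = nf_unit Nabac"
  using nf_module_unit(2)[OF a g, of Nabac] act_words[of "[t12, t13, t12, t23]" "nf_unit N1"]
  by (simp add: nf_module_def)

lemma submodule_words:
  assumes U: "submodule U (alg_A a) (nf_module a g)" and u: "u \<in> U" and ts: "set ts \<subseteq> transpositions3"
  shows "foldr (nf_act a g \<circ> Tr) ts u \<in> U"
  using ts
proof (induction ts)
  case (Cons t ts)
  then show ?case
    using V.rep.alg_submoduleD(2)[OF U[unfolded nf_module_def], of "foldr (nf_act a g \<circ> Tr) ts u" "Tr t"]
    by (simp add: comp_def del: nf_act.simps)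
qed (use u in simp)

lemma submodule_linear:
  assumes U: "submodule U (alg_A a) (nf_module a g)" and "u \<in> U" "v \<in> U"
  shows "(\<lambda>i. c * u i + d * v i) \<in> U"
  using V.rep.alg_submoduleD(1)[OF U[unfolded nf_module_def], of u c]
    V.rep.alg_submoduleD(1)[OF U[unfolded nf_module_def], of v d]
    V.rep.submoduleD(3)[OF U[unfolded nf_module_def], of "\<lambda>i. c * u i" "\<lambda>i. d * v i"] assms(2,3)
  by simp

text \<open>Projection to weight \<open>g\<close> keeps the coordinates at \<open>N1\<close> and
  \<open>Nabac\<close>. Applying z then moves the first to \<open>Nabac\<close> and kills the
  second.\<close>

lemma submodule_weight:
  assumes U: "submodule U (alg_A a) (nf_module a g)" and u: "u \<in> U"
  shows "(\<lambda>i. u N1 * nf_unit N1 i + u Nabac * nf_unit Nabac i) \<in> U"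
    and "(\<lambda>i. u N1 * nf_unit Nabac i) \<in> U"
proof -
  show w: "(\<lambda>i. u N1 * nf_unit N1 i + u Nabac * nf_unit Nabac i) \<in> U"
    using V.rep.alg_submoduleD(2)[OF U[unfolded nf_module_def] u, of "Fn (delta g)"] g
    unfolding d_op_eq[symmetric] by simp
  have "set [t12, t13, t12, t23] \<subseteq> transpositions3" by simp
  from submodule_words[OF U w this] show "(\<lambda>i. u N1 * nf_unit Nabac i) \<in> U"
    unfolding words_linear[OF \<open>set [t12, t13, t12, t23] \<subseteq> transpositions3\<close>] z_unit z_square by simp
qed

lemma submodule_eq_carrier:
  assumes U: "submodule U (alg_A a) (nf_module a g)" and u: "u \<in> U" "u N1 \<noteq> 0"
  shows "U = UNIV"
proof (rule nf_module_submodule_eq[OF a g U])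
  note w = submodule_weight[OF U u(1)]
  \<comment> \<open>With \<alpha> = \<open>u N1\<close> and \<beta> = \<open>u Nabac\<close>, the
    coefficients 1/\<alpha> and -\<beta>/\<alpha>^2 are those of the inverse of \<alpha> + \<beta> z
    in the dual numbers.\<close>
  have "(\<lambda>i. (1 / u N1) * (u N1 * nf_unit N1 i + u Nabac * nf_unit Nabac i) +
      (- u Nabac / (u N1 * u N1)) * (u N1 * nf_unit Nabac i)) \<in> U"
    by (rule submodule_linear[OF U w])
  moreover have "(\<lambda>i. (1 / u N1) * (u N1 * nf_unit N1 i + u Nabac * nf_unit Nabac i) +
      (- u Nabac / (u N1 * u N1)) * (u N1 * nf_unit Nabac i)) = nf_unit N1"
    using u(2) by (auto simp: field_simps)
  ultimately show "nf_unit N1 \<in> U" by simp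
qed

text \<open>By \<open>nf_coordinate\<close> a suitable word carries a nonzero coordinate of
  \<open>u\<close> to \<open>Nabac\<close>. Projection to weight \<open>g\<close> then yields a
  multiple of the image of z, or else the submodule contains the generator.\<close>

lemma socle_in_submodule:
  assumes U: "submodule U (alg_A a) (nf_module a g)" and u: "u \<in> U" "u \<noteq> (\<lambda>_. 0)"
  shows "nf_unit Nabac \<in> U"
proof -
  obtain i where i: "u i \<noteq> 0" using u(2) by auto
  let ?ts = "rev (nf_word (nf_dual i))"
  define w where "w = foldr (nf_act a g \<circ> Tr) ?ts u"
  have ts: "set ?ts \<subseteq> transpositions3" using set_nf_word by simp
  have w: "w \<in> U" unfolding w_def by (rule submodule_words[OF U u(1) ts])
  have "w Nabac \<noteq> 0"
    using nf_coordinate[OF a g, of u i] i unfolding nf_module_def act_words[OF ts] w_def by auto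
  show ?thesis
  proof (cases "w N1 = 0")
    case True
    then have "(\<lambda>i. w Nabac * nf_unit Nabac i) \<in> U" using submodule_weight(1)[OF U w] by simp
    from submodule_linear[OF U this this, of "1 / w Nabac" 0] show ?thesis
      using \<open>w Nabac \<noteq> 0\<close> by simp
  next
    case False
    then show ?thesis using submodule_eq_carrier[OF U w] by simp
  qed
qed

text \<open>If a proper submodule still surjected, it would contain a preimage of \<open>s\<close>
  without \<open>N1\<close> coordinate. Projected to weight \<open>g\<close> this gives s = \<beta>
  z s for a scalar \<beta>; applying z once more gives z s = 0, hence s = 0.\<close>

lemma projective_cover_nf_module:
  assumes S: "simple_module (alg_A a) S" and s: "s \<in> alg_module.wt_space a S g" "s \<noteq> \<zero>\<^bsub>S\<^esub>"
  shows "projective_cover TN TP (alg_A a) (nf_module a g) S"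
proof -
  have mod_S: "alg_module a S" using S by (simp add: simple_module_def alg_module_def)
  interpret S: alg_module a S by (rule mod_S)
  note V = nf_module_alg_module[OF a g]
  obtain h where h: "h \<in> lmod_hom (alg_A a) (nf_module a g) S" "h (nf_unit N1) = s"
    using nf_module_universal[OF a g mod_S s(1)] by blast
  interpret h: left_module_hom "alg_A a" "nf_module a g" S h
    using h(1) V mod_S by (simp add: left_module_homI alg_module_def)
  have surj: "h ` carrier (nf_module a g) = carrier S"
    using hom_onto_simple[OF h.M.left_module_axioms S h(1)] h(2) s(2) nf_module_simps(1) by blast
  have ts: "set [t12, t13, t12, t23] \<subseteq> transpositions3" by simp
  have h_z: "h (z_op a g v) = foldr (S.act \<circ> Tr) [t12, t13, t12, t23] (h v)" for v
    using hom_words(1)[OF V mod_S h(1) ts, of v] act_words[OF ts] nf_module_simps(1)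
    unfolding nf_module_def by simp
  have h_scal: "h (\<lambda>i. c * v i) = S.scal c (h v)" for c v
    using alg_module_homD(1)[OF V mod_S h(1), of v c] nf_module_simps(1)
    unfolding nf_module_def by simp
  have "superfluous_submodule (a_kernel (nf_module a g) S h) (alg_A a) (nf_module a g)"
    unfolding h.superfluous_kernel_iff[OF surj]
  proof (intro allI impI)
    fix U assume U: "submodule U (alg_A a) (nf_module a g)" and "h ` U = carrier S"
    then obtain u where uk: "u \<in> U" and hu: "h u = s"
      using S.wt_space_closed[OF s(1)] by (metis imageE)
    show "U = carrier (nf_module a g)"
    proof (cases "u N1 = 0")
      case False
      then show ?thesis using submodule_eq_carrier[OF U uk] by (simp add: nf_module_simps)
    next
      case True
      have "h (nf_act a g (Fn (delta g)) u) = S.act (Fn (delta g)) s"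
        using alg_module_homD(2)[OF V mod_S h(1), of u "Fn (delta g)"] g hu nf_module_simps(1)
        unfolding nf_module_def by simp
      also have "\<dots> = s" using s(1) by (simp add: S.wt_space_def)
      finally have s_eq: "s = S.scal (u Nabac) (h (nf_unit Nabac))"
        using True unfolding d_op_eq by (simp add: h_scal)
      have hz_closed: "h (nf_unit Nabac) \<in> carrier S" by (rule h.closed) (simp add: nf_module_simps)
      have "h (nf_unit Nabac) = foldr (S.act \<circ> Tr) [t12, t13, t12, t23] s"
        using h_z[of "nf_unit N1"] unfolding z_unit h(2) by simp
      also have "\<dots> = foldr (S.act \<circ> Tr) [t12, t13, t12, t23] (h (\<lambda>i. u Nabac * nf_unit Nabac i))"
        using s_eq by (simp add: h_scal)
      also have "\<dots> = h (\<lambda>_. 0)"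
        using words_linear[OF ts, of "u Nabac" "nf_unit Nabac" 0 "nf_unit Nabac"]
        unfolding h_z[symmetric] z_square by simp
      also have "\<dots> = \<zero>\<^bsub>S\<^esub>" using h.zero by (simp add: nf_module_simps)
      finally have "s = \<zero>\<^bsub>S\<^esub>" using s_eq by simp
      then show ?thesis using s(2) by simp
    qed
  qed
  then show ?thesis
    unfolding projective_cover_def using projective_nf_module[OF a g] surj
    by (intro conjI S.left_module_axioms bexI[OF _ h(1)])
qed

text \<open>Essentiality is immediate once the image of \<open>S\<close> contains
  \<open>nf_unit Nabac\<close>, which lies in every nonzero submodule.\<close>

lemma injective_hull_nf_module:
  assumes S: "simple_module (alg_A a) S" and h: "h \<in> lmod_hom (alg_A a) S (nf_module a g)"
    and s: "s \<in> carrier S" "h s = nf_unit Nabac"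
  shows "injective_hull TN TP (alg_A a) (nf_module a g) S"
proof -
  note V = nf_module_alg_module[OF a g, folded alg_module_left_module]
  interpret h: left_module_hom "alg_A a" S "nf_module a g" h
    using S V h by (simp add: left_module_homI simple_module_def)
  have unit: "nf_unit Nabac \<noteq> (\<lambda>_. 0 :: 'k)" by (auto simp: nf_unit_def fun_eq_iff)
  have inj: "inj_on h (carrier S)"
    by (rule hom_from_simple_inj[OF V S h s(1)]) (use s(2) unit in \<open>simp add: nf_module_simps\<close>)
  have "essential_submodule (h ` carrier S) (alg_A a) (nf_module a g)"
    unfolding essential_submodule_def
  proof (intro conjI allI impI h.submodule_image h.M.submodule_carrier)
    fix U assume "submodule U (alg_A a) (nf_module a g) \<and> U \<inter> h ` carrier S = {\<zero>\<^bsub>nf_module a g\<^esub>}"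
    then have U: "submodule U (alg_A a) (nf_module a g)" and US: "U \<inter> h ` carrier S = {\<lambda>_. 0}"
      by (auto simp: nf_module_simps)
    have "u = (\<lambda>_. 0)" if "u \<in> U" for u
    proof (rule ccontr)
      assume "u \<noteq> (\<lambda>_. 0)"
      then have "nf_unit Nabac \<in> U \<inter> h ` carrier S"
        using socle_in_submodule[OF U that] imageI[OF s(1), of h] s(2) by simp
      then show False using US unit by simp
    qed
    then show "U = {\<zero>\<^bsub>nf_module a g\<^esub>}"
      using h.N.submoduleD(2)[OF U] unfolding nf_module_simps by blast
  qed
  then show ?thesis
    unfolding injective_hull_def using injective_nf_module[OF a g] inj
    by (intro conjI h.M.left_module_axioms bexI[OF _ h])
qed

end

section \<open>Simple modules\<close>

definition graded_space :: "perm set \<Rightarrow> (perm \<Rightarrow> 'k::zero) set"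
  where "graded_space B = {v. \<forall>g. g \<notin> B \<longrightarrow> v g = 0}"

lemma graded_module_eq: "graded_module B \<xi> = rep_module (graded_space B) (gen_act B \<xi>)"
  by (simp add: graded_module_eq_rep_module graded_space_def)

lemma graded_alg_repI:
  fixes a :: "perm \<Rightarrow> 'k::field"
  assumes B: "B \<subseteq> S3"
    and closed: "\<And>t v. t \<in> transpositions3 \<Longrightarrow> v \<in> graded_space B \<Longrightarrow> gen_act B \<xi> (Tr t) v \<in> graded_space B"
    and weight: "\<And>t v h k. t \<in> transpositions3 \<Longrightarrow> v \<in> graded_space B \<Longrightarrow> h \<in> S3 \<Longrightarrow> k \<in> B \<Longrightarrow>
      delta h k * gen_act B \<xi> (Tr t) v k = gen_act B \<xi> (Tr t) (\<lambda>i. delta (t \<circ> h) i * v i) k"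
    and square: "\<And>t v k. t \<in> transpositions3 \<Longrightarrow> v \<in> graded_space B \<Longrightarrow> k \<in> B \<Longrightarrow>
      gen_act B \<xi> (Tr t) (gen_act B \<xi> (Tr t) v) k = f_elt a t k * v k"
    and quadratic: "\<And>v k. v \<in> graded_space B \<Longrightarrow> k \<in> B \<Longrightarrow> gen_act B \<xi> (Tr t13) (gen_act B \<xi> (Tr t23) v) k +
        gen_act B \<xi> (Tr t23) (gen_act B \<xi> (Tr t12) v) k + gen_act B \<xi> (Tr t12) (gen_act B \<xi> (Tr t13) v) k = 0"
      "\<And>v k. v \<in> graded_space B \<Longrightarrow> k \<in> B \<Longrightarrow> gen_act B \<xi> (Tr t23) (gen_act B \<xi> (Tr t13) v) k +
        gen_act B \<xi> (Tr t13) (gen_act B \<xi> (Tr t12) v) k + gen_act B \<xi> (Tr t12) (gen_act B \<xi> (Tr t23) v) k = 0"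
  shows "alg_rep a (graded_space B) (gen_act B \<xi>)"
proof
  fix v u :: "perm \<Rightarrow> 'k" and c and g :: "'k alg_gen" and i
  show "(\<lambda>_. 0) \<in> (graded_space B :: (_ \<Rightarrow> 'k) set)" by (simp add: graded_space_def)
  show "gen_act B \<xi> g (\<lambda>i. u i + v i) = (\<lambda>i. gen_act B \<xi> g u i + gen_act B \<xi> g v i)"
    "gen_act B \<xi> g (\<lambda>i. c * v i) = (\<lambda>i. c * gen_act B \<xi> g v i)"
    by (cases g; simp add: fun_eq_iff sum.distrib sum_distrib_left algebra_simps)+
  assume v: "v \<in> graded_space B"
  have out: "u k = 0" if "u \<in> graded_space B" "k \<notin> B" for u :: "_ \<Rightarrow> 'k" and k
    using that by (simp add: graded_space_def)
  have mult: "(\<lambda>i. f i * v i) \<in> graded_space B" for f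
    using v by (simp add: graded_space_def)
  show "(\<lambda>i. c * v i) \<in> graded_space B"
    using v by (simp add: graded_space_def)
  show "gen_act B \<xi> g v \<in> graded_space B" if "g \<in> alg_gens"
    using that v closed by (auto simp: alg_gens_def mult simp del: gen_act.simps(2))
  show "gen_act B \<xi> (Fn (\<lambda>g. if g \<in> S3 then 1 else 0)) v = v"
    using B out[OF v] by (auto simp: fun_eq_iff)
  show "gen_act B \<xi> (Fn (delta h)) (gen_act B \<xi> (Tr t) v) = gen_act B \<xi> (Tr t) (gen_act B \<xi> (Fn (delta (t \<circ> h))) v)"
    if "h \<in> S3" "t \<in> transpositions3" for h t
  proof
    fix k
    show "gen_act B \<xi> (Fn (delta h)) (gen_act B \<xi> (Tr t) v) k = gen_act B \<xi> (Tr t) (gen_act B \<xi> (Fn (delta (t \<circ> h))) v) k"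
      using weight[OF that(2) v that(1), of k] out[OF closed[OF that(2) v], of k]
        out[OF closed[OF that(2) mult], of k "delta (t \<circ> h)"]
      by (cases "k \<in> B") (simp_all del: gen_act.simps(2))
  qed
  show "gen_act B \<xi> (Tr t) (gen_act B \<xi> (Tr t) v) = gen_act B \<xi> (Fn (f_elt a t)) v"
    if "t \<in> transpositions3" for t
  proof
    fix k
    show "gen_act B \<xi> (Tr t) (gen_act B \<xi> (Tr t) v) k = gen_act B \<xi> (Fn (f_elt a t)) v k"
      using square[OF that v, of k] out[OF closed[OF that closed[OF that v]], of k] out[OF v, of k]
      by (cases "k \<in> B") (simp_all del: gen_act.simps(2))
  qed
  have out2: "gen_act B \<xi> (Tr t) (gen_act B \<xi> (Tr t') v) k = 0"
    if "t \<in> transpositions3" "t' \<in> transpositions3" "k \<notin> B" for t t' k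
    using out[OF closed[OF that(1) closed[OF that(2) v]] that(3)] .
  show "gen_act B \<xi> (Tr t13) (gen_act B \<xi> (Tr t23) v) i +
        gen_act B \<xi> (Tr t23) (gen_act B \<xi> (Tr t12) v) i + gen_act B \<xi> (Tr t12) (gen_act B \<xi> (Tr t13) v) i = 0"
    using quadratic(1)[OF v, of i] out2[of _ _ i] by (cases "i \<in> B") (simp_all del: gen_act.simps(2))
  show "gen_act B \<xi> (Tr t23) (gen_act B \<xi> (Tr t13) v) i +
        gen_act B \<xi> (Tr t13) (gen_act B \<xi> (Tr t12) v) i + gen_act B \<xi> (Tr t12) (gen_act B \<xi> (Tr t23) v) i = 0"
    using quadratic(2)[OF v, of i] out2[of _ _ i] by (cases "i \<in> B") (simp_all del: gen_act.simps(2))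
  show "(\<lambda>i. v i + u i) \<in> graded_space B" if "u \<in> graded_space B"
    using that v by (simp add: graded_space_def)
qed (simp_all add: algebra_simps)

lemma delta_graded_space: "g \<in> B \<Longrightarrow> delta g \<in> graded_space B"
  by (auto simp: graded_space_def delta_def)

lemma delta_nonzero: "delta g \<noteq> (\<lambda>_. 0)"
  by (metis delta_def zero_neq_one)

text \<open>Weight spaces are at most one-dimensional, so projecting and normalizing a nonzero
  vector of a submodule gives some \<open>delta g\<close>. What remains for simplicity is that every
  basis vector can be reached from every other.\<close>

lemma graded_simple:
  fixes a :: "perm \<Rightarrow> 'k::field"
  assumes rep: "alg_rep a (graded_space B) (gen_act B \<xi>)" and B: "B \<subseteq> S3" "B \<noteq> {}"
    and gen: "\<And>U g h. submodule U (alg_A a) (graded_module B \<xi>) \<Longrightarrow> g \<in> B \<Longrightarrow> h \<in> B \<Longrightarrow>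
      delta g \<in> U \<Longrightarrow> delta h \<in> U"
  shows "simple_module (alg_A a) (graded_module B \<xi>)"
proof -
  interpret M: alg_rep a "graded_space B" "gen_act B \<xi>" by (rule rep)
  have "finite B" using B(1) by (rule finite_subset) simp
  show ?thesis
    unfolding simple_module_def
  proof (intro conjI allI impI)
    show "left_module (alg_A a) (graded_module B \<xi>)"
      unfolding graded_module_eq by (rule M.rep.left_module_axioms)
    obtain g where "g \<in> B" using B(2) by blast
    then have "(delta g :: _ \<Rightarrow> 'k) \<in> graded_space B"
      by (rule delta_graded_space)
    moreover have "delta g \<noteq> (\<lambda>_. 0 :: 'k)"
      by (simp add: delta_nonzero)
    ultimately show "carrier (graded_module B \<xi>) \<noteq> {\<zero>\<^bsub>graded_module B \<xi>\<^esub>}"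
      unfolding graded_module_eq by auto
    fix U assume U: "submodule U (alg_A a) (graded_module B \<xi>)"
    note U' = U[unfolded graded_module_eq]
    show "U = {\<zero>\<^bsub>graded_module B \<xi>\<^esub>} \<or> U = carrier (graded_module B \<xi>)"
    proof (cases "U = {\<lambda>_. 0}")
      case True
      then show ?thesis by (simp add: graded_module_eq)
    next
      case False
      moreover have "(\<lambda>_. 0) \<in> U" "U \<subseteq> graded_space B"
        using M.rep.submoduleD(1,2)[OF U'] by auto
      ultimately obtain v g where v: "v \<in> U" "v g \<noteq> 0" "v \<in> graded_space B" by fastforce
      then have g: "g \<in> B" by (auto simp: graded_space_def)
      have "(\<lambda>i. delta g i * v i) \<in> U"
        using M.rep.alg_submoduleD(2)[OF U' v(1), of "Fn (delta g)"] v(3) g B(1) by auto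
      then have "(\<lambda>i. (1 / v g) * (delta g i * v i)) \<in> U"
        using M.rep.alg_submoduleD(1)[OF U', of "\<lambda>i. delta g i * v i" "1 / v g"] \<open>U \<subseteq> graded_space B\<close> by auto
      moreover have "(\<lambda>i. (1 / v g) * (delta g i * v i)) = delta g"
        using v(2) by (auto simp: delta_def)
      ultimately have "delta g \<in> U" by simp
      then have delta: "delta h \<in> U" if "h \<in> B" for h
        using gen[OF U g that] by simp
      have "u \<in> U" if u: "u \<in> graded_space B" for u
      proof -
        have "(\<lambda>i. \<Sum>h\<in>I. u h * delta h i) \<in> U" if "finite I" "I \<subseteq> B" for I
          using that
        proof (induction I rule: finite_induct)
          case empty
          then show ?case using \<open>(\<lambda>_. 0) \<in> U\<close> by simp
        next
          case (insert h I)
          then have "(\<lambda>i. u h * delta h i) \<in> U"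
            using M.rep.alg_submoduleD(1)[OF U' delta, of h "u h"] M.rep_module_ops(1)[OF delta_graded_space]
            by simp
          then show ?case
            using insert M.rep.submoduleD(3)[OF U'] by simp
        qed
        from this[OF \<open>finite B\<close> order_refl] have "(\<lambda>i. \<Sum>h\<in>B. u h * delta h i) \<in> U" .
        moreover have "(\<Sum>h\<in>B. u h * delta h i) = u i" for i
          using u \<open>finite B\<close> by (cases "i \<in> B") (simp_all add: delta_def if_distrib graded_space_def cong: if_cong)
        ultimately show ?thesis by simp
      qed
      then show ?thesis using \<open>U \<subseteq> graded_space B\<close> by (auto simp: graded_module_eq)
    qed
  qed
qed

text \<open>Homomorphisms preserve weights, so a basis vector whose weight does not occur in the
  target is sent to zero.\<close>

lemma graded_not_iso:
  fixes a :: "perm \<Rightarrow> 'k::field"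
  assumes rep: "alg_rep a (graded_space B) (gen_act B \<xi>)" and rep': "alg_rep a (graded_space B') (gen_act B' \<xi>')"
    and g: "g \<in> B" "g \<notin> B'" "g \<in> S3"
  shows "\<not> lmod_iso (alg_A a) (graded_module B \<xi>) (graded_module B' \<xi>')"
proof
  interpret M: alg_rep a "graded_space B" "gen_act B \<xi>" by (rule rep)
  interpret N: alg_rep a "graded_space B'" "gen_act B' \<xi>'" by (rule rep')
  assume "lmod_iso (alg_A a) (graded_module B \<xi>) (graded_module B' \<xi>')"
  then obtain h where h: "h \<in> lmod_hom (alg_A a) (rep_module (graded_space B) (gen_act B \<xi>)) (rep_module (graded_space B') (gen_act B' \<xi>'))"
    and bij: "bij_betw h (graded_space B) (graded_space B')"
    by (auto simp: lmod_iso_def graded_module_eq)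
  interpret h: left_module_hom "alg_A a" "rep_module (graded_space B) (gen_act B \<xi>)" "rep_module (graded_space B') (gen_act B' \<xi>')" h
    using h M.rep.left_module_axioms N.rep.left_module_axioms
    by (simp add: left_module_homI)
  have d: "delta g \<in> graded_space B" by (rule delta_graded_space[OF g(1)])
  have hd: "h (delta g) \<in> graded_space B'" using h.closed[of "delta g"] d by simp
  have "(\<lambda>i. delta g i * delta g i) = (delta g :: _ \<Rightarrow> 'k)" by (auto simp: delta_def)
  then have "h (delta g) = (\<lambda>i. delta g i * h (delta g) i)"
    using alg_module_homD(2)[OF M.alg_module_rep_module N.alg_module_rep_module h, of "delta g" "Fn (delta g)"]
      d hd g(3) by simp
  then have *: "h (delta g) i = delta g i * h (delta g) i" for i by (rule fun_cong)
  have "h (delta g) i = 0" for i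
  proof (cases "i = g")
    case True
    then show ?thesis using hd g(2) by (simp add: graded_space_def)
  next
    case False
    then show ?thesis by (subst *) (simp add: delta_def)
  qed
  then have "h (delta g) = h (\<lambda>_. 0)" using h.zero by auto
  moreover have "(\<lambda>_. 0) \<in> (graded_space B :: (_ \<Rightarrow> 'k) set)" by (rule M.C_zero)
  ultimately have "delta g = (\<lambda>_. 0 :: 'k)"
    using bij d inj_onD[of h "graded_space B" "delta g" "\<lambda>_. 0"] by (simp add: bij_betw_def)
  then show False by (simp add: delta_nonzero)
qed

section \<open>The parameters of the theorem and the explicit simple modules\<close>

lemma conj_param_values:
  "conj_param a id t = a t"
  "conj_param a t12 t12 = a t12" "conj_param a t12 t13 = a t23" "conj_param a t12 t23 = a t13"
  "conj_param a t13 t12 = a t23" "conj_param a t13 t13 = a t13" "conj_param a t13 t23 = a t12"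
  "conj_param a t23 t12 = a t13" "conj_param a t23 t13 = a t12" "conj_param a t23 t23 = a t23"
  "conj_param a (t13 \<circ> t23) t12 = a t23" "conj_param a (t13 \<circ> t23) t13 = a t12"
  "conj_param a (t13 \<circ> t23) t23 = a t13"
  "conj_param a (t23 \<circ> t13) t12 = a t13" "conj_param a (t23 \<circ> t13) t13 = a t23"
  "conj_param a (t23 \<circ> t13) t23 = a t12"
  by (simp_all add: conj_param_def S3_inv comp_assoc comp_normalize comp_normalize_closed)

lemma delta_simps: "delta g g = 1" "h \<noteq> g \<Longrightarrow> delta g h = 0"
  by (simp_all add: delta_def)

lemma L_basis_S3: "L_basis \<subseteq> S3"
  by (simp add: L_basis_def)

locale special_params =
  fixes a :: "perm \<Rightarrow> 'k::field_char_0"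
  assumes params: "a \<in> params3" and neq: "a t12 \<noteq> a t13" and eq: "a t13 = a t23"
begin

text \<open>Up to sign the only nonzero value that the functions f_ij take on the weights of
  L.\<close>

definition gap :: 'k
  where "gap = a t13 - a t12"

lemma gap_nonzero: "gap \<noteq> 0"
  using neq by (simp add: gap_def)

lemma param_values: "a t23 = a t13" "a t12 = - 2 * a t13" "gap = 3 * a t13"
proof -
  have "a t12 + 2 * a t13 = a t12 + a t13 + a t23"
    unfolding eq mult_2 by (rule add.assoc[symmetric])
  also have "\<dots> = 0" using params by (simp add: params3_def)
  finally have *: "a t12 = - (2 * a t13)"
    by (simp add: eq_neg_iff_add_eq_0)
  then show "a t12 = - 2 * a t13" by simp
  show "gap = 3 * a t13" unfolding gap_def * by simp
  show "a t23 = a t13" by (simp add: eq)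
qed

lemma S3_sign:
  "sign t13 = - 1" "sign t23 = - 1" "sign (t13 \<circ> t23) = 1" "sign (t23 \<circ> t13) = 1"
  by (simp_all add: sign_compose[OF permutation_swap_id permutation_swap_id] sign_swap_id)

lemma L_x_values:
  "L_x a t12 t13 = delta (t13 \<circ> t23)" "L_x a t12 t23 = delta (t23 \<circ> t13)"
  "L_x a t12 (t13 \<circ> t23) = (\<lambda>h. - gap * delta t13 h)" "L_x a t12 (t23 \<circ> t13) = (\<lambda>h. - gap * delta t23 h)"
  "L_x a t13 t13 = (\<lambda>_. 0)" "L_x a t13 t23 = delta (t13 \<circ> t23)"
  "L_x a t13 (t13 \<circ> t23) = (\<lambda>h. gap * delta t23 h)" "L_x a t13 (t23 \<circ> t13) = (\<lambda>_. 0)"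
  "L_x a t23 t13 = delta (t23 \<circ> t13)" "L_x a t23 t23 = (\<lambda>_. 0)"
  "L_x a t23 (t13 \<circ> t23) = (\<lambda>_. 0)" "L_x a t23 (t23 \<circ> t13) = (\<lambda>h. gap * delta t13 h)"
  by (simp_all add: L_x_def S3_sign comp_normalize comp_normalize_closed conj_param_values gap_def eq
      f_elt_conj_param[OF S3_closed(6)[OF S3_closed(4)]] f_elt_conj_param[OF S3_closed(7)[OF S3_closed(3)]])

lemma L_gen_act:
  "gen_act L_basis \<xi> (Tr t) v = (\<lambda>h. v t13 * \<xi> t t13 h + v t23 * \<xi> t t23 h +
    v (t13 \<circ> t23) * \<xi> t (t13 \<circ> t23) h + v (t23 \<circ> t13) * \<xi> t (t23 \<circ> t13) h)"
  by (simp add: L_basis_def add.assoc)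

lemma L_x_eq:
  "gen_act L_basis (L_x a) (Tr t12) v = (\<lambda>h. if h = t13 \<circ> t23 then v t13 else if h = t23 \<circ> t13 then v t23
    else if h = t13 then - gap * v (t13 \<circ> t23) else if h = t23 then - gap * v (t23 \<circ> t13) else 0)"
  "gen_act L_basis (L_x a) (Tr t13) v = (\<lambda>h. if h = t13 \<circ> t23 then v t23
    else if h = t23 then gap * v (t13 \<circ> t23) else 0)"
  "gen_act L_basis (L_x a) (Tr t23) v = (\<lambda>h. if h = t23 \<circ> t13 then v t13
    else if h = t13 then gap * v (t23 \<circ> t13) else 0)"
  unfolding L_gen_act L_x_values by (rule ext, simp add: delta_def)+

lemma L_alg_rep: "alg_rep a (graded_space L_basis) (gen_act L_basis (L_x a))"
proof (rule graded_alg_repI[OF L_basis_S3])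
  fix t v assume t: "t \<in> transpositions3" and v: "v \<in> (graded_space L_basis :: (_ \<Rightarrow> 'k) set)"
  show "gen_act L_basis (L_x a) (Tr t) v \<in> graded_space L_basis"
    using t unfolding transpositions3_def
    by (elim insertE emptyE; simp only: L_x_eq; simp add: graded_space_def L_basis_def)
  show "delta h k * gen_act L_basis (L_x a) (Tr t) v k = gen_act L_basis (L_x a) (Tr t) (\<lambda>i. delta (t \<circ> h) i * v i) k"
    if "k \<in> L_basis" for h k
    using t that[unfolded L_basis_def] unfolding transpositions3_def
    by (elim insertE emptyE; simp only: L_x_eq; simp add: delta_transposition comp_normalize comp_normalize_closed)
  show "gen_act L_basis (L_x a) (Tr t) (gen_act L_basis (L_x a) (Tr t) v) k = f_elt a t k * v k"
    if "k \<in> L_basis" for k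
    using t that[unfolded L_basis_def] unfolding transpositions3_def
    by (elim insertE emptyE; simp only: L_x_eq; simp add: f_elt_conj_param conj_param_values gap_def eq)
next
  fix v k assume "v \<in> (graded_space L_basis :: (_ \<Rightarrow> 'k) set)" and k: "k \<in> L_basis"
  show "gen_act L_basis (L_x a) (Tr t13) (gen_act L_basis (L_x a) (Tr t23) v) k +
        gen_act L_basis (L_x a) (Tr t23) (gen_act L_basis (L_x a) (Tr t12) v) k +
        gen_act L_basis (L_x a) (Tr t12) (gen_act L_basis (L_x a) (Tr t13) v) k = 0"
    "gen_act L_basis (L_x a) (Tr t23) (gen_act L_basis (L_x a) (Tr t13) v) k +
        gen_act L_basis (L_x a) (Tr t13) (gen_act L_basis (L_x a) (Tr t12) v) k +
        gen_act L_basis (L_x a) (Tr t12) (gen_act L_basis (L_x a) (Tr t23) v) k = 0"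
    using k[unfolded L_basis_def] by (elim insertE emptyE; simp only: L_x_eq; simp)+
qed

lemma L_simple: "simple_module (alg_A a) (L_module a)"
  unfolding L_module_def
proof (rule graded_simple[OF L_alg_rep L_basis_S3])
  show "L_basis \<noteq> {}" by (simp add: L_basis_def)
  interpret L: alg_rep a "graded_space L_basis" "gen_act L_basis (L_x a)" by (rule L_alg_rep)
  fix U g h
  assume "submodule U (alg_A a) (graded_module L_basis (L_x a))"
    and g: "g \<in> L_basis" and h: "h \<in> L_basis" and U: "delta g \<in> U"
  then have sub: "submodule U (alg_A a) (rep_module (graded_space L_basis) (gen_act L_basis (L_x a)))"
    by (simp add: graded_module_eq)
  have in_L: "t13 \<in> L_basis" "t23 \<in> L_basis" "t13 \<circ> t23 \<in> L_basis" "t23 \<circ> t13 \<in> L_basis"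
    by (simp_all add: L_basis_def)
  have x: "(\<lambda>i. c * gen_act L_basis (L_x a) (Tr t) (delta k) i) \<in> U"
    if "delta k \<in> U" "t \<in> transpositions3" "k \<in> L_basis" for c t k
    using L.rep.alg_submoduleD(1)[OF sub L.rep.alg_submoduleD(2)[OF sub that(1)], of "Tr t" c] that
      L.ga_closed[OF _ delta_graded_space[OF that(3)], of "Tr t"]
    by (simp add: L.rep_module_ops(2)[OF delta_graded_space] del: gen_act.simps)
  \<comment> \<open>These four arrows form a cycle through all of \<open>L_basis\<close>; their
    coefficients 1 and \<open>gap\<close> are invertible.\<close>
  have arrows: "gen_act L_basis (L_x a) (Tr t12) (delta t13) = (\<lambda>i. 1 * delta (t13 \<circ> t23) i)"
    "gen_act L_basis (L_x a) (Tr t13) (delta (t13 \<circ> t23)) = (\<lambda>i. gap * delta t23 i)"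
    "gen_act L_basis (L_x a) (Tr t12) (delta t23) = (\<lambda>i. 1 * delta (t23 \<circ> t13) i)"
    "gen_act L_basis (L_x a) (Tr t23) (delta (t23 \<circ> t13)) = (\<lambda>i. gap * delta t13 i)"
    unfolding L_x_eq by (auto simp: delta_def)
  have 1: "delta t13 \<in> U \<Longrightarrow> delta (t13 \<circ> t23) \<in> U"
    using x[of t13 t12 1] in_L unfolding arrows by simp
  have 2: "delta (t13 \<circ> t23) \<in> U \<Longrightarrow> delta t23 \<in> U"
    using x[of "t13 \<circ> t23" t13 "1 / gap"] in_L gap_nonzero unfolding arrows by simp
  have 3: "delta t23 \<in> U \<Longrightarrow> delta (t23 \<circ> t13) \<in> U"
    using x[of t23 t12 1] in_L unfolding arrows by simp
  have 4: "delta (t23 \<circ> t13) \<in> U \<Longrightarrow> delta t13 \<in> U"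
    using x[of "t23 \<circ> t13" t23 "1 / gap"] in_L gap_nonzero unfolding arrows by simp
  show "delta h \<in> U"
    using g h U 1 2 3 4 unfolding L_basis_def by blast
qed

text \<open>All f_ij vanish at \<open>id\<close>, and also at \<open>t12\<close> because
  \<open>a t13 = a t23\<close>, so the zero action is compatible with the squares.\<close>

lemma k_alg_rep:
  assumes h: "h \<in> {id, t12}"
  shows "alg_rep a (graded_space {h}) (gen_act {h} (\<lambda>t g _. 0))"
proof (rule graded_alg_repI)
  show "gen_act {h} (\<lambda>t g _. 0) (Tr t) (gen_act {h} (\<lambda>t g _. 0) (Tr t) v) k = f_elt a t k * v k"
    if "t \<in> transpositions3" "k \<in> {h}" for t v k
    using h that by (auto simp: transpositions3_def f_elt_conj_param conj_param_values eq)
qed (use h in \<open>auto simp: graded_space_def\<close>)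

lemma k_simple:
  assumes h: "h \<in> {id, t12}"
  shows "simple_module (alg_A a) (k_module h)"
  unfolding k_module_def by (rule graded_simple[OF k_alg_rep[OF h]]) (use h in auto)

text \<open>With \<open>p\<close> for the conjugated parameter, the tables give z z = \<gamma> z +
  \<delta> on the generator, where \<delta> is \<open>(p t23 - a t23) * (a t12 - p t13) * (a t13 - p
  t23) * (a t12 - p t12)\<close> and \<gamma> is the coefficient of \<open>Nc\<close> in
  \<open>nf_x23 a p Nabac\<close>. At all three weights \<open>p t23 = a t23\<close>, so \<delta> is
  0, and the terms of \<gamma> vanish or cancel. At \<open>t13\<close>, in contrast,
  \<open>p t23 = a t12\<close> and \<delta> is nonzero.\<close>

lemma local_verma:
  assumes g: "g \<in> {id, t12, t13 \<circ> t23}"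
  shows "local_verma a g"
proof
  show "a \<in> params3" by (rule params)
  show "g \<in> S3" using g by auto
  show "z_op a g (nf_unit Nabac) = (\<lambda>_. 0)"
  proof
    fix i
    show "z_op a g (nf_unit Nabac) i = 0"
      using g by (elim insertE emptyE; cases i)
        (simp_all add: nf_op_simps nf_unit_def conj_param_values param_values(1,2)
          algebra_simps)
  qed
qed

lemma graded_weight_vector:
  assumes rep: "alg_rep a (graded_space B) (gen_act B \<xi>)" and g: "g \<in> B" "g \<in> S3"
  shows "delta g \<in> alg_module.wt_space a (graded_module B \<xi>) g"
    and "delta g \<noteq> \<zero>\<^bsub>graded_module B \<xi>\<^esub>"
proof -
  interpret M: alg_rep a "graded_space B" "gen_act B \<xi>" by (rule rep)
  show "delta g \<in> alg_module.wt_space a (graded_module B \<xi>) g"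
    using delta_graded_space[OF g(1)] M.rep_module_ops(2)[OF delta_graded_space[OF g(1)], of "Fn (delta g)"] g(2)
    unfolding graded_module_eq M.rep.wt_space_def by (simp add: fun_eq_iff) (simp add: delta_def)
  show "delta g \<noteq> \<zero>\<^bsub>graded_module B \<xi>\<^esub>"
    by (simp add: graded_module_eq delta_nonzero)
qed

lemma k_cover_hull:
  assumes g: "g \<in> {id, t12}"
  shows "projective_cover TN TP (alg_A a) (nf_module a g) (k_module g)"
    and "injective_hull TN TP (alg_A a) (nf_module a g) (k_module g)"
proof -
  interpret V: local_verma a g by (rule local_verma) (use g in blast)
  let ?x = "\<lambda>t g _. 0 :: 'k"
  interpret K: alg_rep a "graded_space {g}" "gen_act {g} ?x" by (rule k_alg_rep[OF g])
  have gS: "g \<in> S3" using g by auto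
  note vec = graded_weight_vector[OF k_alg_rep[OF g] singletonI gS, folded k_module_def]
  show "projective_cover TN TP (alg_A a) (nf_module a g) (k_module g)"
    by (rule V.projective_cover_nf_module[OF k_simple[OF g] vec])
  \<comment> \<open>At these weights all generators annihilate \<open>nf_unit Nabac\<close>, since
    every coefficient in the three \<open>Nabac\<close> rows vanishes; it therefore spans a copy of
    the one-dimensional module.\<close>
  define h :: "(perm \<Rightarrow> 'k) \<Rightarrow> nf \<Rightarrow> 'k" where "h v = (\<lambda>i. v g * nf_unit Nabac i)" for v
  have "h \<in> lmod_hom (alg_A a) (rep_module (graded_space {g}) (gen_act {g} ?x)) (rep_module UNIV (nf_act a g))"
  proof (rule alg_module_homI[OF K.alg_module_rep_module V.V.alg_module_rep_module])
    fix x :: "'k alg_gen" and v :: "perm \<Rightarrow> 'k"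
    assume x: "x \<in> alg_gens" and v: "v \<in> carrier (rep_module (graded_space {g}) (gen_act {g} ?x))"
    have "h (gen_act {g} ?x x v) i = nf_act a g x (h v) i" for i
    proof (cases x)
      case (Fn f)
      then show ?thesis
        using nf_weight_eq_iff[OF gS, of Nabac] by (simp add: h_def nf_unit_def)
    next
      case (Tr t)
      then show ?thesis
        using g by (elim insertE emptyE; cases i)
          (simp_all add: h_def nf_op_simps nf_unit_def conj_param_values
            param_values(1,2) algebra_simps)
    qed
    then show "h (K.rep.act x v) = V.V.rep.act x (h v)"
      using x v by (auto simp del: gen_act.simps)
  qed (auto simp: h_def algebra_simps)
  then have "h \<in> lmod_hom (alg_A a) (k_module g) (nf_module a g)"
    by (simp add: k_module_def graded_module_eq nf_module_def)
  then show "injective_hull TN TP (alg_A a) (nf_module a g) (k_module g)"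
    by (rule V.injective_hull_nf_module[OF k_simple[OF g], of _ "delta g"])
      (auto simp: k_module_def graded_module_eq delta_graded_space h_def delta_simps)
qed

lemma L_cover_hull:
  shows "projective_cover TN TP (alg_A a) (nf_module a (t13 \<circ> t23)) (L_module a)"
    and "injective_hull TN TP (alg_A a) (nf_module a (t13 \<circ> t23)) (L_module a)"
proof -
  let ?g = "t13 \<circ> t23"
  interpret V: local_verma a ?g by (rule local_verma) blast
  interpret L: alg_rep a "graded_space L_basis" "gen_act L_basis (L_x a)" by (rule L_alg_rep)
  have g: "?g \<in> L_basis" "?g \<in> S3" by (simp_all add: L_basis_def)
  note vec = graded_weight_vector[OF L_alg_rep g, folded L_module_def]
  show "projective_cover TN TP (alg_A a) (nf_module a ?g) (L_module a)"
    by (rule V.projective_cover_nf_module[OF L_simple vec])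
  \<comment> \<open>Once the basis vector of weight \<open>?g\<close> goes to abac, the rest is
    forced. Applying \<open>x12\<close> and \<open>x13\<close> gives - \<open>gap\<close> times bac
    and \<open>gap\<close> times abc, which fixes the images for \<open>t13\<close> and
    \<open>t23\<close>; applying \<open>x12\<close> to abc gives - \<open>gap\<close> times bc for
    \<open>t23 \<circ> t13\<close>.\<close>
  define h :: "(perm \<Rightarrow> 'k) \<Rightarrow> nf \<Rightarrow> 'k"
    where "h v = (\<lambda>i. v ?g * nf_unit Nabac i + v t13 * nf_unit Nbac i + v t23 * nf_unit Nabc i -
      gap * v (t23 \<circ> t13) * nf_unit Nbc i)" for v
  have "h \<in> lmod_hom (alg_A a) (rep_module (graded_space L_basis) (gen_act L_basis (L_x a)))
      (rep_module UNIV (nf_act a ?g))"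
  proof (rule alg_module_homI[OF L.alg_module_rep_module V.V.alg_module_rep_module])
    fix x :: "'k alg_gen" and v :: "perm \<Rightarrow> 'k"
    assume x: "x \<in> alg_gens" and v: "v \<in> carrier (rep_module (graded_space L_basis) (gen_act L_basis (L_x a)))"
    have "h (gen_act L_basis (L_x a) x v) i = nf_act a ?g x (h v) i" for i
    proof (cases x)
      case (Fn f)
      then show ?thesis
        by (cases i) (simp_all add: h_def nf_unit_def nf_weight_def comp_assoc comp_normalize comp_normalize_closed)
    next
      case (Tr t)
      then have "t \<in> transpositions3" using x by (auto simp: alg_gens_def)
      then show ?thesis
        unfolding Tr transpositions3_def
        by (elim insertE emptyE; simp only: h_def L_x_eq; cases i)
          (simp_all add: nf_op_simps nf_unit_def conj_param_values
            param_values algebra_simps)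
    qed
    then show "h (L.rep.act x v) = V.V.rep.act x (h v)"
      using x v by (auto simp del: gen_act.simps)
  qed (auto simp: h_def algebra_simps)
  then have "h \<in> lmod_hom (alg_A a) (L_module a) (nf_module a ?g)"
    by (simp add: L_module_def graded_module_eq nf_module_def)
  then show "injective_hull TN TP (alg_A a) (nf_module a ?g) (L_module a)"
    by (rule V.injective_hull_nf_module[OF L_simple, of _ "delta ?g"])
      (auto simp: L_module_def graded_module_eq delta_graded_space g(1) h_def delta_simps)
qed

section \<open>Classification of the simple modules\<close>

lemma simple_quotient_of_verma:
  assumes M: "simple_module (alg_A a) M" and g: "g \<in> S3"
    and m: "m \<in> alg_module.wt_space a M g" "m \<noteq> \<zero>\<^bsub>M\<^esub>"
    and cover: "projective_cover TN TP (alg_A a) (nf_module a g) S" and S: "simple_module (alg_A a) S"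
  shows "lmod_iso (alg_A a) M S"
proof -
  have mod_M: "alg_module a M" using M by (simp add: simple_module_def alg_module_def)
  note V = nf_module_alg_module[OF params g, folded alg_module_left_module]
  obtain p where p: "p \<in> lmod_hom (alg_A a) (nf_module a g) M" "p (nf_unit N1) = m"
    using nf_module_universal[OF params g mod_M m(1)] by blast
  have "p ` carrier (nf_module a g) = carrier M"
    using hom_onto_simple[OF V M p(1), of "nf_unit N1"] p(2) m(2) by (simp add: nf_module_def)
  moreover obtain h where "h \<in> lmod_hom (alg_A a) (nf_module a g) S" "h ` carrier (nf_module a g) = carrier S"
    "superfluous_submodule (a_kernel (nf_module a g) S h) (alg_A a) (nf_module a g)"
    using cover by (auto simp: projective_cover_def)
  ultimately show ?thesis
    using simple_quotient_unique[OF V S M _ _ _ p(1)] by blast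
qed

lemma simple_weights:
  assumes M: "simple_module (alg_A a) M"
  shows "\<exists>g\<in>{id, t12, t13 \<circ> t23}. \<exists>m\<in>alg_module.wt_space a M g. m \<noteq> \<zero>\<^bsub>M\<^esub>"
proof -
  interpret M: alg_module a M using M by (simp add: simple_module_def alg_module_def)
  define P where "P g \<longleftrightarrow> (\<exists>m\<in>M.wt_space g. m \<noteq> \<zero>\<^bsub>M\<^esub>)" for g
  obtain m where m: "m \<in> carrier M" "m \<noteq> \<zero>\<^bsub>M\<^esub>"
    using M M.M.zero_closed unfolding simple_module_def by blast
  \<comment> \<open>The functions \<open>delta g\<close> sum to the unit, so a nonzero vector has a
    nonzero weight component.\<close>
  have "\<exists>g\<in>S3. P g"
  proof (rule ccontr)
    assume "\<not> ?thesis"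
    then have zero: "M.act (Fn (delta g)) m = \<zero>\<^bsub>M\<^esub>" if "g \<in> S3" for g
      using M.d_op_wt_space[OF that m(1)] that by (auto simp: P_def)
    have "(\<lambda>h. \<Sum>g\<in>G. delta g h :: 'k) \<in> carrier fun_S3 \<and> M.act (Fn (\<lambda>h. \<Sum>g\<in>G. delta g h)) m = \<zero>\<^bsub>M\<^esub>"
      if "finite G" "G \<subseteq> S3" for G
      using that
    proof (induction G rule: finite_induct)
      case empty
      have "(\<lambda>_. 0 :: 'k) \<in> carrier fun_S3" by (simp add: fun_S3_def)
      then show ?case
        using M.act_Fn(2)[OF m(1), of "\<lambda>_. 0" "\<lambda>_. 0" 0] m(1) by (simp add: M.scal_linear)
    next
      case (insert g G)
      then show ?case
        using M.act_Fn(1)[OF m(1), of "delta g" "\<lambda>h. \<Sum>g\<in>G. delta g h"] zero[of g]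
          fun_S3_closed(1)[of "delta g" "\<lambda>h. \<Sum>g\<in>G. delta g h :: 'k"] by simp
    qed
    from this[OF finite_S3 order_refl] have "M.act (Fn (\<lambda>h. \<Sum>g\<in>S3. delta g h)) m = \<zero>\<^bsub>M\<^esub>" ..
    moreover have "(\<lambda>h. \<Sum>g\<in>S3. delta g h :: 'k) = (\<lambda>h. if h \<in> S3 then 1 else 0)"
      by (rule ext) (simp add: delta_def)
    ultimately show False
      using M.act_Fn(4)[OF m(1) f_elt_fun_S3 f_elt_fun_S3] m(2) by simp
  qed
  \<comment> \<open>The square of the generator for \<open>t\<close> acts on weight \<open>g\<close>
    by a nonzero scalar, so the generator itself is injective there.\<close>
  moreover have step: "P (t \<circ> g)" if P: "P g" and g: "g \<in> S3" and t: "t \<in> transpositions3"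
    and nz: "a t \<noteq> conj_param a g t" for t g
  proof -
    obtain m where m: "m \<in> M.wt_space g" "m \<noteq> \<zero>\<^bsub>M\<^esub>" using P by (auto simp: P_def)
    have mM: "m \<in> carrier M" by (rule M.wt_space_closed[OF m(1)])
    have "M.act (Tr t) m \<noteq> \<zero>\<^bsub>M\<^esub>"
    proof
      assume "M.act (Tr t) m = \<zero>\<^bsub>M\<^esub>"
      then have "M.scal (a t - conj_param a g t) m = \<zero>\<^bsub>M\<^esub>"
        using M.x_op_square[OF g m(1) t] t by simp
      then have "M.scal (1 / (a t - conj_param a g t) * (a t - conj_param a g t)) m = \<zero>\<^bsub>M\<^esub>"
        unfolding M.scal_linear(2)[OF mM] by simp
      then show False using nz m(2) mM by (simp add: M.scal_linear(3))
    qed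
    then show ?thesis using M.x_op_wt_space[OF g m(1) t] by (auto simp: P_def)
  qed
  \<comment> \<open>The other three weights lead to \<open>t13 \<circ> t23\<close>: from
    \<open>t13\<close> by \<open>x12\<close>, from \<open>t23\<close> by \<open>x13\<close>, and
    from \<open>t23 \<circ> t13\<close> by \<open>x12\<close> to \<open>t23\<close>.\<close>
  have "P (t13 \<circ> t23)" if "P t13"
    using step[OF that, of t12] neq eq by (simp add: conj_param_values comp_normalize_closed)
  moreover have "P (t13 \<circ> t23)" if "P t23"
    using step[OF that, of t13] neq eq by (simp add: conj_param_values)
  moreover have "P t23" if "P (t23 \<circ> t13)"
    using step[OF that, of t12] neq eq by (simp add: conj_param_values comp_normalize)
  ultimately have "P id \<or> P t12 \<or> P (t13 \<circ> t23)"
    unfolding S3_eq by blast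
  then show ?thesis by (auto simp: P_def)
qed

end

theorem theorem2:
  fixes a :: "(nat \<Rightarrow> nat) \<Rightarrow> 'k::{alg_closed_field, field_char_0}"
  assumes "a \<in> params3" and "a t12 \<noteq> a t13" and "a t13 = a t23"
  shows
    "simple_module (alg_A a) (k_module id) \<and>
     simple_module (alg_A a) (k_module t12) \<and>
     simple_module (alg_A a) (L_module a) \<and>
     \<not> lmod_iso (alg_A a) (k_module id) (k_module t12) \<and>
     \<not> lmod_iso (alg_A a) (k_module id) (L_module a) \<and>
     \<not> lmod_iso (alg_A a) (k_module t12) (L_module a) \<and>
     (\<forall>M :: (('k alg_gen word \<Rightarrow>\<^sub>0 'k) set, 'v) module. simple_module (alg_A a) M \<longrightarrow>
        lmod_iso (alg_A a) M (k_module id) \<or>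
        lmod_iso (alg_A a) M (k_module t12) \<or>
        lmod_iso (alg_A a) M (L_module a)) \<and>
     projective_cover TYPE('n) TYPE('p) (alg_A a) (verma a id) (k_module id) \<and>
     injective_hull TYPE('n) TYPE('p) (alg_A a) (verma a id) (k_module id) \<and>
     projective_cover TYPE('n) TYPE('p) (alg_A a) (verma a t12) (k_module t12) \<and>
     injective_hull TYPE('n) TYPE('p) (alg_A a) (verma a t12) (k_module t12) \<and>
     projective_cover TYPE('n) TYPE('p) (alg_A a) (verma a (t13 \<circ> t23)) (L_module a) \<and>
     injective_hull TYPE('n) TYPE('p) (alg_A a) (verma a (t13 \<circ> t23)) (L_module a)"
proof -
  interpret special_params a using assms by unfold_locales
  have k: "id \<in> {id, t12}" "t12 \<in> {id, t12}" by auto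
  have not_iso:
    "\<not> lmod_iso (alg_A a) (k_module id) (k_module t12)"
    "\<not> lmod_iso (alg_A a) (k_module id) (L_module a)"
    "\<not> lmod_iso (alg_A a) (k_module t12) (L_module a)"
    unfolding k_module_def L_module_def
    by (rule graded_not_iso[OF k_alg_rep[OF k(1)] k_alg_rep[OF k(2)], of id]
        graded_not_iso[OF k_alg_rep[OF k(1)] L_alg_rep, of id]
        graded_not_iso[OF k_alg_rep[OF k(2)] L_alg_rep, of t12]; simp add: L_basis_def)+
  have classification: "lmod_iso (alg_A a) M (k_module id) \<or> lmod_iso (alg_A a) M (k_module t12) \<or>
      lmod_iso (alg_A a) M (L_module a)"
    if M: "simple_module (alg_A a) M" for M :: "(('k alg_gen word \<Rightarrow>\<^sub>0 'k) set, 'v) module"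
  proof -
    obtain g m where g: "g \<in> {id, t12, t13 \<circ> t23}" and m: "m \<in> alg_module.wt_space a M g" "m \<noteq> \<zero>\<^bsub>M\<^esub>"
      using simple_weights[OF M] by blast
    show ?thesis
      using g m
        simple_quotient_of_verma[OF M _ _ _ k_cover_hull(1)[OF k(1)] k_simple[OF k(1)]]
        simple_quotient_of_verma[OF M _ _ _ k_cover_hull(1)[OF k(2)] k_simple[OF k(2)]]
        simple_quotient_of_verma[OF M _ _ _ L_cover_hull(1) L_simple]
      by auto
  qed
  \<comment> \<open>Covers and hulls are known for the coordinate model; these rules carry them to
    the tensor products of the statement.\<close>
  note cong = projective_cover_cong[OF _ verma_iso_nf_module[OF assms(1)]]
    injective_hull_cong[OF _ verma_iso_nf_module[OF assms(1)]]
  note verma = verma_alg_module[folded alg_module_left_module]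
  show ?thesis
    by (intro conjI allI impI k_simple k L_simple not_iso classification cong verma k_cover_hull L_cover_hull) simp_all
qed

end
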